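(* Let $(W,S)$ be a finite irreducible Coxeter system with Hiller Schubert calculus as in the context, let $J\subseteq S$, and let $v\in W^J$ (equivalently, $\mathrm{Des}(v)\cap J=\varnothing$). Then the ideal $J_v:=\Bbbk\text{-span of }\{S_u:u\ge v\}$ of the coinvariant algebra $\Bbbk[V]/(\Bbbk[V]^W_+)$ is generated as an ideal by the set $\{S_u: u\in W^J,\ u\ge v\}$.
   Context: $W$ acts on its reflection representation $V$ over a subfield $\Bbbk\subseteq\mathbb{R}$, $\Bbbk[V]=\mathrm{Sym}(V^\star)$. A root system $\Phi\subset V^\star$ is a $W$-stable set of functionals $\pm\alpha$ whose kernels are exactly the reflecting hyperplanes; a chamber is fixed, $\Phi^+$ are the roots positive on it, $S$ the reflections in its walls, $\alpha_s$ the positive root vanishing on the hyperplane of $s$. $\partial_s f=(f-s(f))/\alpha_s$, $\partial_u=\partial_{s_{i_1}}\cdots\partial_{s_{i_\ell}}$ for a reduced word of $u$. With $w_0$ the longest element, $S_{w_0}=\frac1{|W|}\prod_{\alpha\in\Phi^+}\alpha$ and $S_w=\partial_{w^{-1}w_0}S_{w_0}$; their images form a basis of the coinvariant algebra $\Bbbk[V]/(\Bbbk[V]^W_+)$ (quotient by the ideal generated by positive-degree $W$-invariants), and $S_w$ denotes also this image. $\le$ is Bruhat order, $\ell$ the length, $\mathrm{Des}(u)=\{s\in S:\ell(us)<\ell(u)\}$, $W_J=\langle J\rangle$, and $W^J=\{u:\mathrm{Des}(u)\cap J=\varnothing\}$ the minimal-length coset representatives of $W/W_J$. (The span $J_v$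 is an ideal.) *)

theory Defs
  imports
    "HOL-Analysis.Cartesian_Space"
    "HOL-Library.Poly_Mapping"
    "HOL-Algebra.Algebraic_Closure_Type"
    "HOL-Algebra.Generated_Groups"
begin

subsection \<open>Coxeter systems\<close>

definition word_prod :: "('g, 'm) monoid_scheme \<Rightarrow> 'g list \<Rightarrow> 'g" where
  "word_prod W xs = foldr (\<otimes>\<^bsub>W\<^esub>) xs \<one>\<^bsub>W\<^esub>"

text \<open>One elementary step: deletion of a relator \<open>(st)\<close> to the power \<open>m s t\<close> inside a word.\<close>

inductive coxeter_step :: "'g set \<Rightarrow> ('g \<Rightarrow> 'g \<Rightarrow> nat) \<Rightarrow> 'g list \<Rightarrow> 'g list \<Rightarrow> bool"
  for S m where
  "s \<in> S \<Longrightarrow> t \<in> S \<Longrightarrow>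
     coxeter_step S m (xs @ concat (replicate (m s t) [s, t]) @ ys) (xs @ ys)"

text \<open>The group has the presentation with generators \<open>S\<close> and relations \<open>(st)\<^bsup>m s t\<^esup> = 1\<close>
  for a Coxeter matrix \<open>m\<close>, where the value \<open>0\<close> encodes \<open>\<infinity>\<close> (no relation).  As \<open>m s s = 1\<close>,
  the relators include \<open>ss\<close>, so words in \<open>S\<close> without formal inverses suffice.\<close>

definition coxeter_system :: "('g, 'm) monoid_scheme \<Rightarrow> 'g set \<Rightarrow> bool" where
  "coxeter_system W S \<longleftrightarrow>
     group W \<and> S \<subseteq> carrier W \<and> generate W S = carrier W \<and>
     (\<exists>m. (\<forall>s\<in>S. \<forall>t\<in>S. m s t = m t s \<and> (m s t = 1 \<longleftrightarrow> s = t)) \<and>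
          (\<forall>xs\<in>lists S. \<forall>ys\<in>lists S.
             word_prod W xs = word_prod W ys \<longleftrightarrow> equivclp (coxeter_step S m) xs ys))"

text \<open>The Coxeter graph is nonempty and connected: distinct \<open>s\<close>, \<open>t\<close> are joined
  iff they do not commute.\<close>

definition irreducible_coxeter :: "('g, 'm) monoid_scheme \<Rightarrow> 'g set \<Rightarrow> bool" where
  "irreducible_coxeter W S \<longleftrightarrow>
     S \<noteq> {} \<and>
     \<not> (\<exists>A B. A \<noteq> {} \<and> B \<noteq> {} \<and> A \<inter> B = {} \<and> A \<union> B = S \<and>
            (\<forall>a\<in>A. \<forall>b\<in>B. a \<otimes>\<^bsub>W\<^esub> b = b \<otimes>\<^bsub>W\<^esub> a))"

definition cox_length :: "('g, 'm) monoid_scheme \<Rightarrow> 'g set \<Rightarrow> 'g \<Rightarrow> nat" where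
  "cox_length W S w = (LEAST n. \<exists>xs\<in>lists S. length xs = n \<and> word_prod W xs = w)"

definition reduced_word :: "('g, 'm) monoid_scheme \<Rightarrow> 'g set \<Rightarrow> 'g \<Rightarrow> 'g list \<Rightarrow> bool" where
  "reduced_word W S w xs \<longleftrightarrow>
     xs \<in> lists S \<and> word_prod W xs = w \<and> length xs = cox_length W S w"

definition cox_reflections :: "('g, 'm) monoid_scheme \<Rightarrow> 'g set \<Rightarrow> 'g set" where
  "cox_reflections W S = {w \<otimes>\<^bsub>W\<^esub> s \<otimes>\<^bsub>W\<^esub> inv\<^bsub>W\<^esub> w |w s. w \<in> carrier W \<and> s \<in> S}"

definition bruhat_le :: "('g, 'm) monoid_scheme \<Rightarrow> 'g set \<Rightarrow> 'g \<Rightarrow> 'g \<Rightarrow> bool" where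
  "bruhat_le W S u w \<longleftrightarrow>
     (u, w) \<in> {(x, x \<otimes>\<^bsub>W\<^esub> t) |x t. x \<in> carrier W \<and> t \<in> cox_reflections W S \<and>
                 cox_length W S x < cox_length W S (x \<otimes>\<^bsub>W\<^esub> t)}\<^sup>*"

definition longest_elem :: "('g, 'm) monoid_scheme \<Rightarrow> 'g set \<Rightarrow> 'g" where
  "longest_elem W S =
     (THE w. w \<in> carrier W \<and> (\<forall>u\<in>carrier W. cox_length W S u \<le> cox_length W S w))"

definition descents :: "('g, 'm) monoid_scheme \<Rightarrow> 'g set \<Rightarrow> 'g \<Rightarrow> 'g set" where
  "descents W S u = {s \<in> S. cox_length W S (u \<otimes>\<^bsub>W\<^esub> s) < cox_length W S u}"

definition min_coset_reps :: "('g, 'm) monoid_scheme \<Rightarrow> 'g set \<Rightarrow> 'g set \<Rightarrow> 'g set" where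
  "min_coset_reps W S J = {u \<in> carrier W. descents W S u \<inter> J = {}}"


subsection \<open>Reflection representation, roots and chambers\<close>

text \<open>The ground field is a type \<open>'k\<close> with an embedding \<open>\<iota>\<close> into the reals, used only for signs;
  \<open>V\<close> is \<open>'k ^ 'n\<close>, and elements of the dual space are linear maps \<open>'k ^ 'n \<Rightarrow> 'k\<close>.\<close>

definition real_embedding :: "('k::field \<Rightarrow> real) \<Rightarrow> bool" where
  "real_embedding \<iota> \<longleftrightarrow>
     \<iota> 1 = 1 \<and> (\<forall>a b. \<iota> (a + b) = \<iota> a + \<iota> b) \<and> (\<forall>a b. \<iota> (a * b) = \<iota> a * \<iota> b)"

definition fixed_space :: "('k::field ^ 'n \<Rightarrow> 'k ^ 'n) \<Rightarrow> ('k ^ 'n) set" where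
  "fixed_space T = {x. T x = x}"

definition is_reflection :: "('k::field ^ 'n \<Rightarrow> 'k ^ 'n) \<Rightarrow> bool" where
  "is_reflection T \<longleftrightarrow>
     Vector_Spaces.linear (*s) (*s) T \<and> T \<circ> T = id \<and> vec.dim (fixed_space T) + 1 = CARD('n)"

definition kernel_of :: "('k::field ^ 'n \<Rightarrow> 'k) \<Rightarrow> ('k ^ 'n) set" where
  "kernel_of \<alpha> = {x. \<alpha> x = 0}"

text \<open>A faithful linear representation without nonzero fixed vectors in which \<open>S\<close> acts by
  reflections.  Together with \<open>S\<close> being the set of reflections in the walls of a chamber (below),
  this determines the reflection representation.\<close>

definition reflection_representation ::
  "('g, 'm) monoid_scheme \<Rightarrow> 'g set \<Rightarrow> ('g \<Rightarrow> 'k::field ^ 'n \<Rightarrow> 'k ^ 'n) \<Rightarrow> bool" where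
  "reflection_representation W S \<rho> \<longleftrightarrow>
     (\<forall>w\<in>carrier W. Vector_Spaces.linear (*s) (*s) (\<rho> w)) \<and>
     \<rho> \<one>\<^bsub>W\<^esub> = id \<and>
     (\<forall>u\<in>carrier W. \<forall>w\<in>carrier W. \<rho> (u \<otimes>\<^bsub>W\<^esub> w) = \<rho> u \<circ> \<rho> w) \<and>
     inj_on \<rho> (carrier W) \<and>
     (\<forall>s\<in>S. is_reflection (\<rho> s)) \<and>
     (\<forall>x. (\<forall>w\<in>carrier W. \<rho> w x = x) \<longrightarrow> x = 0)"

definition reflecting_hyperplanes ::
  "('g, 'm) monoid_scheme \<Rightarrow> ('g \<Rightarrow> 'k::field ^ 'n \<Rightarrow> 'k ^ 'n) \<Rightarrow> ('k ^ 'n) set set" where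
  "reflecting_hyperplanes W \<rho> = {fixed_space (\<rho> r) |r. r \<in> carrier W \<and> is_reflection (\<rho> r)}"

text \<open>Exactly one pair \<open>\<plusminus>\<alpha>\<close> for every reflecting hyperplane; \<open>W\<close> acts on functionals by
  \<open>w \<cdot> \<alpha> = \<alpha> \<circ> w\<^sup>-\<^sup>1\<close>.\<close>

definition root_system ::
  "('g, 'm) monoid_scheme \<Rightarrow> ('g \<Rightarrow> 'k::field ^ 'n \<Rightarrow> 'k ^ 'n) \<Rightarrow> ('k ^ 'n \<Rightarrow> 'k) set \<Rightarrow> bool" where
  "root_system W \<rho> \<Phi> \<longleftrightarrow>
     (\<forall>\<alpha>\<in>\<Phi>. Vector_Spaces.linear (*s) (*) \<alpha>) \<and>
     (\<forall>w\<in>carrier W. \<forall>\<alpha>\<in>\<Phi>. \<alpha> \<circ> \<rho> (inv\<^bsub>W\<^esub> w) \<in> \<Phi>) \<and>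
     kernel_of ` \<Phi> = reflecting_hyperplanes W \<rho> \<and>
     (\<forall>\<alpha>\<in>\<Phi>. (\<lambda>x. - \<alpha> x) \<in> \<Phi>) \<and>
     (\<forall>\<alpha>\<in>\<Phi>. \<forall>\<beta>\<in>\<Phi>. kernel_of \<alpha> = kernel_of \<beta> \<longrightarrow> \<beta> = \<alpha> \<or> \<beta> = (\<lambda>x. - \<alpha> x))"

text \<open>A chamber is the class of a point off all hyperplanes under the relation ``on the same side
  of every hyperplane''; over the reals these are the connected components of the complement of
  the hyperplanes, and the description makes sense over subfields.\<close>

definition chamber ::
  "('k::field \<Rightarrow> real) \<Rightarrow> ('k ^ 'n \<Rightarrow> 'k) set \<Rightarrow> ('k ^ 'n) set \<Rightarrow> bool" where
  "chamber \<iota> \<Phi> C \<longleftrightarrow>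
     (\<exists>x. (\<forall>\<alpha>\<in>\<Phi>. \<alpha> x \<noteq> 0) \<and> C = {y. \<forall>\<alpha>\<in>\<Phi>. \<iota> (\<alpha> x) * \<iota> (\<alpha> y) > 0})"

definition positive_roots ::
  "('k::field \<Rightarrow> real) \<Rightarrow> ('k ^ 'n \<Rightarrow> 'k) set \<Rightarrow> ('k ^ 'n) set \<Rightarrow> ('k ^ 'n \<Rightarrow> 'k) set" where
  "positive_roots \<iota> \<Phi> C = {\<alpha> \<in> \<Phi>. \<forall>x\<in>C. \<iota> (\<alpha> x) > 0}"

definition closed_chamber ::
  "('k::field \<Rightarrow> real) \<Rightarrow> ('k ^ 'n \<Rightarrow> 'k) set \<Rightarrow> ('k ^ 'n) set \<Rightarrow> ('k ^ 'n) set" where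
  "closed_chamber \<iota> \<Phi> C = {x. \<forall>\<alpha>\<in>positive_roots \<iota> \<Phi> C. \<iota> (\<alpha> x) \<ge> 0}"

text \<open>A wall is a reflecting hyperplane whose intersection with the closed chamber has
  codimension one.\<close>

definition walls ::
  "('g, 'm) monoid_scheme \<Rightarrow> ('g \<Rightarrow> 'k::field ^ 'n \<Rightarrow> 'k ^ 'n) \<Rightarrow> ('k \<Rightarrow> real) \<Rightarrow>
   ('k ^ 'n \<Rightarrow> 'k) set \<Rightarrow> ('k ^ 'n) set \<Rightarrow> ('k ^ 'n) set set" where
  "walls W \<rho> \<iota> \<Phi> C =
     {H \<in> reflecting_hyperplanes W \<rho>. vec.span (H \<inter> closed_chamber \<iota> \<Phi> C) = H}"

definition wall_reflections ::
  "('g, 'm) monoid_scheme \<Rightarrow> ('g \<Rightarrow> 'k::field ^ 'n \<Rightarrow> 'k ^ 'n) \<Rightarrow> ('k \<Rightarrow> real) \<Rightarrow>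
   ('k ^ 'n \<Rightarrow> 'k) set \<Rightarrow> ('k ^ 'n) set \<Rightarrow> 'g set" where
  "wall_reflections W \<rho> \<iota> \<Phi> C =
     {s \<in> carrier W. is_reflection (\<rho> s) \<and> fixed_space (\<rho> s) \<in> walls W \<rho> \<iota> \<Phi> C}"

definition simple_root ::
  "('g \<Rightarrow> 'k::field ^ 'n \<Rightarrow> 'k ^ 'n) \<Rightarrow> ('k \<Rightarrow> real) \<Rightarrow>
   ('k ^ 'n \<Rightarrow> 'k) set \<Rightarrow> ('k ^ 'n) set \<Rightarrow> 'g \<Rightarrow> 'k ^ 'n \<Rightarrow> 'k" where
  "simple_root \<rho> \<iota> \<Phi> C s =
     (THE \<alpha>. \<alpha> \<in> positive_roots \<iota> \<Phi> C \<and> (\<forall>x\<in>fixed_space (\<rho> s). \<alpha> x = 0))"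


subsection \<open>The symmetric algebra of the dual space and divided differences\<close>

text \<open>\<open>Sym(V\<^sup>\<star>)\<close> is the polynomial ring in the coordinate functionals of \<open>'k ^ 'n\<close>.\<close>

type_synonym ('n, 'k) mpoly = "('n \<Rightarrow>\<^sub>0 nat) \<Rightarrow>\<^sub>0 'k"

definition poly_const :: "'k::zero \<Rightarrow> ('n, 'k) mpoly" where
  "poly_const c = Poly_Mapping.single 0 c"

definition poly_var :: "'n \<Rightarrow> ('n, 'k::zero_neq_one) mpoly" where
  "poly_var i = Poly_Mapping.single (Poly_Mapping.single i 1) 1"

definition poly_subst ::
  "('n::finite \<Rightarrow> ('n, 'k::comm_ring_1) mpoly) \<Rightarrow> ('n, 'k) mpoly \<Rightarrow> ('n, 'k) mpoly" where
  "poly_subst \<sigma> f =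
     (\<Sum>m\<in>Poly_Mapping.keys f. poly_const (Poly_Mapping.lookup f m) *
        (\<Prod>i\<in>UNIV. \<sigma> i ^ Poly_Mapping.lookup m i))"

definition linear_form :: "('k::field ^ 'n::finite \<Rightarrow> 'k) \<Rightarrow> ('n, 'k) mpoly" where
  "linear_form \<alpha> = (\<Sum>i\<in>UNIV. poly_const (\<alpha> (axis i 1)) * poly_var i)"

text \<open>The algebra automorphism extending the action \<open>w \<cdot> \<alpha> = \<alpha> \<circ> w\<^sup>-\<^sup>1\<close> on functionals.\<close>

definition poly_act ::
  "('g, 'm) monoid_scheme \<Rightarrow> ('g \<Rightarrow> 'k::field ^ 'n \<Rightarrow> 'k ^ 'n) \<Rightarrow> 'g \<Rightarrow>
   ('n::finite, 'k) mpoly \<Rightarrow> ('n, 'k) mpoly" where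
  "poly_act W \<rho> w = poly_subst (\<lambda>i. linear_form (\<lambda>x. \<rho> (inv\<^bsub>W\<^esub> w) x $ i))"

definition divided_diff ::
  "('g, 'm) monoid_scheme \<Rightarrow> ('g \<Rightarrow> 'k::field ^ 'n \<Rightarrow> 'k ^ 'n) \<Rightarrow> ('k \<Rightarrow> real) \<Rightarrow>
   ('k ^ 'n \<Rightarrow> 'k) set \<Rightarrow> ('k ^ 'n) set \<Rightarrow> 'g \<Rightarrow> ('n::finite, 'k) mpoly \<Rightarrow> ('n, 'k) mpoly" where
  "divided_diff W \<rho> \<iota> \<Phi> C s f =
     (THE g. linear_form (simple_root \<rho> \<iota> \<Phi> C s) * g = f - poly_act W \<rho> s f)"

definition divided_diff_elem ::
  "('g, 'm) monoid_scheme \<Rightarrow> 'g set \<Rightarrow> ('g \<Rightarrow> 'k::field ^ 'n \<Rightarrow> 'k ^ 'n) \<Rightarrow> ('k \<Rightarrow> real) \<Rightarrow>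
   ('k ^ 'n \<Rightarrow> 'k) set \<Rightarrow> ('k ^ 'n) set \<Rightarrow> 'g \<Rightarrow> ('n::finite, 'k) mpoly \<Rightarrow> ('n, 'k) mpoly" where
  "divided_diff_elem W S \<rho> \<iota> \<Phi> C u =
     foldr (divided_diff W \<rho> \<iota> \<Phi> C) (SOME xs. reduced_word W S u xs)"

definition schubert_top ::
  "('g, 'm) monoid_scheme \<Rightarrow> ('k::field \<Rightarrow> real) \<Rightarrow>
   ('k ^ 'n \<Rightarrow> 'k) set \<Rightarrow> ('k ^ 'n) set \<Rightarrow> ('n::finite, 'k) mpoly" where
  "schubert_top W \<iota> \<Phi> C =
     poly_const (inverse (of_nat (card (carrier W)))) * (\<Prod>\<alpha>\<in>positive_roots \<iota> \<Phi> C. linear_form \<alpha>)"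

definition schubert ::
  "('g, 'm) monoid_scheme \<Rightarrow> 'g set \<Rightarrow> ('g \<Rightarrow> 'k::field ^ 'n \<Rightarrow> 'k ^ 'n) \<Rightarrow> ('k \<Rightarrow> real) \<Rightarrow>
   ('k ^ 'n \<Rightarrow> 'k) set \<Rightarrow> ('k ^ 'n) set \<Rightarrow> 'g \<Rightarrow> ('n::finite, 'k) mpoly" where
  "schubert W S \<rho> \<iota> \<Phi> C w =
     divided_diff_elem W S \<rho> \<iota> \<Phi> C (inv\<^bsub>W\<^esub> w \<otimes>\<^bsub>W\<^esub> longest_elem W S) (schubert_top W \<iota> \<Phi> C)"


subsection \<open>The coinvariant algebra\<close>

definition poly_ring :: "('n::finite, 'k::field) mpoly ring" where
  "poly_ring = ring_of_type_algebra"

definition positive_invariants ::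
  "('g, 'm) monoid_scheme \<Rightarrow> ('g \<Rightarrow> 'k::field ^ 'n \<Rightarrow> 'k ^ 'n) \<Rightarrow> ('n::finite, 'k) mpoly set" where
  "positive_invariants W \<rho> =
     {f. (\<forall>w\<in>carrier W. poly_act W \<rho> w f = f) \<and> Poly_Mapping.lookup f 0 = 0}"

definition invariant_ideal ::
  "('g, 'm) monoid_scheme \<Rightarrow> ('g \<Rightarrow> 'k::field ^ 'n \<Rightarrow> 'k ^ 'n) \<Rightarrow> ('n::finite, 'k) mpoly set" where
  "invariant_ideal W \<rho> = Idl\<^bsub>poly_ring\<^esub> (positive_invariants W \<rho>)"

definition coinvariant_algebra ::
  "('g, 'm) monoid_scheme \<Rightarrow> ('g \<Rightarrow> 'k::field ^ 'n \<Rightarrow> 'k ^ 'n) \<Rightarrow>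
   ('n::finite, 'k) mpoly set ring" where
  "coinvariant_algebra W \<rho> = poly_ring Quot invariant_ideal W \<rho>"

definition coinv_class ::
  "('g, 'm) monoid_scheme \<Rightarrow> ('g \<Rightarrow> 'k::field ^ 'n \<Rightarrow> 'k ^ 'n) \<Rightarrow>
   ('n::finite, 'k) mpoly \<Rightarrow> ('n, 'k) mpoly set" where
  "coinv_class W \<rho> f = invariant_ideal W \<rho> +>\<^bsub>poly_ring\<^esub> f"

text \<open>Scalars act through the classes of constant polynomials.\<close>

definition coinv_span ::
  "('g, 'm) monoid_scheme \<Rightarrow> ('g \<Rightarrow> 'k::field ^ 'n \<Rightarrow> 'k ^ 'n) \<Rightarrow>
   ('n::finite, 'k) mpoly set set \<Rightarrow> ('n, 'k) mpoly set set" where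
  "coinv_span W \<rho> A =
     {finsum (coinvariant_algebra W \<rho>)
        (\<lambda>a. coinv_class W \<rho> (poly_const (c a)) \<otimes>\<^bsub>coinvariant_algebra W \<rho>\<^esub> a) F |F c.
        finite F \<and> F \<subseteq> A}"

definition schubert_class ::
  "('g, 'm) monoid_scheme \<Rightarrow> 'g set \<Rightarrow> ('g \<Rightarrow> 'k::field ^ 'n \<Rightarrow> 'k ^ 'n) \<Rightarrow> ('k \<Rightarrow> real) \<Rightarrow>
   ('k ^ 'n \<Rightarrow> 'k) set \<Rightarrow> ('k ^ 'n) set \<Rightarrow> 'g \<Rightarrow> ('n::finite, 'k) mpoly set" where
  "schubert_class W S \<rho> \<iota> \<Phi> C w = coinv_class W \<rho> (schubert W S \<rho> \<iota> \<Phi> C w)"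

definition schubert_ideal ::
  "('g, 'm) monoid_scheme \<Rightarrow> 'g set \<Rightarrow> ('g \<Rightarrow> 'k::field ^ 'n \<Rightarrow> 'k ^ 'n) \<Rightarrow> ('k \<Rightarrow> real) \<Rightarrow>
   ('k ^ 'n \<Rightarrow> 'k) set \<Rightarrow> ('k ^ 'n) set \<Rightarrow> 'g \<Rightarrow> ('n::finite, 'k) mpoly set set" where
  "schubert_ideal W S \<rho> \<iota> \<Phi> C v =
     coinv_span W \<rho> {schubert_class W S \<rho> \<iota> \<Phi> C u |u. u \<in> carrier W \<and> bruhat_le W S v u}"

end

theory Submission
  imports Defs
begin

text \<open>
  Divided differences satisfy a twisted Leibniz rule, and commuting a linear form past a composite
  along a word deletes one letter at a time; hence composites along reduced words depend only on
  the group element and those along non-reduced words vanish, which gives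
  \<open>\<partial>\<^sub>u S\<^sub>w = S\<^bsub>w u\<^sup>-\<^sup>1\<^esub>\<close> or \<open>0\<close>.  Peeling off the values of the longest operators shows that every
  polynomial \<open>f\<close> is congruent to \<open>\<Sum>\<^sub>u (\<partial>\<^sub>u f)(0) S\<^sub>u\<close> modulo the invariants.  By the Leibniz rule
  \<open>(\<partial>\<^sub>u (S\<^sub>x f))(0)\<close> vanishes unless \<open>x \<le> u\<close>, so the span of \<open>S\<^sub>u\<close>, \<open>u \<ge> v\<close>, is an ideal.  For \<open>x\<close> in \<open>W\<^sup>J\<close>
  the polynomial \<open>S\<^sub>x\<close> is invariant under \<open>W\<^sub>J\<close>; therefore, for \<open>z\<close> in \<open>W\<^sub>J\<close>, the product \<open>S\<^sub>x S\<^sub>z\<close> is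
  \<open>S\<^bsub>x z\<^esub>\<close> plus terms \<open>S\<^bsub>x' z'\<^esub>\<close> with \<open>x' > x\<close> in \<open>W\<^sup>J\<close>.  Descending induction on \<open>x\<close> gives the generation
  statement, since \<open>v \<le> x z\<close> implies \<open>v \<le> x\<close> for \<open>v\<close> in \<open>W\<^sup>J\<close>.
\<close>

text \<open>Word independence comes from the commutation formula itself. Deleting a letter from a
  word for \<open>w\<close> multiplies \<open>w\<close> on the right by the reflection in a root,
  and for a reduced word these roots run exactly once through the inversions of \<open>w\<close>.
  The correction terms therefore see only \<open>w\<close>, and agreement of two composites spreads
  from constants to all polynomials. The combinatorics this takes (strong exchange, lifting in
  Bruhat order, the longest element) is drawn from the action on signed roots. The embedding \<iota>
  supplies positivity: the functional \<open>inner x0\<close> pairs positively with every positive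
  coroot, so the operator of \<open>w\<close> sends its power of exponent \<open>len w\<close> to a
  positive constant. From this the constant \<kappa>, by which all coefficients are divided, is
  nonzero. In the descending induction, terms from the coset of \<open>x\<close> itself could spoil
  triangularity. Their coefficients form a delta: operators along \<open>W_J\<close> pass through
  \<open>S_x\<close>, and what remains is a multiple of the constant term of an operator applied to
  \<open>S_z\<close>.\<close>

abbreviation lookup where "lookup \<equiv> Poly_Mapping.lookup"
abbreviation keys where "keys \<equiv> Poly_Mapping.keys"
abbreviation single where "single \<equiv> Poly_Mapping.single"

section \<open>Polynomials\<close>

lemma poly_const_simps:
  "poly_const (0::'k::comm_ring_1) = 0"
  "poly_const (1::'k::comm_ring_1) = 1"
  "poly_const (a + b :: 'k) = poly_const a + poly_const b"
  "poly_const (a - b :: 'k) = poly_const a - poly_const b"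
  "poly_const (- a :: 'k) = - poly_const a"
  "poly_const (a * b :: 'k) = poly_const a * poly_const b"
  by (simp_all add: poly_const_def single_add single_diff single_uminus mult_single)

lemma poly_const_sum: "poly_const (\<Sum>x\<in>A. f x :: 'k::comm_ring_1) = (\<Sum>x\<in>A. poly_const (f x))"
  by (induction A rule: infinite_finite_induct) (simp_all add: poly_const_simps)

lemma lookup_const_0 [simp]: "lookup (poly_const c) 0 = c"
  by (simp add: poly_const_def)

lemma add_eq_0_poly_mapping:
  fixes m n :: "'n \<Rightarrow>\<^sub>0 nat"
  assumes "m + n = 0" shows "m = 0" "n = 0"
  using assms by (auto simp: poly_mapping_eq_iff fun_eq_iff lookup_add)

lemma single_mult_lookup:
  fixes f :: "('n, 'k::comm_ring_1) mpoly"
  shows "lookup (single m c * f) (m + n) = c * lookup f n"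
proof -
  have "lookup (single m c * f) (m + n)
      = (\<Sum>l. lookup (single m c) l * (\<Sum>q. lookup f q when m + n = l + q))"
    by (simp add: lookup_mult)
  also have "\<dots> = (\<Sum>l. (c * (\<Sum>q. lookup f q when m + n = l + q)) when l = m)"
    by (rule Sum_any.cong) (auto simp: lookup_single when_def)
  also have "\<dots> = c * (\<Sum>q. lookup f q when n = q)"
    by (simp add: Sum_any_when_equal)
  also have "\<dots> = c * lookup f n"
    by simp
  finally show ?thesis .
qed

lemma single_mult_lookup_eq_0:
  fixes f :: "('n, 'k::comm_ring_1) mpoly"
  assumes "\<And>n. n \<in> keys f \<Longrightarrow> k \<noteq> m + n"
  shows "lookup (single m c * f) k = 0"
proof (rule ccontr)
  assume "lookup (single m c * f) k \<noteq> 0"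
  hence "k \<in> keys (single m c * f)" by (simp add: in_keys_iff)
  then obtain a b where "a \<in> keys (single m c)" "b \<in> keys f" "k = a + b"
    using keys_mult[of "single m c" f] by auto
  thus False using assms by (auto split: if_splits)
qed

lemma lookup_0_mult: "lookup (f * g) 0 = lookup f 0 * lookup g 0"
  for f g :: "('n, 'k::comm_ring_1) mpoly"
proof -
  have "lookup (f * g) 0 = (\<Sum>l. lookup f l * (\<Sum>q. lookup g q when 0 = l + q))"
    by (simp add: lookup_mult)
  also have "\<dots> = (\<Sum>l. (lookup f 0 * lookup g 0) when l = (0 :: 'n \<Rightarrow>\<^sub>0 nat))"
  proof (rule Sum_any.cong)
    fix l :: "'n \<Rightarrow>\<^sub>0 nat"
    have "(\<Sum>q. lookup g q when 0 = l + q) = (\<Sum>q. (lookup g q when l = 0) when q = 0)"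
      by (rule Sum_any.cong) (auto simp: when_def dest: add_eq_0_poly_mapping add_eq_0_poly_mapping[OF sym])
    thus "lookup f l * (\<Sum>q. lookup g q when 0 = l + q) = ((lookup f 0 * lookup g 0) when l = 0)"
      by (auto simp: when_def)
  qed
  finally show ?thesis by simp
qed

lemma mpoly_sum_singles: "f = (\<Sum>m\<in>keys f. single m (lookup f m))"
  by (rule poly_mapping_eqI)
     (auto simp: lookup_sum lookup_single when_def in_keys_iff sum.delta')

lemma single_as_vars:
  fixes m :: "'n::finite \<Rightarrow>\<^sub>0 nat"
  shows "single m (c :: 'k::comm_ring_1) = poly_const c * (\<Prod>i\<in>UNIV. poly_var i ^ lookup m i)"
proof -
  have pow: "poly_var i ^ n = single (single i n) (1::'k)" for i :: 'n and n
    by (induction n) (simp_all add: poly_var_def mult_single flip: single_add)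
  have "(\<Prod>i\<in>A. single (single i (lookup m i)) (1::'k)) = single (\<Sum>i\<in>A. single i (lookup m i)) 1"
    if "finite A" for A
    using that by (induction A rule: finite_induct) (simp_all add: mult_single)
  moreover have "(\<Sum>i\<in>UNIV. single i (lookup m i)) = m"
    by (rule poly_mapping_eqI) (simp add: lookup_sum lookup_single when_def sum.delta')
  ultimately show ?thesis by (simp add: pow poly_const_def mult_single)
qed

text \<open>Adding one variable factor at a time matches the Leibniz rule, which is how identities
  of operators are verified below.\<close>

lemma mpoly_induct [case_names const add var]:
  fixes f :: "('n::finite, 'k::comm_ring_1) mpoly"
  assumes c: "\<And>c. P (poly_const c)"
    and a: "\<And>f g. P f \<Longrightarrow> P g \<Longrightarrow> P (f + g)"
    and v: "\<And>i f. P f \<Longrightarrow> P (poly_var i * f)"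
  shows "P f"
proof -
  have pw: "P (poly_var i ^ n * g)" if "P g" for i g n
    using that by (induction n) (simp_all add: v mult.assoc)
  have pr: "P ((\<Prod>i\<in>A. poly_var i ^ lookup m i) * g)" if "finite A" "P g" for A g m
    using that by (induction A rule: finite_induct) (simp_all add: pw mult.assoc)
  have P1: "P (single m c)" for m c
    by (subst single_as_vars, subst mult.commute) (rule pr[OF finite c])
  have P2: "P (\<Sum>m\<in>A. single m (lookup f m))" if "finite A" for A
    using that
  proof (induction A rule: finite_induct)
    case empty
    show ?case using c[of 0] by (simp add: poly_const_simps)
  next
    case (insert x F)
    thus ?case by (simp add: a P1)
  qed
  show ?thesis
    by (subst mpoly_sum_singles) (rule P2[OF finite_keys])
qed

subsection \<open>Substitution homomorphisms\<close>

text \<open>The defining sum runs over \<open>keys f\<close>, which changes under addition; a common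
  larger index set makes additivity visible.\<close>

lemma poly_subst_superset:
  fixes f :: "('n::finite, 'k::comm_ring_1) mpoly"
  assumes "finite A" "keys f \<subseteq> A"
  shows "poly_subst \<sigma> f = (\<Sum>m\<in>A. poly_const (lookup f m) * (\<Prod>i\<in>UNIV. \<sigma> i ^ lookup m i))"
  unfolding poly_subst_def
  by (rule sum.mono_neutral_left) (use assms in \<open>auto simp: in_keys_iff poly_const_simps\<close>)

lemma poly_subst_add: "poly_subst \<sigma> (f + g) = poly_subst \<sigma> f + poly_subst \<sigma> g"
proof -
  let ?A = "keys f \<union> keys g"
  have "keys (f + g) \<subseteq> ?A" by (rule keys_add)
  thus ?thesis
    by (simp add: poly_subst_superset[of ?A] lookup_add poly_const_simps sum.distrib distrib_right)
qed

lemma poly_subst_const [simp]: "poly_subst \<sigma> (poly_const c) = poly_const c"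
  by (subst poly_subst_superset[of "{0}"]) (simp_all add: poly_const_def)

lemma poly_subst_0 [simp]: "poly_subst \<sigma> 0 = 0"
  by (simp add: poly_subst_def)

lemma poly_subst_single:
  "poly_subst \<sigma> (single m c) = poly_const c * (\<Prod>i\<in>UNIV. \<sigma> i ^ lookup m i)"
  by (subst poly_subst_superset[of "{m}"]) auto

lemma poly_subst_var [simp]: "poly_subst \<sigma> (poly_var j) = \<sigma> j"
proof -
  have "(\<Prod>i\<in>UNIV. \<sigma> i ^ lookup (single j (1::nat)) i) = (\<Prod>i\<in>UNIV. if i = j then \<sigma> j else 1)"
    by (rule prod.cong) (auto simp: lookup_single when_def)
  thus ?thesis by (simp add: poly_var_def poly_subst_single poly_const_simps prod.delta)
qed

lemma poly_subst_sum: "poly_subst \<sigma> (\<Sum>x\<in>A. f x) = (\<Sum>x\<in>A. poly_subst \<sigma> (f x))"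
  by (induction A rule: infinite_finite_induct) (simp_all add: poly_subst_add)

lemma poly_subst_mult: "poly_subst \<sigma> (f * g) = poly_subst \<sigma> f * poly_subst \<sigma> g"
proof -
  have s: "poly_subst \<sigma> (single m a * single n b)
      = poly_subst \<sigma> (single m a) * poly_subst \<sigma> (single n b)" for m n a b
    by (simp add: mult_single poly_subst_single lookup_add power_add prod.distrib
        poly_const_simps mult_ac)
  have "f * g = (\<Sum>m\<in>keys f. \<Sum>n\<in>keys g. single m (lookup f m) * single n (lookup g n))"
    by (subst (1) mpoly_sum_singles[of f], subst (1) mpoly_sum_singles[of g]) (simp add: sum_product)
  hence "poly_subst \<sigma> (f * g) = (\<Sum>m\<in>keys f. poly_subst \<sigma> (single m (lookup f m)))
      * (\<Sum>n\<in>keys g. poly_subst \<sigma> (single n (lookup g n)))"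
    by (simp add: poly_subst_sum s sum_product)
  thus ?thesis by (simp flip: poly_subst_sum mpoly_sum_singles)
qed

lemma poly_subst_uminus: "poly_subst \<sigma> (- f) = - poly_subst \<sigma> f"
  using poly_subst_add[of \<sigma> f "- f"] by (simp add: eq_neg_iff_add_eq_0 add.commute)

lemma poly_subst_diff: "poly_subst \<sigma> (f - g) = poly_subst \<sigma> f - poly_subst \<sigma> g"
  using poly_subst_add[of \<sigma> f "- g"] by (simp add: poly_subst_uminus)

subsection \<open>Linear forms\<close>

lemma linear_form_lincomb:
  "linear_form (\<lambda>x. a * f x + b * g x) = poly_const a * linear_form f + poly_const b * linear_form g"
  by (simp add: linear_form_def sum_distrib_left sum.distrib poly_const_simps distrib_right mult.assoc)

lemma linear_form_uminus: "linear_form (\<lambda>x. - f x) = - linear_form f"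
  by (simp add: linear_form_def poly_const_simps sum_negf)

lemma vec_as_sum_axis: "(x :: 'k::field ^ 'n::finite) = (\<Sum>i\<in>UNIV. x $ i *s axis i 1)"
  by (simp add: vec_eq_iff axis_def if_distrib sum.delta' cong: if_cong)

lemma linear_functional_expand:
  fixes f :: "'k::field ^ 'n::finite \<Rightarrow> 'k"
  assumes "Vector_Spaces.linear (*s) (*) f"
  shows "f x = (\<Sum>i\<in>UNIV. x $ i * f (axis i 1))"
proof -
  interpret Vector_Spaces.linear "(*s)" "(*)" f by fact
  have "f x = f (\<Sum>i\<in>UNIV. x $ i *s axis i 1)" by (subst vec_as_sum_axis) simp
  thus ?thesis by (simp add: sum scale)
qed

lemma linear_form_coord: "linear_form (\<lambda>x :: 'k::field ^ 'n::finite. x $ i) = poly_var i"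
proof -
  have "linear_form (\<lambda>x :: 'k ^ 'n. x $ i) = (\<Sum>j\<in>UNIV. if j = i then poly_var i else 0)"
    unfolding linear_form_def by (rule sum.cong) (auto simp: axis_def poly_const_simps)
  thus ?thesis by simp
qed

text \<open>A monomial of \<open>g\<close> with maximal exponent at a variable occurring in the form \<open>\<alpha>\<close>
  produces a monomial of the product that nothing can cancel.\<close>

lemma linear_form_mult_eq_0:
  fixes \<alpha> :: "'k::field ^ 'n::finite \<Rightarrow> 'k"
  assumes lin: "Vector_Spaces.linear (*s) (*) \<alpha>" and nz: "\<alpha> y \<noteq> 0" and eq: "linear_form \<alpha> * g = 0"
  shows "g = 0"
proof (rule ccontr)
  assume g: "g \<noteq> 0"
  obtain j where j: "\<alpha> (axis j 1) \<noteq> 0"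
  proof (rule ccontr)
    assume "\<not> thesis"
    hence "\<alpha> (axis i 1) = 0" for i using that by blast
    with nz show False by (subst (asm) linear_functional_expand[OF lin]) simp
  qed
  define M where "M = Max ((\<lambda>m. lookup m j) ` keys g)"
  have ne: "keys g \<noteq> {}" using g by simp
  have "M \<in> (\<lambda>m. lookup m j) ` keys g"
    unfolding M_def by (rule Max_in) (use ne in auto)
  then obtain m where m: "m \<in> keys g" "lookup m j = M" by auto
  have max: "lookup n j \<le> M" if "n \<in> keys g" for n
    unfolding M_def by (rule Max_ge) (use that in auto)
  let ?k = "single j 1 + m"
  have *: "poly_const c * poly_var i = single (single i 1) c" for i :: 'n and c :: 'k
    by (simp add: poly_const_def poly_var_def mult_single)
  have "0 = lookup (linear_form \<alpha> * g) ?k" by (simp add: eq)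
  also have "\<dots> = (\<Sum>i\<in>UNIV. lookup (single (single i 1) (\<alpha> (axis i 1)) * g) ?k)"
    by (simp add: linear_form_def sum_distrib_right lookup_sum *)
  also have "\<dots> = (\<Sum>i\<in>UNIV. if i = j then \<alpha> (axis j 1) * lookup g m else 0)"
  proof (rule sum.cong)
    fix i :: 'n
    have "lookup (single (single i 1) (\<alpha> (axis i 1)) * g) ?k = 0" if "i \<noteq> j"
    proof (rule single_mult_lookup_eq_0)
      fix n assume n: "n \<in> keys g"
      show "?k \<noteq> single i 1 + n"
      proof
        assume "?k = single i 1 + n"
        hence "lookup ?k j = lookup (single i 1 + n) j" by simp
        thus False using that m(2) max[OF n] by (simp add: lookup_add lookup_single when_def)
      qed
    qed
    thus "lookup (single (single i 1) (\<alpha> (axis i 1)) * g) ?k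
        = (if i = j then \<alpha> (axis j 1) * lookup g m else 0)"
      by (simp add: single_mult_lookup)
  qed simp
  also have "\<dots> = \<alpha> (axis j 1) * lookup g m" by simp
  finally show False using j m(1) by (simp add: in_keys_iff)
qed

subsection \<open>Homogeneous polynomials\<close>

definition mdeg :: "('n::finite \<Rightarrow>\<^sub>0 nat) \<Rightarrow> nat" where
  "mdeg m = (\<Sum>i\<in>UNIV. lookup m i)"

definition homogeneous :: "nat \<Rightarrow> ('n::finite, 'k::comm_ring_1) mpoly \<Rightarrow> bool" where
  "homogeneous d f \<longleftrightarrow> (\<forall>m\<in>keys f. mdeg m = d)"

lemma mdeg_add: "mdeg (m + n) = mdeg m + mdeg n"
  by (simp add: mdeg_def lookup_add sum.distrib)

lemma mdeg_0 [simp]: "mdeg 0 = 0"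
  by (simp add: mdeg_def)

lemma mdeg_eq_0: "mdeg m = 0 \<Longrightarrow> m = 0"
  by (simp add: mdeg_def poly_mapping_eq_iff fun_eq_iff)

lemma homogeneous_0 [simp]: "homogeneous d 0"
  by (simp add: homogeneous_def)

lemma homogeneous_const: "homogeneous 0 (poly_const c)"
  by (simp add: homogeneous_def poly_const_def)

lemma homogeneous_add: "homogeneous d f \<Longrightarrow> homogeneous d g \<Longrightarrow> homogeneous d (f + g)"
  unfolding homogeneous_def using keys_add[of f g] by blast

lemma homogeneous_mult: "homogeneous d f \<Longrightarrow> homogeneous e g \<Longrightarrow> homogeneous (d + e) (f * g)"
  unfolding homogeneous_def using keys_mult[of f g] by (fastforce simp: mdeg_add)

lemma homogeneous_sum: "(\<And>x. x \<in> A \<Longrightarrow> homogeneous d (f x)) \<Longrightarrow> homogeneous d (\<Sum>x\<in>A. f x)"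
  by (induction A rule: infinite_finite_induct) (simp_all add: homogeneous_add)

lemma homogeneous_var: "homogeneous 1 (poly_var i)"
  by (simp add: homogeneous_def poly_var_def mdeg_def lookup_single when_def)

lemma homogeneous_linear_form: "homogeneous 1 (linear_form \<alpha>)"
  unfolding linear_form_def
proof (rule homogeneous_sum)
  show "homogeneous 1 (poly_const (\<alpha> (axis i 1)) * poly_var i)" for i
    using homogeneous_mult[OF homogeneous_const homogeneous_var, of "\<alpha> (axis i 1)" i] by simp
qed

lemma homogeneous_prod_linear_forms:
  "homogeneous (card A) (\<Prod>\<alpha>\<in>A. linear_form \<alpha>)"
proof (induction A rule: infinite_finite_induct)
  case (insert \<alpha> A)
  thus ?case using homogeneous_mult[OF homogeneous_linear_form insert.IH, of \<alpha>] by simp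
qed (simp_all flip: poly_const_simps(2) add: homogeneous_const)

lemma homogeneous_power_linear_form: "homogeneous k (linear_form \<alpha> ^ k)"
proof (induction k)
  case (Suc k)
  thus ?case using homogeneous_mult[OF homogeneous_linear_form Suc, of \<alpha>] by simp
qed (simp flip: poly_const_simps(2) add: homogeneous_const)

lemma homogeneous_degree_0: "homogeneous 0 f \<Longrightarrow> f = poly_const (lookup f 0)"
  unfolding homogeneous_def
  by (rule poly_mapping_eqI)
     (metis in_keys_iff lookup_const_0 lookup_single_not_eq mdeg_eq_0 poly_const_def)

lemma homogeneous_lookup_0: "homogeneous d f \<Longrightarrow> d > 0 \<Longrightarrow> lookup f 0 = 0"
  unfolding homogeneous_def by (metis in_keys_iff mdeg_0 less_irrefl)

text \<open>The zero polynomial is homogeneous of every degree, hence a base case for all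
  \<open>d\<close> beside the constants of degree \<open>0\<close>.\<close>

lemma homogeneous_induct [consumes 1, case_names zero const add var]:
  fixes f :: "('n::finite, 'k::comm_ring_1) mpoly"
  assumes hom: "homogeneous d f"
    and z: "\<And>d. P d 0"
    and c: "\<And>c. P 0 (poly_const c)"
    and a: "\<And>d f g. P d f \<Longrightarrow> P d g \<Longrightarrow> P d (f + g)"
    and v: "\<And>d i f. P d f \<Longrightarrow> P (Suc d) (poly_var i * f)"
  shows "P d f"
proof -
  have pw: "P (n + d) (poly_var i ^ n * g)" if "P d g" for i g n d
    using that by (induction n) (simp_all add: v mult.assoc)
  have pr: "P ((\<Sum>i\<in>A. lookup m i) + d) ((\<Prod>i\<in>A. poly_var i ^ lookup m i) * g)"
    if "finite A" "P d g" for A g m d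
    using that by (induction A rule: finite_induct) (simp_all add: pw mult.assoc add.assoc)
  have P1: "P (mdeg m) (single m c)" for m c
    using pr[OF finite[of UNIV] c, of m c] by (simp add: single_as_vars mdeg_def mult.commute)
  have P2: "P d (\<Sum>m\<in>A. single m (lookup f m))" if "finite A" "\<And>m. m \<in> A \<Longrightarrow> mdeg m = d" for A
    using that
  proof (induction A rule: finite_induct)
    case (insert x F)
    thus ?case using P1[of x] by (simp add: a)
  qed (simp add: z)
  show ?thesis
    by (subst mpoly_sum_singles) (rule P2, use hom in \<open>auto simp: homogeneous_def\<close>)
qed

section \<open>Groups acting on signed roots\<close>

declare in_lists_conv_set [simp del] in_listsD [rule del] in_listsI [rule del]

text \<open>Isolates what length and Bruhat order draw from geometry: a group permuting finitely
  many signed roots, where each simple reflection turns exactly one positive root negative.\<close>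

locale reflection_group = group W for W :: "('g, 'm) monoid_scheme" (structure) +
  fixes S :: "'g set" and \<Phi> :: "'r set" and act :: "'g \<Rightarrow> 'r \<Rightarrow> 'r" and neg :: "'r \<Rightarrow> 'r"
    and Pos :: "'r set" and sr :: "'g \<Rightarrow> 'r" and refl :: "'r \<Rightarrow> 'g"
  assumes finite_roots: "finite \<Phi>"
    and S_subset: "S \<subseteq> carrier W"
    and S_generates: "generate W S = carrier W"
    and S_involution: "s \<in> S \<Longrightarrow> s \<otimes> s = \<one>"
    and act_closed: "w \<in> carrier W \<Longrightarrow> \<beta> \<in> \<Phi> \<Longrightarrow> act w \<beta> \<in> \<Phi>"
    and act_mult: "u \<in> carrier W \<Longrightarrow> w \<in> carrier W \<Longrightarrow> \<beta> \<in> \<Phi> \<Longrightarrow> act (u \<otimes> w) \<beta> = act u (act w \<beta>)"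
    and act_one: "\<beta> \<in> \<Phi> \<Longrightarrow> act \<one> \<beta> = \<beta>"
    and neg_closed: "\<beta> \<in> \<Phi> \<Longrightarrow> neg \<beta> \<in> \<Phi>"
    and neg_neg: "\<beta> \<in> \<Phi> \<Longrightarrow> neg (neg \<beta>) = \<beta>"
    and act_neg: "w \<in> carrier W \<Longrightarrow> \<beta> \<in> \<Phi> \<Longrightarrow> act w (neg \<beta>) = neg (act w \<beta>)"
    and Pos_subset: "Pos \<subseteq> \<Phi>"
    and neg_Pos_iff: "\<beta> \<in> \<Phi> \<Longrightarrow> neg \<beta> \<in> Pos \<longleftrightarrow> \<beta> \<notin> Pos"
    and sr_Pos: "s \<in> S \<Longrightarrow> sr s \<in> Pos"
    and act_sr: "s \<in> S \<Longrightarrow> act s (sr s) = neg (sr s)"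
    and act_simple_Pos: "s \<in> S \<Longrightarrow> \<beta> \<in> Pos \<Longrightarrow> \<beta> \<noteq> sr s \<Longrightarrow> act s \<beta> \<in> Pos"
    and refl_closed: "\<beta> \<in> \<Phi> \<Longrightarrow> refl \<beta> \<in> carrier W"
    and refl_involution: "\<beta> \<in> \<Phi> \<Longrightarrow> refl \<beta> \<otimes> refl \<beta> = \<one>"
    and act_refl: "\<beta> \<in> \<Phi> \<Longrightarrow> act (refl \<beta>) \<beta> = neg \<beta>"
    and refl_act: "w \<in> carrier W \<Longrightarrow> \<beta> \<in> \<Phi> \<Longrightarrow> refl (act w \<beta>) = w \<otimes> refl \<beta> \<otimes> inv w"
    and refl_neg: "\<beta> \<in> \<Phi> \<Longrightarrow> refl (neg \<beta>) = refl \<beta>"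
    and refl_sr: "s \<in> S \<Longrightarrow> refl (sr s) = s"
begin

abbreviation wprod where "wprod \<equiv> word_prod W"
abbreviation len where "len \<equiv> cox_length W S"
abbreviation bruhat (infix "\<preceq>" 50) where "x \<preceq> y \<equiv> bruhat_le W S x y"

lemma S_carrier [simp]: "s \<in> S \<Longrightarrow> s \<in> carrier W"
  using S_subset by blast

lemma S_inv [simp]: "s \<in> S \<Longrightarrow> inv s = s"
  using S_involution by (simp add: inv_equality)

lemma mult_S_S [simp]: "w \<in> carrier W \<Longrightarrow> s \<in> S \<Longrightarrow> w \<otimes> s \<otimes> s = w"
  by (simp add: m_assoc S_involution)

lemma S_S_mult [simp]: "w \<in> carrier W \<Longrightarrow> s \<in> S \<Longrightarrow> s \<otimes> (s \<otimes> w) = w"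
  by (simp add: S_involution flip: m_assoc)

lemma Pos_root [simp]: "\<beta> \<in> Pos \<Longrightarrow> \<beta> \<in> \<Phi>"
  using Pos_subset by blast

lemma finite_Pos: "finite Pos"
  using finite_roots Pos_subset finite_subset by blast

lemma wprod_Nil [simp]: "wprod [] = \<one>"
  and wprod_Cons [simp]: "wprod (x # xs) = x \<otimes> wprod xs"
  by (simp_all add: word_prod_def)

lemma wprod_closed [simp]: "xs \<in> lists S \<Longrightarrow> wprod xs \<in> carrier W"
  by (induction xs) auto

lemma wprod_append [simp]:
  "xs \<in> lists S \<Longrightarrow> ys \<in> lists S \<Longrightarrow> wprod (xs @ ys) = wprod xs \<otimes> wprod ys"
  by (induction xs) (auto simp: m_assoc)

lemma wprod_rev: "xs \<in> lists S \<Longrightarrow> wprod (rev xs) = inv (wprod xs)"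
  by (induction xs) (auto simp: inv_mult_group in_lists_conv_set)

lemma exists_word: "w \<in> carrier W \<Longrightarrow> \<exists>xs\<in>lists S. wprod xs = w"
proof -
  assume "w \<in> carrier W"
  hence "w \<in> generate W S" by (simp add: S_generates)
  thus ?thesis
  proof (induction rule: generate.induct)
    case one
    thus ?case by (intro bexI[of _ "[]"]) auto
  next
    case (incl h)
    thus ?case by (intro bexI[of _ "[h]"]) auto
  next
    case (inv h)
    thus ?case by (intro bexI[of _ "[h]"]) auto
  next
    case (eng h1 h2)
    then obtain xs ys where "xs \<in> lists S" "ys \<in> lists S" "wprod xs = h1" "wprod ys = h2" by blast
    thus ?case by (intro bexI[of _ "xs @ ys"]) auto
  qed
qed

subsection \<open>Length and inversions\<close>

lemma len_le: "xs \<in> lists S \<Longrightarrow> len (wprod xs) \<le> length xs"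
  unfolding cox_length_def by (rule Least_le) auto

lemma exists_reduced: "w \<in> carrier W \<Longrightarrow> \<exists>xs. reduced_word W S w xs"
proof -
  assume "w \<in> carrier W"
  hence "\<exists>n. \<exists>xs\<in>lists S. length xs = n \<and> wprod xs = w" using exists_word by blast
  from LeastI_ex[OF this] show ?thesis
    unfolding reduced_word_def cox_length_def by blast
qed

lemma reducedD: "reduced_word W S w xs \<Longrightarrow> xs \<in> lists S"
  "reduced_word W S w xs \<Longrightarrow> wprod xs = w"
  "reduced_word W S w xs \<Longrightarrow> length xs = len w"
  by (auto simp: reduced_word_def)

lemma len_mult_le: "u \<in> carrier W \<Longrightarrow> w \<in> carrier W \<Longrightarrow> len (u \<otimes> w) \<le> len u + len w"
proof -
  assume "u \<in> carrier W" "w \<in> carrier W"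
  then obtain xs ys where "reduced_word W S u xs" "reduced_word W S w ys"
    using exists_reduced by blast
  thus ?thesis using len_le[of "xs @ ys"] by (auto simp: reduced_word_def)
qed

lemma len_inv: "w \<in> carrier W \<Longrightarrow> len (inv w) = len w"
proof -
  have le: "len (inv w) \<le> len w" if w: "w \<in> carrier W" for w
  proof -
    obtain xs where "reduced_word W S w xs" using exists_reduced[OF w] by blast
    thus ?thesis using len_le[of "rev xs"] by (auto simp: reduced_word_def wprod_rev in_lists_conv_set)
  qed
  assume "w \<in> carrier W"
  thus ?thesis using le[of w] le[of "inv w"] by simp
qed

lemma len_one [simp]: "len \<one> = 0"
  using len_le[of "[]"] by simp

lemma len_eq_0: "w \<in> carrier W \<Longrightarrow> len w = 0 \<longleftrightarrow> w = \<one>"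
  using exists_reduced[of w] by (auto simp: reduced_word_def)

definition Inv :: "'g \<Rightarrow> 'r set" where
  "Inv w = {\<beta> \<in> Pos. act w \<beta> \<notin> Pos}"

lemma finite_Inv [simp]: "finite (Inv w)"
  using finite_Pos by (simp add: Inv_def)

lemma neg_not_Pos: "\<beta> \<in> Pos \<Longrightarrow> neg \<beta> \<notin> Pos"
  by (simp add: neg_Pos_iff)

lemma act_simple_simple: "s \<in> S \<Longrightarrow> \<beta> \<in> \<Phi> \<Longrightarrow> act s (act s \<beta>) = \<beta>"
  by (simp add: act_one S_involution flip: act_mult)

text \<open>A simple reflection permutes the positive roots other than \<open>sr s\<close>, so
  \<open>act s\<close> carries the old inversions into \<open>Pos\<close>, and the only new
  inversion is \<open>sr s\<close>.\<close>

lemma Inv_mult_simple: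
  assumes "w \<in> carrier W" "s \<in> S" "act w (sr s) \<in> Pos"
  shows "Inv (w \<otimes> s) = insert (sr s) (act s ` Inv w)" "sr s \<notin> act s ` Inv w"
proof -
  have sr: "sr s \<in> Pos" using assms sr_Pos by simp
  have ne: "\<beta> \<noteq> sr s" if "\<beta> \<in> Inv w" for \<beta> using that assms(3) by (auto simp: Inv_def)
  have a: "act (w \<otimes> s) \<beta> = act w (act s \<beta>)" if "\<beta> \<in> Pos" for \<beta>
    using assms that by (simp add: act_mult)
  show "sr s \<notin> act s ` Inv w"
  proof
    assume "sr s \<in> act s ` Inv w"
    then obtain \<beta> where b: "\<beta> \<in> Inv w" "sr s = act s \<beta>" by blast
    have "act s (sr s) = \<beta>" using b assms act_simple_simple[of s \<beta>] by (simp add: Inv_def)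
    hence "\<beta> = neg (sr s)" using act_sr[OF assms(2)] by simp
    thus False using b neg_not_Pos[OF sr] by (auto simp: Inv_def)
  qed
  have "act w (neg (sr s)) \<notin> Pos" using assms sr by (simp add: act_neg act_closed neg_not_Pos)
  hence 1: "sr s \<in> Inv (w \<otimes> s)"
    using sr by (simp add: Inv_def a act_sr assms)
  have 2: "act s \<beta> \<in> Inv (w \<otimes> s)" if "\<beta> \<in> Inv w" for \<beta>
  proof -
    have "act s \<beta> \<in> Pos" using that ne[OF that] assms act_simple_Pos by (auto simp: Inv_def)
    thus ?thesis using that assms by (auto simp: Inv_def a act_simple_simple)
  qed
  have 3: "\<beta> \<in> act s ` Inv w" if "\<beta> \<in> Inv (w \<otimes> s)" "\<beta> \<noteq> sr s" for \<beta>
  proof -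
    have "act s \<beta> \<in> Pos" using that assms act_simple_Pos by (auto simp: Inv_def)
    hence "act s \<beta> \<in> Inv w" using that by (auto simp: Inv_def a)
    thus ?thesis using that assms act_simple_simple[of s \<beta>] by (force simp: Inv_def)
  qed
  show "Inv (w \<otimes> s) = insert (sr s) (act s ` Inv w)" using 1 2 3 by blast
qed

lemma inj_on_act_simple: "s \<in> S \<Longrightarrow> A \<subseteq> \<Phi> \<Longrightarrow> inj_on (act s) A"
  by (rule inj_on_inverseI[where g = "act s"]) (auto simp: act_simple_simple)

lemma card_Inv_mult_simple:
  assumes "w \<in> carrier W" "s \<in> S" "act w (sr s) \<in> Pos"
  shows "card (Inv (w \<otimes> s)) = Suc (card (Inv w))"
proof -
  have "inj_on (act s) (Inv w)" by (rule inj_on_act_simple) (use assms in \<open>auto simp: Inv_def\<close>)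
  thus ?thesis using Inv_mult_simple[OF assms] by (simp add: card_image)
qed

section \<open>Letter deletion, strong exchange, and inversions of reduced words\<close>

definition del :: "nat \<Rightarrow> 'g list \<Rightarrow> 'g list" where
  "del i xs = take i xs @ drop (Suc i) xs"

text \<open>The root whose reflection, multiplied on the right, deletes letter \<open>i\<close>: the
  simple root of that letter carried back through the letters after it.\<close>

definition word_root :: "'g list \<Rightarrow> nat \<Rightarrow> 'r" where
  "word_root xs i = act (inv (wprod (drop (Suc i) xs))) (sr (xs ! i))"

lemma lists_take_drop: "xs \<in> lists S \<Longrightarrow> take i xs \<in> lists S" "xs \<in> lists S \<Longrightarrow> drop i xs \<in> lists S"
  by (auto simp: in_lists_conv_set dest: in_set_takeD in_set_dropD)

lemma del_in_lists: "xs \<in> lists S \<Longrightarrow> del i xs \<in> lists S"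
  by (simp add: del_def lists_take_drop)

lemma length_del: "i < length xs \<Longrightarrow> Suc (length (del i xs)) = length xs"
  by (simp add: del_def)

lemma nth_lists: "xs \<in> lists S \<Longrightarrow> i < length xs \<Longrightarrow> xs ! i \<in> S"
  by (auto simp: in_lists_conv_set)

text \<open>For a word \<open>u s v\<close> the reflection is \<open>inv v s v\<close>, and the two
  copies of \<open>s\<close> cancel.\<close>

lemma wprod_del:
  assumes "xs \<in> lists S" "i < length xs"
  shows "wprod (del i xs) = wprod xs \<otimes> refl (word_root xs i)"
proof -
  define u v s where "u = wprod (take i xs)" and "v = wprod (drop (Suc i) xs)" and "s = xs ! i"
  have l: "take i xs \<in> lists S" "drop (Suc i) xs \<in> lists S" "s \<in> S"
    using assms by (simp_all add: s_def lists_take_drop nth_lists)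
  have c: "u \<in> carrier W" "v \<in> carrier W" using l by (auto simp: u_def v_def)
  have "xs = take i xs @ s # drop (Suc i) xs" using assms by (simp add: s_def id_take_nth_drop)
  hence "wprod xs = wprod (take i xs @ s # drop (Suc i) xs)" by simp
  also have "\<dots> = u \<otimes> (s \<otimes> v)" using l by (subst wprod_append) (auto simp: u_def v_def)
  finally have 1: "wprod xs = u \<otimes> (s \<otimes> v)" .
  have "refl (word_root xs i) = inv v \<otimes> s \<otimes> v"
    using l c by (simp add: word_root_def refl_act sr_Pos refl_sr flip: v_def s_def)
  hence "wprod xs \<otimes> refl (word_root xs i) = u \<otimes> (s \<otimes> (v \<otimes> inv v) \<otimes> s \<otimes> v)"
    using c l unfolding 1 by (simp only: m_assoc m_closed inv_closed S_carrier)
  also have "\<dots> = u \<otimes> v" using c l by (simp add: S_involution)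
  also have "\<dots> = wprod (del i xs)" using l by (simp add: del_def u_def v_def)
  finally show ?thesis ..
qed

lemma word_root_snoc:
  assumes "xs \<in> lists S" "s \<in> S"
  shows "i < length xs \<Longrightarrow> word_root (xs @ [s]) i = act s (word_root xs i)"
    and "word_root (xs @ [s]) (length xs) = sr s"
proof -
  assume i: "i < length xs"
  have "drop (Suc i) xs \<in> lists S" using assms(1) by (rule lists_take_drop)
  thus "word_root (xs @ [s]) i = act s (word_root xs i)"
    using i assms nth_lists[OF assms(1) i]
    by (simp add: word_root_def nth_append inv_mult_group act_mult sr_Pos)
next
  show "word_root (xs @ [s]) (length xs) = sr s"
    using assms by (simp add: word_root_def act_one sr_Pos)
qed

text \<open>The heart of strong exchange: as the word is applied, the sign of the image of \<beta>
  changes at some letter, and a letter \<open>s\<close> turns a positive root negative only at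
  \<open>sr s\<close>.\<close>

lemma inversion_is_word_root:
  assumes "xs \<in> lists S" "\<beta> \<in> Pos" "act (wprod xs) \<beta> \<notin> Pos"
  shows "\<exists>i<length xs. word_root xs i = \<beta>"
  using assms
proof (induction xs arbitrary: \<beta> rule: rev_induct)
  case Nil
  thus ?case by (simp add: act_one)
next
  case (snoc s xs)
  hence l: "xs \<in> lists S" "s \<in> S" by auto
  show ?case
  proof (cases "\<beta> = sr s")
    case True
    thus ?thesis using word_root_snoc(2)[OF l] by (intro exI[of _ "length xs"]) simp
  next
    case False
    hence P: "act s \<beta> \<in> Pos" using snoc.prems l act_simple_Pos by blast
    have "act (wprod xs) (act s \<beta>) \<notin> Pos"
      using snoc.prems l by (simp add: act_mult)
    then obtain i where i: "i < length xs" "word_root xs i = act s \<beta>"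
      using snoc.IH[OF l(1) P] by blast
    hence "word_root (xs @ [s]) i = \<beta>"
      using snoc.prems l by (simp add: word_root_snoc act_simple_simple)
    thus ?thesis using i by (intro exI[of _ i]) simp
  qed
qed

lemma len_mult_refl_less:
  assumes "w \<in> carrier W" "\<beta> \<in> Pos" "act w \<beta> \<notin> Pos"
  shows "len (w \<otimes> refl \<beta>) < len w"
proof -
  obtain xs where xs: "reduced_word W S w xs" using exists_reduced assms by blast
  then obtain i where i: "i < length xs" "word_root xs i = \<beta>"
    using inversion_is_word_root[of xs \<beta>] assms by (auto simp: reduced_word_def)
  hence "wprod (del i xs) = w \<otimes> refl \<beta>"
    using wprod_del[of xs i] xs by (auto simp: reduced_word_def)
  thus ?thesis using len_le[OF del_in_lists, of xs i] length_del[OF i(1)] xs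
    by (auto simp: reduced_word_def)
qed

text \<open>\<open>refl \<beta>\<close> reverses the sign of the image of \<beta>, so the strict
  decrease of \<open>len_mult_refl_less\<close>, applied to \<open>w \<otimes> refl \<beta>\<close>,
  yields the strict increase.\<close>

lemma len_mult_refl_less_iff:
  assumes "w \<in> carrier W" "\<beta> \<in> Pos"
  shows "len (w \<otimes> refl \<beta>) < len w \<longleftrightarrow> act w \<beta> \<notin> Pos"
    and "len w < len (w \<otimes> refl \<beta>) \<longleftrightarrow> act w \<beta> \<in> Pos"
proof -
  have gt: "len w < len (w \<otimes> refl \<beta>)" if "act w \<beta> \<in> Pos"
  proof -
    have "act (w \<otimes> refl \<beta>) \<beta> \<notin> Pos"
      using assms that by (simp add: act_mult refl_closed act_refl act_neg neg_not_Pos)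
    from len_mult_refl_less[OF _ assms(2) this] show ?thesis
      using assms by (simp add: refl_closed m_assoc refl_involution)
  qed
  show "len (w \<otimes> refl \<beta>) < len w \<longleftrightarrow> act w \<beta> \<notin> Pos"
       "len w < len (w \<otimes> refl \<beta>) \<longleftrightarrow> act w \<beta> \<in> Pos"
    using gt len_mult_refl_less[OF assms] by fastforce+
qed

lemma len_simple_less_iff:
  assumes "w \<in> carrier W" "s \<in> S"
  shows "len (w \<otimes> s) < len w \<longleftrightarrow> act w (sr s) \<notin> Pos"
    and "len w < len (w \<otimes> s) \<longleftrightarrow> act w (sr s) \<in> Pos"
  using len_mult_refl_less_iff[OF assms(1) sr_Pos[OF assms(2)]] assms by (simp_all add: refl_sr)

lemma len_simple_cases:
  assumes "w \<in> carrier W" "s \<in> S"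
  shows "len (w \<otimes> s) = Suc (len w) \<or> len w = Suc (len (w \<otimes> s))"
proof -
  have "len s \<le> 1" using len_le[of "[s]"] assms by simp
  hence "len (w \<otimes> s) \<le> Suc (len w)" "len w \<le> Suc (len (w \<otimes> s))"
    using len_mult_le[of w s] len_mult_le[of "w \<otimes> s" s] assms by auto
  moreover have "len (w \<otimes> s) \<noteq> len w" using len_simple_less_iff[OF assms] by force
  ultimately show ?thesis by linarith
qed

lemma len_simple_left_cases:
  assumes "w \<in> carrier W" "s \<in> S"
  shows "len (s \<otimes> w) = Suc (len w) \<or> len w = Suc (len (s \<otimes> w))"
  using len_simple_cases[of "inv w" s] assms len_inv[of w] len_inv[of "s \<otimes> w"]
  by (simp add: inv_mult_group)

lemma reduced_snoc:
  assumes "reduced_word W S w (xs @ [s])"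
  shows "s \<in> S" "w \<in> carrier W" "reduced_word W S (w \<otimes> s) xs" "len w = Suc (len (w \<otimes> s))"
proof -
  have l: "xs \<in> lists S" "s \<in> S" "w = wprod xs \<otimes> s" "len w = Suc (length xs)"
    using assms by (auto simp: reduced_word_def)
  hence w: "w \<in> carrier W" by simp
  have e: "w \<otimes> s = wprod xs" using l by simp
  have "len (w \<otimes> s) \<le> length xs" using len_le[OF l(1)] e by simp
  with len_simple_cases[OF w l(2)] l(4) have "len (w \<otimes> s) = length xs" by linarith
  thus "s \<in> S" "w \<in> carrier W" "reduced_word W S (w \<otimes> s) xs" "len w = Suc (len (w \<otimes> s))"
    using l w e by (auto simp: reduced_word_def)
qed

text \<open>Stripping the last letter of a reduced word removes exactly one inversion.\<close>

lemma card_Inv: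
  assumes "w \<in> carrier W" shows "card (Inv w) = len w"
proof -
  obtain xs where "reduced_word W S w xs" using exists_reduced[OF assms] by blast
  thus ?thesis
  proof (induction xs arbitrary: w rule: rev_induct)
    case Nil
    hence "w = \<one>" by (auto simp: reduced_word_def)
    hence "Inv w = {}" by (auto simp: Inv_def act_one)
    thus ?case using \<open>w = \<one>\<close> by simp
  next
    case (snoc s xs)
    note r = reduced_snoc[OF snoc.prems]
    have c: "w \<otimes> s \<in> carrier W" using r by simp
    have "act (w \<otimes> s) (sr s) \<in> Pos" using len_simple_less_iff(2)[OF c r(1)] r by simp
    from card_Inv_mult_simple[OF c r(1) this] show ?case using snoc.IH[OF r(3)] r by simp
  qed
qed

text \<open>Strong exchange makes the map onto \<open>Inv w\<close>, and both sides have
  \<open>len w\<close> elements. Sums over positions of a word thereby become sums that see only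
  \<open>w\<close>.\<close>

lemma word_root_reduced:
  assumes "reduced_word W S w xs"
  shows "bij_betw (word_root xs) {..<length xs} (Inv w)"
proof -
  have w: "w \<in> carrier W" using assms by (auto simp: reduced_word_def)
  have sub: "Inv w \<subseteq> word_root xs ` {..<length xs}"
    using inversion_is_word_root[of xs] assms by (auto simp: reduced_word_def Inv_def)
  have "card (word_root xs ` {..<length xs}) \<le> card (Inv w)"
    using card_image_le[of "{..<length xs}" "word_root xs"] card_Inv[OF w] assms
    by (simp add: reduced_word_def)
  hence eq: "Inv w = word_root xs ` {..<length xs}"
    using sub by (intro card_seteq) auto
  have "inj_on (word_root xs) {..<length xs}"
    by (rule eq_card_imp_inj_on) (use card_Inv[OF w] assms eq in \<open>auto simp: reduced_word_def\<close>)
  thus ?thesis using eq by (simp add: bij_betw_def)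
qed

lemma exists_descent:
  assumes "w \<in> carrier W" "len w > 0"
  shows "\<exists>s\<in>S. len w = Suc (len (w \<otimes> s))"
proof -
  obtain xs where xs: "reduced_word W S w xs" using exists_reduced assms by blast
  hence "xs \<noteq> []" using assms by (auto simp: reduced_word_def)
  then obtain ys s where "xs = ys @ [s]" by (metis rev_exhaust)
  thus ?thesis using reduced_snoc xs by blast
qed

subsection \<open>Bruhat order\<close>

definition brel :: "('g \<times> 'g) set" where
  "brel = {(x, x \<otimes> t) |x t. x \<in> carrier W \<and> t \<in> cox_reflections W S \<and> len x < len (x \<otimes> t)}"

lemma bruhat_iff: "x \<preceq> y \<longleftrightarrow> (x, y) \<in> brel\<^sup>*"
  by (simp add: bruhat_le_def brel_def)

lemma bruhat_refl [simp]: "x \<preceq> x"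
  by (simp add: bruhat_iff)

lemma bruhat_trans [trans]: "x \<preceq> y \<Longrightarrow> y \<preceq> z \<Longrightarrow> x \<preceq> z"
  by (simp add: bruhat_iff)

lemma simple_reflection: "s \<in> S \<Longrightarrow> s \<in> cox_reflections W S"
  unfolding cox_reflections_def by (rule CollectI, rule exI[of _ \<one>], rule exI[of _ s]) auto

text \<open>A reflection is conjugate to a simple one, hence is \<open>refl\<close> of a root, and
  the root may be replaced by its negative.\<close>

lemma brelE:
  assumes "(x, y) \<in> brel"
  obtains \<beta> where "x \<in> carrier W" "y = x \<otimes> refl \<beta>" "\<beta> \<in> Pos" "act x \<beta> \<in> Pos" "len x < len y"
    "refl \<beta> \<in> cox_reflections W S"
proof -
  obtain t where t: "x \<in> carrier W" "y = x \<otimes> t" "t \<in> cox_reflections W S" "len x < len y"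
    using assms by (auto simp: brel_def)
  then obtain w s where ws: "w \<in> carrier W" "s \<in> S" "t = w \<otimes> s \<otimes> inv w"
    by (auto simp: cox_reflections_def)
  define \<gamma> where "\<gamma> = act w (sr s)"
  have g: "\<gamma> \<in> \<Phi>" "refl \<gamma> = t" using ws by (auto simp: \<gamma>_def act_closed sr_Pos refl_act refl_sr)
  define \<beta> where "\<beta> = (if \<gamma> \<in> Pos then \<gamma> else neg \<gamma>)"
  have b: "\<beta> \<in> Pos" "refl \<beta> = t" using g by (auto simp: \<beta>_def neg_Pos_iff refl_neg)
  thus ?thesis using t len_mult_refl_less_iff(2)[of x \<beta>] by (intro that[of \<beta>]) auto
qed

lemma bruhat_lt_simple: "w \<in> carrier W \<Longrightarrow> s \<in> S \<Longrightarrow> len w < len (w \<otimes> s) \<Longrightarrow> w \<preceq> w \<otimes> s"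
  unfolding bruhat_iff brel_def by (rule r_into_rtrancl) (auto intro: simple_reflection)

lemma bruhat_gt_simple: "w \<in> carrier W \<Longrightarrow> s \<in> S \<Longrightarrow> len (w \<otimes> s) < len w \<Longrightarrow> w \<otimes> s \<preceq> w"
  using bruhat_lt_simple[of "w \<otimes> s" s] by simp

lemma bruhat_len: "x \<preceq> y \<Longrightarrow> len x \<le> len y"
  unfolding bruhat_iff by (induction rule: rtrancl_induct) (auto elim!: brelE)

lemma bruhat_len_eq: "x \<preceq> y \<Longrightarrow> len y \<le> len x \<Longrightarrow> x = y"
proof -
  have "x = y \<or> len x < len y" if "(x, y) \<in> brel\<^sup>*"
    using that by (induction rule: rtrancl_induct) (auto elim!: brelE)
  thus "x \<preceq> y \<Longrightarrow> len y \<le> len x \<Longrightarrow> x = y" by (auto simp: bruhat_iff)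
qed

text \<open>Conjugation by \<open>s\<close> replaces \<beta> by \<open>act s \<beta>\<close>, whose
  image under \<open>x \<otimes> s\<close> is that of \<beta> under \<open>x\<close>. Positivity of
  \<open>act s \<beta>\<close> fails only for \<open>\<beta> = sr s\<close>, the excluded
  case.\<close>

lemma brel_mult_simple:
  assumes "(x, y) \<in> brel" "s \<in> S" "y \<noteq> x \<otimes> s"
  shows "(x \<otimes> s, y \<otimes> s) \<in> brel"
proof -
  obtain \<beta> where b: "x \<in> carrier W" "y = x \<otimes> refl \<beta>" "\<beta> \<in> Pos" "act x \<beta> \<in> Pos"
    "refl \<beta> \<in> cox_reflections W S" using assms(1) by (rule brelE)
  have "\<beta> \<noteq> sr s" using b assms by (auto simp: refl_sr)
  hence sb: "act s \<beta> \<in> Pos" using b assms act_simple_Pos by blast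
  have "act (x \<otimes> s) (act s \<beta>) \<in> Pos" using b assms by (simp add: act_mult act_closed act_simple_simple)
  hence l: "len (x \<otimes> s) < len (x \<otimes> s \<otimes> refl (act s \<beta>))"
    using len_mult_refl_less_iff(2)[OF _ sb] b assms by simp
  have r: "refl (act s \<beta>) = s \<otimes> refl \<beta> \<otimes> s" using b assms by (simp add: refl_act)
  have e: "x \<otimes> s \<otimes> refl (act s \<beta>) = y \<otimes> s"
    unfolding r using b assms by (simp add: refl_closed flip: m_assoc)
  obtain w s' where ws: "w \<in> carrier W" "s' \<in> S" "refl \<beta> = w \<otimes> s' \<otimes> inv w"
    using b by (auto simp: cox_reflections_def)
  have "s \<otimes> refl \<beta> \<otimes> s = (s \<otimes> w) \<otimes> s' \<otimes> inv (s \<otimes> w)"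
    using ws assms by (simp add: inv_mult_group m_assoc)
  hence "refl (act s \<beta>) \<in> cox_reflections W S"
    unfolding cox_reflections_def r using ws assms
    by (intro CollectI exI[of _ "s \<otimes> w"] exI[of _ s'] conjI) simp_all
  thus ?thesis unfolding brel_def using l b assms
    by (intro CollectI exI[of _ "x \<otimes> s"] exI[of _ "refl (act s \<beta>)"] conjI) (simp_all add: e)
qed

text \<open>One half of the lifting property: a chain from \<open>x\<close> to \<open>u\<close> is
  multiplied by \<open>s\<close> step by step. A step that is itself multiplication by
  \<open>s\<close> is bypassed through \<open>u \<preceq> u \<otimes> s\<close>.\<close>

lemma bruhat_mult_simple:
  assumes "x \<preceq> u" "u \<in> carrier W" "s \<in> S" "len u < len (u \<otimes> s)"
  shows "x \<otimes> s \<preceq> u \<otimes> s"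
  using assms(1) unfolding bruhat_iff
proof (induction rule: converse_rtrancl_induct)
  case (step y z)
  show ?case
  proof (cases "z = y \<otimes> s")
    case True
    have "z \<preceq> u" using step by (simp add: bruhat_iff)
    also have "u \<preceq> u \<otimes> s" using assms by (intro bruhat_lt_simple)
    finally show ?thesis using True by (simp add: bruhat_iff)
  next
    case False
    thus ?thesis using brel_mult_simple[OF step(1) assms(3)] step(3) by (meson converse_rtrancl_into_rtrancl)
  qed
qed simp

text \<open>The other half, valid whichever of \<open>u\<close> and \<open>u \<otimes> s\<close> is
  longer: the smaller of \<open>x\<close> and \<open>x \<otimes> s\<close> grows monotonically along
  a chain. If \<open>s\<close> is an ascent of \<open>x\<close>, then \<open>x\<close> stays below
  after \<open>s\<close> is removed from \<open>u\<close>.\<close>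

lemma bruhat_min_simple:
  assumes "x \<preceq> u" "u \<in> carrier W" "s \<in> S"
  shows "(if len (x \<otimes> s) < len x then x \<otimes> s else x) \<preceq> u \<otimes> s"
  using assms(1) unfolding bruhat_iff
proof (induction rule: converse_rtrancl_induct)
  case base
  show ?case
    using assms len_simple_cases[of u s] bruhat_lt_simple[of u s] by (auto simp: bruhat_iff)
next
  case (step y z)
  let ?m = "\<lambda>y. if len (y \<otimes> s) < len y then y \<otimes> s else y"
  obtain \<beta> where b: "y \<in> carrier W" "z = y \<otimes> refl \<beta>" "\<beta> \<in> Pos" using step(1) by (rule brelE)
  have 1: "?m y \<preceq> y" "?m y \<preceq> y \<otimes> s"
    using b assms len_simple_cases[of y s] bruhat_lt_simple[of y s] bruhat_gt_simple[of y s] by auto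
  have yz: "y \<preceq> z" using step(1) by (simp add: bruhat_iff)
  have "?m y \<preceq> ?m z"
  proof (cases "len (z \<otimes> s) < len z")
    case True
    show ?thesis
    proof (cases "z = y \<otimes> s")
      case True
      hence "?m z = y" using \<open>len (z \<otimes> s) < len z\<close> b assms by simp
      thus ?thesis using 1 by simp
    next
      case False
      hence "y \<otimes> s \<preceq> z \<otimes> s" using brel_mult_simple[OF step(1) assms(3)] by (auto simp: bruhat_iff)
      hence "?m y \<preceq> z \<otimes> s" using 1(2) bruhat_trans by blast
      thus ?thesis using True by simp
    qed
  next
    case False
    hence e: "?m z = z" by simp
    show ?thesis unfolding e by (rule bruhat_trans[OF 1(1) yz])
  qed
  moreover have "?m z \<preceq> u \<otimes> s" using step(3) by (simp add: bruhat_iff)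
  ultimately show ?case unfolding bruhat_iff[symmetric] by (rule bruhat_trans)
qed

subsection \<open>The longest element\<close>

lemma exists_longest: "\<exists>w\<in>carrier W. \<forall>u\<in>carrier W. len u \<le> len w"
proof -
  have b: "len u \<le> card Pos" if "u \<in> carrier W" for u
    unfolding card_Inv[OF that, symmetric] by (rule card_mono[OF finite_Pos]) (auto simp: Inv_def)
  hence fin: "finite (len ` carrier W)" by (auto intro: finite_subset[of _ "{..card Pos}"])
  hence "Max (len ` carrier W) \<in> len ` carrier W" by (intro Max_in) auto
  then obtain w where "w \<in> carrier W" "len w = Max (len ` carrier W)" by auto
  thus ?thesis using fin by (auto intro!: bexI[of _ w])
qed

lemma Inv_longest:
  assumes "w \<in> carrier W" "\<forall>u\<in>carrier W. len u \<le> len w"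
  shows "Inv w = Pos"
proof -
  have "act w \<beta> \<notin> Pos" if "\<beta> \<in> Pos" for \<beta>
  proof
    assume "act w \<beta> \<in> Pos"
    hence "len w < len (w \<otimes> refl \<beta>)" using that assms len_mult_refl_less_iff(2) by blast
    moreover have "w \<otimes> refl \<beta> \<in> carrier W" using that assms by (simp add: refl_closed)
    ultimately show False using assms(2) by fastforce
  qed
  thus ?thesis by (auto simp: Inv_def)
qed

text \<open>\<open>w\<close> reverses the sign of every root, so the inversions of
  \<open>w \<otimes> u\<close> are the complement in \<open>Pos\<close> of those of
  \<open>u\<close>.\<close>

lemma len_mult_of_Inv_all:
  assumes "w \<in> carrier W" "Inv w = Pos" "u \<in> carrier W"
  shows "len (w \<otimes> u) + len u = card Pos"
proof -
  have iff: "act w \<gamma> \<in> Pos \<longleftrightarrow> \<gamma> \<notin> Pos" if "\<gamma> \<in> \<Phi>" for \<gamma>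
  proof (cases "\<gamma> \<in> Pos")
    case True
    thus ?thesis using assms(2) by (auto simp: Inv_def)
  next
    case False
    hence "neg \<gamma> \<in> Inv w" using that assms by (simp add: neg_Pos_iff)
    hence "neg (act w \<gamma>) \<notin> Pos" using that assms by (simp add: Inv_def act_neg)
    thus ?thesis using that assms False by (simp add: neg_Pos_iff act_closed)
  qed
  have "Inv (w \<otimes> u) = Pos - Inv u"
    using assms(1,3) by (auto simp: Inv_def act_mult iff act_closed)
  hence "card (Inv (w \<otimes> u)) = card Pos - card (Inv u)"
    by (simp add: card_Diff_subset Inv_def finite_Pos)
  moreover have "card (Inv u) \<le> card Pos"
    by (rule card_mono[OF finite_Pos]) (auto simp: Inv_def)
  ultimately show ?thesis using assms by (simp add: card_Inv)
qed

abbreviation w0 where "w0 \<equiv> longest_elem W S"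

lemma longest_props:
  shows w0_closed [simp]: "w0 \<in> carrier W" and Inv_w0: "Inv w0 = Pos" and w0_w0: "w0 \<otimes> w0 = \<one>"
    and len_w0: "len w0 = card Pos"
proof -
  obtain w where w: "w \<in> carrier W" "\<forall>u\<in>carrier W. len u \<le> len w" using exists_longest by blast
  have I: "Inv w = Pos" using Inv_longest[OF w] .
  \<comment> \<open>Two elements of maximal length have a product of length zero. Taking
    \<open>u = w\<close> gives the involution, and cancellation then gives the uniqueness required
    by \<open>THE\<close>.\<close>
  have uniq: "w \<otimes> u = \<one>" if u: "u \<in> carrier W" "\<forall>x\<in>carrier W. len x \<le> len u" for u
  proof -
    have "len u = card Pos" using card_Inv[OF u(1)] Inv_longest[OF u] by simp
    thus ?thesis using len_mult_of_Inv_all[OF w(1) I u(1)] w u by (simp add: len_eq_0)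
  qed
  have "w0 = w"
    unfolding longest_elem_def
  proof (rule the_equality)
    fix u assume "u \<in> carrier W \<and> (\<forall>x\<in>carrier W. len x \<le> len u)"
    thus "u = w" using uniq[of u] uniq[OF w] w by (metis l_cancel)
  qed (use w in auto)
  thus "w0 \<in> carrier W" "Inv w0 = Pos" "w0 \<otimes> w0 = \<one>" "len w0 = card Pos"
    using w I uniq[OF w] card_Inv[OF w(1)] by auto
qed

lemma len_mult_w0:
  assumes "u \<in> carrier W" shows "len (u \<otimes> w0) + len u = card Pos"
proof -
  have "inv w0 = w0" using w0_w0 by (simp add: inv_equality)
  hence "inv (u \<otimes> w0) = w0 \<otimes> inv u" using assms by (simp add: inv_mult_group)
  hence "len (u \<otimes> w0) = len (w0 \<otimes> inv u)" using assms len_inv[of "u \<otimes> w0"] by simp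
  thus ?thesis using len_mult_of_Inv_all[OF w0_closed Inv_w0, of "inv u"] assms by (simp add: len_inv)
qed

lemma inv_w0: "inv w0 = w0"
  using w0_w0 by (simp add: inv_equality)

subsection \<open>Minimal coset representatives\<close>

lemma coset_rep_ascent:
  assumes "x \<in> min_coset_reps W S J" "s \<in> J" "J \<subseteq> S"
  shows "len x < len (x \<otimes> s)"
proof -
  have "x \<in> carrier W" "\<not> len (x \<otimes> s) < len x"
    using assms by (auto simp: min_coset_reps_def descents_def)
  thus ?thesis using len_simple_cases[of x s] assms by auto
qed

text \<open>Descents in \<open>J\<close> are stripped from the right. By
  \<open>bruhat_min_simple\<close> each stripping leaves a minimal representative \<open>v\<close>
  below the remainder, which yields the last conjunct.\<close>

lemma coset_decomposition:
  assumes "J \<subseteq> S" "u \<in> carrier W"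
  shows "\<exists>x zs. x \<in> min_coset_reps W S J \<and> zs \<in> lists J \<and> reduced_word W S (wprod zs) zs \<and>
    u = x \<otimes> wprod zs \<and> len u = len x + length zs \<and>
    (\<forall>v. v \<in> min_coset_reps W S J \<longrightarrow> v \<preceq> u \<longrightarrow> v \<preceq> x)"
  using assms(2)
proof (induction "len u" arbitrary: u rule: less_induct)
  case less
  show ?case
  proof (cases "u \<in> min_coset_reps W S J")
    case True
    thus ?thesis using less.prems by (intro exI[of _ u] exI[of _ "[]"]) (auto simp: reduced_word_def)
  next
    case False
    then obtain s where s: "s \<in> J" "s \<in> S" "len (u \<otimes> s) < len u"
      using less.prems by (auto simp: min_coset_reps_def descents_def)
    have us: "u \<otimes> s \<in> carrier W" using s less.prems by simp
    obtain x zs where x: "x \<in> min_coset_reps W S J" "zs \<in> lists J" "reduced_word W S (wprod zs) zs"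
      "u \<otimes> s = x \<otimes> wprod zs" "len (u \<otimes> s) = len x + length zs"
      "\<forall>v. v \<in> min_coset_reps W S J \<longrightarrow> v \<preceq> u \<otimes> s \<longrightarrow> v \<preceq> x"
      using less.hyps[OF s(3) us] by blast
    have xc: "x \<in> carrier W" using x by (simp add: min_coset_reps_def)
    have zS: "zs \<in> lists S" using x assms by (auto simp: in_lists_conv_set)
    have "u = u \<otimes> s \<otimes> s" using s less.prems by simp
    also have "\<dots> = x \<otimes> wprod (zs @ [s])" using x(4) xc zS s by (simp add: m_assoc)
    finally have u: "u = x \<otimes> wprod (zs @ [s])" .
    have l: "len u = len x + length (zs @ [s])" using len_simple_cases[of u s] s less.prems x(5) by auto
    \<comment> \<open>The lengths add up in \<open>u\<close> and length is subadditive, so the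
      extended word cannot be shortened.\<close>
    have "length (zs @ [s]) \<le> len (wprod (zs @ [s]))"
      using len_mult_le[of x "wprod (zs @ [s])"] u l xc zS s by (simp del: wprod_append)
    hence r: "reduced_word W S (wprod (zs @ [s])) (zs @ [s])"
      using len_le[of "zs @ [s]"] zS s by (auto simp: reduced_word_def)
    have "v \<preceq> x" if v: "v \<in> min_coset_reps W S J" "v \<preceq> u" for v
    proof -
      have "len v < len (v \<otimes> s)" using coset_rep_ascent v s assms by blast
      hence "v \<preceq> u \<otimes> s" using bruhat_min_simple[OF v(2) less.prems s(2)] by auto
      thus ?thesis using x(6) v by blast
    qed
    thus ?thesis using u l r x s by (intro exI[of _ x] exI[of _ "zs @ [s]"]) auto
  qed
qed

end

section \<open>The reflection representation\<close>

lemma linear_map_simps: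
  fixes f :: "'k::field ^ 'n \<Rightarrow> 'k ^ 'm"
  assumes "Vector_Spaces.linear (*s) (*s) f"
  shows "f (x + y) = f x + f y" "f (c *s x) = c *s f x" "f (x - y) = f x - f y" "f 0 = 0"
proof -
  interpret Vector_Spaces.linear "(*s)" "(*s)" f by fact
  show "f (x + y) = f x + f y" "f (c *s x) = c *s f x" "f (x - y) = f x - f y" "f 0 = 0"
    by (rule add scale diff zero)+
qed

lemma linear_functional_simps:
  fixes f :: "'k::field ^ 'n \<Rightarrow> 'k"
  assumes "Vector_Spaces.linear (*s) (*) f"
  shows "f (x + y) = f x + f y" "f (c *s x) = c * f x" "f (x - y) = f x - f y" "f 0 = 0"
    "f (- x) = - f x"
proof -
  interpret Vector_Spaces.linear "(*s)" "(*)" f by fact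
  show "f (x + y) = f x + f y" "f (c *s x) = c * f x" "f (x - y) = f x - f y" "f 0 = 0"
    "f (- x) = - f x"
    by (rule add scale diff zero neg)+
qed

lemma linear_functionalI:
  fixes f :: "'k::field ^ 'n \<Rightarrow> 'k"
  assumes "\<And>x y. f (x + y) = f x + f y" "\<And>c x. f (c *s x) = c * f x"
  shows "Vector_Spaces.linear (*s) (*) f"
proof -
  interpret v1: vector_space "(*s) :: 'k \<Rightarrow> 'k ^ 'n \<Rightarrow> 'k ^ 'n" by unfold_locales
  interpret v2: vector_space "(*) :: 'k \<Rightarrow> 'k \<Rightarrow> 'k" by unfold_locales (auto simp: algebra_simps)
  show ?thesis by unfold_locales (use assms in auto)
qed

lemma linear_functional_comp:
  assumes "Vector_Spaces.linear (*s) (*) f" "Vector_Spaces.linear (*s) (*s) g"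
  shows "Vector_Spaces.linear (*s) (*) (f \<circ> g)"
  by (rule linear_functionalI)
     (simp_all add: linear_functional_simps[OF assms(1)] linear_map_simps[OF assms(2)])

lemma hyperplane_functional_multiple:
  fixes \<alpha> :: "'k::field ^ 'n \<Rightarrow> 'k"
  assumes "Vector_Spaces.linear (*s) (*) \<alpha>" "Vector_Spaces.linear (*s) (*) \<beta>"
    and "\<alpha> y = 1" "\<And>x. \<alpha> x = 0 \<Longrightarrow> \<beta> x = 0"
  shows "\<beta> x = \<alpha> x * \<beta> y"
proof -
  have "\<alpha> (x - \<alpha> x *s y) = 0" using assms by (simp add: linear_functional_simps)
  hence "\<beta> (x - \<alpha> x *s y) = 0" by (rule assms)
  thus ?thesis using assms by (simp add: linear_functional_simps)
qed

text \<open>\<open>T\<close> fixes the kernel of \<alpha>, so it moves every vector along one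
  direction \<open>a\<close>; \<open>T a = - a\<close> then forces
  \<open>\<alpha> a = 2\<close>.\<close>

lemma reflection_formula:
  fixes T :: "'k::field ^ 'n \<Rightarrow> 'k ^ 'n"
  assumes T: "is_reflection T" and lin: "Vector_Spaces.linear (*s) (*) \<alpha>"
    and ker: "kernel_of \<alpha> = fixed_space T"
  shows "\<exists>a. \<alpha> a = 2 \<and> T = (\<lambda>y. y - \<alpha> y *s a)"
proof -
  have linT: "Vector_Spaces.linear (*s) (*s) T" and TT: "T (T y) = y"
    and dim: "vec.dim (fixed_space T) + 1 = CARD('n)" for y
    using T by (auto simp: is_reflection_def fun_eq_iff)
  note Ts = linear_map_simps[OF linT] and As = linear_functional_simps[OF lin]
  have "\<exists>z. \<alpha> z \<noteq> 0"
  proof (rule ccontr)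
    assume "\<nexists>z. \<alpha> z \<noteq> 0"
    hence "fixed_space T = UNIV" using ker by (auto simp: kernel_of_def)
    thus False using dim by (simp add: card_cart_basis)
  qed
  then obtain z where "\<alpha> z \<noteq> 0" by blast
  define y0 where "y0 = inverse (\<alpha> z) *s z"
  have y0: "\<alpha> y0 = 1" using \<open>\<alpha> z \<noteq> 0\<close> by (simp add: y0_def As)
  define a where "a = y0 - T y0"
  have fixd: "T x = x \<longleftrightarrow> \<alpha> x = 0" for x using ker by (auto simp: kernel_of_def fixed_space_def)
  have form: "T y = y - \<alpha> y *s a" for y
  proof -
    have "\<alpha> (y - \<alpha> y *s y0) = 0" by (simp add: As y0)
    hence "T (y - \<alpha> y *s y0) = y - \<alpha> y *s y0" by (simp add: fixd)
    thus ?thesis by (simp add: Ts a_def vec.scale_right_diff_distrib algebra_simps)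
  qed
  have "a \<noteq> 0" using y0 fixd[of y0] by (auto simp: a_def)
  have "T a = - a" by (simp add: a_def Ts TT)
  hence "(2 - \<alpha> a) *s a = 0" using form[of a]
    by (simp add: vec_eq_iff algebra_simps)
  hence "\<alpha> a = 2" using \<open>a \<noteq> 0\<close> by simp
  thus ?thesis using form by (intro exI[of _ a]) auto
qed

locale hiller =
  fixes W :: "('g, 'm) monoid_scheme" (structure)
    and S :: "'g set"
    and \<iota> :: "'k::field \<Rightarrow> real"
    and \<rho> :: "'g \<Rightarrow> 'k ^ 'n::finite \<Rightarrow> 'k ^ 'n"
    and \<Phi> :: "('k ^ 'n \<Rightarrow> 'k) set"
    and C :: "('k ^ 'n) set"
  assumes coxeter: "coxeter_system W S"
    and finite_W: "finite (carrier W)"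
    and embedding: "real_embedding \<iota>"
    and representation: "reflection_representation W S \<rho>"
    and roots: "root_system W \<rho> \<Phi>"
    and is_chamber: "chamber \<iota> \<Phi> C"
    and S_walls: "S = wall_reflections W \<rho> \<iota> \<Phi> C"
begin

sublocale group W
  using coxeter by (simp add: coxeter_system_def)

subsection \<open>Signs\<close>

lemma iota_simps [simp]:
  "\<iota> 1 = 1" "\<iota> (a + b) = \<iota> a + \<iota> b" "\<iota> (a * b) = \<iota> a * \<iota> b" "\<iota> 0 = 0" "\<iota> (- a) = - \<iota> a"
  "\<iota> (a - b) = \<iota> a - \<iota> b"
proof -
  show 1: "\<iota> 1 = 1" "\<iota> (a + b) = \<iota> a + \<iota> b" "\<iota> (a * b) = \<iota> a * \<iota> b" for a b
    using embedding by (auto simp: real_embedding_def)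
  show 0: "\<iota> 0 = 0" using 1(2)[of 0 0] by simp
  show m: "\<iota> (- a) = - \<iota> a" for a using 1(2)[of a "- a"] 0 by simp
  show "\<iota> (a - b) = \<iota> a - \<iota> b" using 1(2)[of a "- b"] m by simp
qed

lemma iota_eq_0 [simp]: "\<iota> a = 0 \<longleftrightarrow> a = 0"
proof
  assume a: "\<iota> a = 0"
  show "a = 0"
  proof (rule ccontr)
    assume "a \<noteq> 0"
    hence "\<iota> (a * inverse a) = 1" by simp
    thus False using a by (simp del: right_inverse)
  qed
qed simp

lemma iota_of_nat [simp]: "\<iota> (of_nat n) = real n"
  by (induction n) auto

lemma iota_sum: "\<iota> (\<Sum>x\<in>A. f x) = (\<Sum>x\<in>A. \<iota> (f x))"
  by (induction A rule: infinite_finite_induct) auto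

text \<open>A field embedded in the reals has characteristic zero; division by \<open>2\<close> and
  by the group order rests on this.\<close>

lemma of_nat_neq_0: "n > 0 \<Longrightarrow> of_nat n \<noteq> (0::'k)"
  using iota_of_nat[of n] iota_eq_0[of "of_nat n"] by simp

lemma two_neq_0: "(2::'k) \<noteq> 0"
  using of_nat_neq_0[of 2] by simp

subsection \<open>Reflections and coroots\<close>

lemma rep_linear: "w \<in> carrier W \<Longrightarrow> Vector_Spaces.linear (*s) (*s) (\<rho> w)"
  and rep_one [simp]: "\<rho> \<one> = id"
  and rep_mult: "u \<in> carrier W \<Longrightarrow> w \<in> carrier W \<Longrightarrow> \<rho> (u \<otimes> w) = \<rho> u \<circ> \<rho> w"
  and rep_inj: "u \<in> carrier W \<Longrightarrow> w \<in> carrier W \<Longrightarrow> \<rho> u = \<rho> w \<Longrightarrow> u = w"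
  using representation unfolding reflection_representation_def by (auto dest: inj_onD)

lemmas rep_simps = linear_map_simps[OF rep_linear]

lemma rep_inv [simp]: "w \<in> carrier W \<Longrightarrow> \<rho> w (\<rho> (inv w) x) = x" "w \<in> carrier W \<Longrightarrow> \<rho> (inv w) (\<rho> w x) = x"
  using rep_mult[of w "inv w"] rep_mult[of "inv w" w] by (auto simp: fun_eq_iff)

lemma root_linear: "\<alpha> \<in> \<Phi> \<Longrightarrow> Vector_Spaces.linear (*s) (*) \<alpha>"
  and root_act: "w \<in> carrier W \<Longrightarrow> \<alpha> \<in> \<Phi> \<Longrightarrow> \<alpha> \<circ> \<rho> (inv w) \<in> \<Phi>"
  and root_kernels: "kernel_of ` \<Phi> = reflecting_hyperplanes W \<rho>"
  and root_uminus: "\<alpha> \<in> \<Phi> \<Longrightarrow> (\<lambda>x. - \<alpha> x) \<in> \<Phi>"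
  and root_unique: "\<alpha> \<in> \<Phi> \<Longrightarrow> \<beta> \<in> \<Phi> \<Longrightarrow> kernel_of \<alpha> = kernel_of \<beta> \<Longrightarrow> \<beta> = \<alpha> \<or> \<beta> = (\<lambda>x. - \<alpha> x)"
  using roots unfolding root_system_def by blast+

lemmas root_simps = linear_functional_simps[OF root_linear]

definition act :: "'g \<Rightarrow> ('k ^ 'n \<Rightarrow> 'k) \<Rightarrow> 'k ^ 'n \<Rightarrow> 'k" where
  "act w \<alpha> = \<alpha> \<circ> \<rho> (inv w)"

definition neg :: "('k ^ 'n \<Rightarrow> 'k) \<Rightarrow> 'k ^ 'n \<Rightarrow> 'k" where
  "neg \<alpha> = (\<lambda>x. - \<alpha> x)"

text \<open>\<open>a\<close> is the coroot of \<beta>, in the normalization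
  \<open>\<beta> a = 2\<close> that makes \<open>r\<close> an involution.\<close>

definition reflection_along :: "('k ^ 'n \<Rightarrow> 'k) \<Rightarrow> 'g \<Rightarrow> 'k ^ 'n \<Rightarrow> bool" where
  "reflection_along \<beta> r a \<longleftrightarrow> r \<in> carrier W \<and> \<beta> a = 2 \<and> \<rho> r = (\<lambda>y. y - \<beta> y *s a)"

definition refl :: "('k ^ 'n \<Rightarrow> 'k) \<Rightarrow> 'g" where
  "refl \<beta> = (SOME r. \<exists>a. reflection_along \<beta> r a)"

definition coroot :: "('k ^ 'n \<Rightarrow> 'k) \<Rightarrow> 'k ^ 'n" where
  "coroot \<beta> = (SOME a. reflection_along \<beta> (refl \<beta>) a)"

lemma reflection_alongI:
  assumes "r \<in> carrier W" "is_reflection (\<rho> r)" "\<beta> \<in> \<Phi>" "kernel_of \<beta> = fixed_space (\<rho> r)"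
  shows "\<exists>a. reflection_along \<beta> r a"
  using reflection_formula[OF assms(2) root_linear[OF assms(3)] assms(4)] assms(1)
  by (auto simp: reflection_along_def)

lemma reflection_along_refl:
  assumes "\<beta> \<in> \<Phi>" shows "reflection_along \<beta> (refl \<beta>) (coroot \<beta>)"
proof -
  have "kernel_of \<beta> \<in> reflecting_hyperplanes W \<rho>" using assms root_kernels by blast
  then obtain r where "r \<in> carrier W" "is_reflection (\<rho> r)" "kernel_of \<beta> = fixed_space (\<rho> r)"
    by (auto simp: reflecting_hyperplanes_def)
  hence "\<exists>r a. reflection_along \<beta> r a" using reflection_alongI assms by blast
  hence "\<exists>a. reflection_along \<beta> (refl \<beta>) a" unfolding refl_def by (rule someI_ex)
  thus ?thesis unfolding coroot_def by (rule someI_ex)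
qed

text \<open>The product of two reflections in the same hyperplane is a transvection, which has infinite
  order in characteristic zero unless it is trivial.\<close>

lemma reflection_along_unique:
  assumes "\<beta> \<in> \<Phi>" "reflection_along \<beta> r a" "reflection_along \<beta> r' a'"
  shows "r = r'" "a = a'"
proof -
  note B = root_simps[OF assms(1)]
  have c: "r \<in> carrier W" "r' \<in> carrier W" and ba: "\<beta> a = 2" "\<beta> a' = 2"
    and f: "\<rho> r = (\<lambda>y. y - \<beta> y *s a)" "\<rho> r' = (\<lambda>y. y - \<beta> y *s a')"
    using assms by (auto simp: reflection_along_def)
  define q where "q = r \<otimes> r'"
  have q: "q \<in> carrier W" using c by (simp add: q_def)
  have rq: "\<rho> q y = y + \<beta> y *s (a - a')" for y
    using c by (simp add: q_def rep_mult f B ba vec_eq_iff algebra_simps)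
  have pow: "\<rho> (q [^] m) y = y + (of_nat m * \<beta> y) *s (a - a')" for m :: nat and y
  proof (induction m arbitrary: y)
    case (Suc m)
    have "\<rho> (q [^] Suc m) y = \<rho> (q [^] m) (\<rho> q y)" using q by (simp add: rep_mult)
    also have "\<dots> = \<rho> q y + (of_nat m * \<beta> (\<rho> q y)) *s (a - a')" by (rule Suc)
    also have "\<dots> = y + (of_nat (Suc m) * \<beta> y) *s (a - a')"
      by (simp add: rq B ba vec_eq_iff algebra_simps)
    finally show ?case .
  qed simp
  have "\<rho> (q [^] Coset.order W) a = a" using pow_order_eq_1[OF q] by simp
  hence "(of_nat (Coset.order W) * 2) *s (a - a') = 0" using pow[of "Coset.order W" a] ba by simp
  moreover have "of_nat (Coset.order W) * (2::'k) \<noteq> 0"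
    using of_nat_neq_0[of "Coset.order W"] two_neq_0 order_gt_0_iff_finite finite_W by simp
  ultimately show a: "a = a'" by simp
  show "r = r'" using c f a by (intro rep_inj) auto
qed

lemma refl_eqI: "\<beta> \<in> \<Phi> \<Longrightarrow> reflection_along \<beta> r a \<Longrightarrow> refl \<beta> = r \<and> coroot \<beta> = a"
  using reflection_along_unique reflection_along_refl by blast

lemma
  assumes "\<beta> \<in> \<Phi>"
  shows refl_carrier: "refl \<beta> \<in> carrier W" and root_coroot: "\<beta> (coroot \<beta>) = 2"
    and rep_refl: "\<rho> (refl \<beta>) y = y - \<beta> y *s coroot \<beta>"
  using reflection_along_refl[OF assms] by (auto simp: reflection_along_def)

lemma refl_refl: assumes "\<beta> \<in> \<Phi>" shows "refl \<beta> \<otimes> refl \<beta> = \<one>"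
proof (rule rep_inj)
  show "\<rho> (refl \<beta> \<otimes> refl \<beta>) = \<rho> \<one>"
    using assms by (auto simp: fun_eq_iff rep_mult refl_carrier rep_refl root_simps root_coroot
        vec_eq_iff algebra_simps)
qed (use assms refl_carrier in auto)

lemma inv_refl: "\<beta> \<in> \<Phi> \<Longrightarrow> inv (refl \<beta>) = refl \<beta>"
  by (simp add: inv_equality refl_refl refl_carrier)

lemma act_refl_root: "\<beta> \<in> \<Phi> \<Longrightarrow> act (refl \<beta>) \<beta> = neg \<beta>"
  by (auto simp: act_def inv_refl rep_refl root_simps root_coroot neg_def)

text \<open>The conjugate is a reflection along the transported root with the transported coroot;
  uniqueness identifies both.\<close>

lemma refl_act_coroot:
  assumes "\<beta> \<in> \<Phi>" "w \<in> carrier W"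
  shows "refl (act w \<beta>) = w \<otimes> refl \<beta> \<otimes> inv w" "coroot (act w \<beta>) = \<rho> w (coroot \<beta>)"
proof -
  have "reflection_along (act w \<beta>) (w \<otimes> refl \<beta> \<otimes> inv w) (\<rho> w (coroot \<beta>))"
    unfolding reflection_along_def
    using assms by (auto simp: act_def fun_eq_iff rep_mult refl_carrier rep_refl root_coroot rep_simps)
  thus "refl (act w \<beta>) = w \<otimes> refl \<beta> \<otimes> inv w" "coroot (act w \<beta>) = \<rho> w (coroot \<beta>)"
    using refl_eqI[of "act w \<beta>"] root_act[OF assms(2,1)] by (auto simp: act_def)
qed

text \<open>Each hyperplane is the fixed space of an element of the finite group and carries at most
  two roots, of which \<open>?g\<close> picks one.\<close>

lemma finite_root_set: "finite \<Phi>"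
proof -
  have "reflecting_hyperplanes W \<rho> \<subseteq> (\<lambda>r. fixed_space (\<rho> r)) ` carrier W"
    by (auto simp: reflecting_hyperplanes_def)
  hence fin: "finite (kernel_of ` \<Phi>)" using finite_W root_kernels finite_surj by metis
  let ?g = "inv_into \<Phi> kernel_of"
  have "\<Phi> \<subseteq> ?g ` kernel_of ` \<Phi> \<union> neg ` ?g ` kernel_of ` \<Phi>"
  proof
    fix \<alpha> assume a: "\<alpha> \<in> \<Phi>"
    define \<gamma> where "\<gamma> = ?g (kernel_of \<alpha>)"
    have "\<gamma> \<in> \<Phi>" "kernel_of \<gamma> = kernel_of \<alpha>"
      unfolding \<gamma>_def using a by (simp_all add: inv_into_into f_inv_into_f)
    hence "\<alpha> = \<gamma> \<or> \<alpha> = neg \<gamma>" using root_unique[of \<gamma> \<alpha>] a by (simp add: neg_def)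
    moreover have "\<gamma> \<in> ?g ` kernel_of ` \<Phi>" using a by (simp add: \<gamma>_def)
    ultimately show "\<alpha> \<in> ?g ` kernel_of ` \<Phi> \<union> neg ` ?g ` kernel_of ` \<Phi>" by blast
  qed
  thus ?thesis using fin by (meson finite_UnI finite_imageI finite_subset)
qed

subsection \<open>Positive and simple roots\<close>

abbreviation "Pos \<equiv> positive_roots \<iota> \<Phi> C"
abbreviation "sr \<equiv> simple_root \<rho> \<iota> \<Phi> C"

text \<open>A base point of the chamber: signs of roots are tested at it, and it later supplies the
  strictly dominant functional \<open>inner x0\<close>.\<close>

definition x0 :: "'k ^ 'n" where
  "x0 = (SOME x. (\<forall>\<alpha>\<in>\<Phi>. \<alpha> x \<noteq> 0) \<and> C = {y. \<forall>\<alpha>\<in>\<Phi>. \<iota> (\<alpha> x) * \<iota> (\<alpha> y) > 0})"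

lemma x0: "\<alpha> \<in> \<Phi> \<Longrightarrow> \<alpha> x0 \<noteq> 0" "C = {y. \<forall>\<alpha>\<in>\<Phi>. \<iota> (\<alpha> x0) * \<iota> (\<alpha> y) > 0}"
  using someI_ex[OF is_chamber[unfolded chamber_def]] unfolding x0_def by blast+

lemma Pos_iff: "\<alpha> \<in> Pos \<longleftrightarrow> \<alpha> \<in> \<Phi> \<and> \<iota> (\<alpha> x0) > 0"
proof -
  have "0 < \<iota> (\<alpha> x0) * \<iota> (\<alpha> x0)" if "\<alpha> \<in> \<Phi>" for \<alpha>
    using x0(1)[OF that] iota_eq_0[of "\<alpha> x0"] by (metis not_real_square_gt_zero)
  hence "x0 \<in> C" by (subst x0(2)) simp
  moreover have "\<iota> (\<alpha> y) > 0" if "\<alpha> \<in> \<Phi>" "\<iota> (\<alpha> x0) > 0" "y \<in> C" for y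
  proof -
    have "\<iota> (\<alpha> x0) * \<iota> (\<alpha> y) > 0" using that(1,3) by (subst (asm) x0(2)) simp
    thus ?thesis using that(2) by (simp add: zero_less_mult_iff)
  qed
  ultimately show ?thesis by (auto simp: positive_roots_def)
qed

lemma neg_Pos: "\<beta> \<in> \<Phi> \<Longrightarrow> neg \<beta> \<in> Pos \<longleftrightarrow> \<beta> \<notin> Pos"
  using x0(1)[of \<beta>] iota_eq_0[of "\<beta> x0"] root_uminus[of \<beta>] by (auto simp: Pos_iff neg_def simp del: iota_eq_0)

text \<open>A functional vanishing on the hyperplane of \<alpha> is a multiple of \<alpha>. Roots
  are nonzero, so the kernels agree and the root system leaves only a sign.\<close>

lemma root_scaled:
  assumes "\<alpha> \<in> \<Phi>" "\<beta> \<in> \<Phi>" "\<And>x. \<alpha> x = 0 \<Longrightarrow> \<beta> x = 0"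
  shows "\<beta> = \<alpha> \<or> \<beta> = neg \<alpha>"
proof -
  define y where "y = inverse 2 *s coroot \<alpha>"
  have y: "\<alpha> y = 1" using assms two_neq_0 by (simp add: y_def root_simps root_coroot)
  have e: "\<beta> x = \<alpha> x * \<beta> y" for x
    by (rule hyperplane_functional_multiple) (use assms y root_linear in auto)
  have "\<beta> y \<noteq> 0" using e[of "coroot \<beta>"] root_coroot[OF assms(2)] two_neq_0 by auto
  hence "\<beta> x = 0 \<longleftrightarrow> \<alpha> x = 0" for x by (subst e) simp
  hence "kernel_of \<alpha> = kernel_of \<beta>" by (simp add: kernel_of_def)
  thus ?thesis using root_unique assms by (simp add: neg_def)
qed

lemma wall_reflectionD:
  assumes "s \<in> S"
  shows "s \<in> carrier W" "is_reflection (\<rho> s)"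
    "vec.span (fixed_space (\<rho> s) \<inter> closed_chamber \<iota> \<Phi> C) = fixed_space (\<rho> s)"
    "fixed_space (\<rho> s) \<in> kernel_of ` \<Phi>"
  using assms S_walls root_kernels by (auto simp: wall_reflections_def walls_def)

lemma simple_root_props:
  assumes "s \<in> S"
  shows "sr s \<in> Pos" "kernel_of (sr s) = fixed_space (\<rho> s)" "refl (sr s) = s"
proof -
  obtain \<alpha> where a: "\<alpha> \<in> \<Phi>" "kernel_of \<alpha> = fixed_space (\<rho> s)"
    using wall_reflectionD(4)[OF assms] by auto
  define \<beta> where "\<beta> = (if \<alpha> \<in> Pos then \<alpha> else neg \<alpha>)"
  have b: "\<beta> \<in> Pos" "\<beta> \<in> \<Phi>" using neg_Pos[OF a(1)] by (auto simp: \<beta>_def Pos_iff)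
  have k: "kernel_of \<beta> = fixed_space (\<rho> s)" using a by (auto simp: \<beta>_def neg_def kernel_of_def)
  have "sr s = \<beta>"
    unfolding simple_root_def
  proof (rule the_equality)
    show "\<beta> \<in> Pos \<and> (\<forall>x\<in>fixed_space (\<rho> s). \<beta> x = 0)"
      using b k by (auto simp: kernel_of_def)
    fix \<gamma> assume g: "\<gamma> \<in> Pos \<and> (\<forall>x\<in>fixed_space (\<rho> s). \<gamma> x = 0)"
    have "\<gamma> \<in> \<Phi>" using g by (simp add: Pos_iff)
    moreover have "\<gamma> x = 0" if "\<beta> x = 0" for x using g that by (auto simp: kernel_of_def simp flip: k)
    ultimately have "\<gamma> = \<beta> \<or> \<gamma> = neg \<beta>" using b by (intro root_scaled)
    thus "\<gamma> = \<beta>" using g b neg_Pos by blast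
  qed
  moreover have "refl \<beta> = s"
    using refl_eqI b reflection_alongI[OF wall_reflectionD(1,2)[OF assms] b(2) k] by blast
  ultimately show "sr s \<in> Pos" "kernel_of (sr s) = fixed_space (\<rho> s)" "refl (sr s) = s"
    using b k by auto
qed

text \<open>The wall of \<open>s\<close> contains a point of the closed chamber at which \<open>\<beta>\<close> is positive; it is
  fixed by \<open>s\<close>.\<close>

lemma simple_preserves_Pos:
  assumes "s \<in> S" "\<beta> \<in> Pos" "\<beta> \<noteq> sr s"
  shows "act s \<beta> \<in> Pos"
proof -
  let ?H = "fixed_space (\<rho> s)" and ?C = "closed_chamber \<iota> \<Phi> C"
  note sp = simple_root_props[OF assms(1)]
  have b: "\<beta> \<in> \<Phi>" "sr s \<in> \<Phi>" using assms sp by (auto simp: Pos_iff)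
  have "\<exists>y\<in>?H \<inter> ?C. \<beta> y \<noteq> 0"
  proof (rule ccontr)
    assume "\<not> ?thesis"
    hence z: "\<beta> y = 0" if "y \<in> ?H \<inter> ?C" for y using that by blast
    have "\<beta> x = 0" if "x \<in> vec.span (?H \<inter> ?C)" for x
      using that
    proof (induction rule: vec.span_induct)
      case base
      show ?case using b by (auto simp: vec.subspace_def root_simps)
    qed (use z in auto)
    hence "\<beta> x = 0" if "sr s x = 0" for x
      using that wall_reflectionD(3)[OF assms(1)] sp(2) by (auto simp: kernel_of_def)
    hence "\<beta> = sr s \<or> \<beta> = neg (sr s)" using b by (intro root_scaled)
    thus False using assms sp(1) neg_Pos[OF b(2)] by auto
  qed
  then obtain y where y: "\<rho> s y = y" "y \<in> ?C" "\<beta> y \<noteq> 0" by (auto simp: fixed_space_def)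
  have "\<iota> (\<beta> y) \<ge> 0" using y assms by (auto simp: closed_chamber_def)
  hence p: "\<iota> (\<beta> y) > 0" using y iota_eq_0[of "\<beta> y"] by (simp add: less_le del: iota_eq_0)
  have "inv s = s" using inv_refl[OF b(2)] sp by simp
  hence e: "act s \<beta> y = \<beta> y" using y by (simp add: act_def)
  have a: "act s \<beta> \<in> \<Phi>" using root_act b wall_reflectionD[OF assms(1)] by (simp add: act_def)
  show ?thesis
  proof (rule ccontr)
    assume "act s \<beta> \<notin> Pos"
    hence "neg (act s \<beta>) \<in> Pos" using neg_Pos a by blast
    hence "\<iota> (neg (act s \<beta>) y) \<ge> 0" using y by (auto simp: closed_chamber_def)
    thus False using p e by (simp add: neg_def)
  qed
qed

sublocale reflection_group W S \<Phi> act neg Pos sr refl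
proof
  show "finite \<Phi>" by (rule finite_root_set)
  show "S \<subseteq> carrier W" "generate W S = carrier W" using coxeter by (auto simp: coxeter_system_def)
  show "act \<one> \<beta> = \<beta>" for \<beta> by (simp add: act_def)
  show "Pos \<subseteq> \<Phi>" by (auto simp: Pos_iff)
next
  fix s assume s: "s \<in> S"
  note p = simple_root_props[OF s]
  have r: "sr s \<in> \<Phi>" using p by (simp add: Pos_iff)
  show "sr s \<in> Pos" "refl (sr s) = s" by (fact p)+
  show "s \<otimes> s = \<one>" using refl_refl[OF r] p by simp
  show "act s (sr s) = neg (sr s)" using act_refl_root[OF r] p by simp
  show "act s \<beta> \<in> Pos" if "\<beta> \<in> Pos" "\<beta> \<noteq> sr s" for \<beta>
    using simple_preserves_Pos[OF s] that .
next
  fix \<beta> assume b: "\<beta> \<in> \<Phi>"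
  show "neg \<beta> \<in> \<Phi>" using root_uminus[OF b] by (simp add: neg_def)
  show "neg (neg \<beta>) = \<beta>" by (simp add: neg_def)
  show "neg \<beta> \<in> Pos \<longleftrightarrow> \<beta> \<notin> Pos" by (rule neg_Pos[OF b])
  show "refl \<beta> \<in> carrier W" "refl \<beta> \<otimes> refl \<beta> = \<one>" "act (refl \<beta>) \<beta> = neg \<beta>"
    by (rule refl_carrier[OF b] refl_refl[OF b] act_refl_root[OF b])+
  have "reflection_along (neg \<beta>) (refl \<beta>) (- coroot \<beta>)"
    using b by (auto simp: reflection_along_def neg_def rep_refl refl_carrier root_simps root_coroot
        fun_eq_iff)
  thus "refl (neg \<beta>) = refl \<beta>" using refl_eqI[of "neg \<beta>"] root_uminus[OF b] by (simp add: neg_def)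
next
  fix w \<beta> assume w: "w \<in> carrier W" and b: "\<beta> \<in> \<Phi>"
  show "act w \<beta> \<in> \<Phi>" using root_act[OF w b] by (simp add: act_def)
  show "act w (neg \<beta>) = neg (act w \<beta>)" by (auto simp: act_def neg_def)
  show "refl (act w \<beta>) = w \<otimes> refl \<beta> \<otimes> inv w" using refl_act_coroot b w by simp
  show "act (u \<otimes> w) \<beta> = act u (act w \<beta>)" if "u \<in> carrier W" for u
    using that w by (simp add: act_def inv_mult_group rep_mult comp_assoc)
qed

end

section \<open>Divided differences\<close>

lemma poly_subst_linear_form:
  fixes \<phi> :: "'k::field ^ 'n::finite \<Rightarrow> 'k"
  assumes "Vector_Spaces.linear (*s) (*) \<phi>"
  shows "poly_subst (\<lambda>i. linear_form (\<lambda>x. g x $ i)) (linear_form \<phi>) = linear_form (\<phi> \<circ> g)"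
proof -
  have "poly_subst (\<lambda>i. linear_form (\<lambda>x. g x $ i)) (linear_form \<phi>)
      = (\<Sum>i\<in>UNIV. \<Sum>j\<in>UNIV. poly_const (\<phi> (axis i 1)) * (poly_const (g (axis j 1) $ i) * poly_var j))"
    by (simp add: linear_form_def poly_subst_sum poly_subst_mult sum_distrib_left)
  also have "\<dots> = (\<Sum>j\<in>UNIV. \<Sum>i\<in>UNIV. poly_const (\<phi> (axis i 1)) * (poly_const (g (axis j 1) $ i) * poly_var j))"
    by (rule sum.swap)
  also have "\<dots> = (\<Sum>j\<in>UNIV. poly_const (\<Sum>i\<in>UNIV. g (axis j 1) $ i * \<phi> (axis i 1)) * poly_var j)"
    by (simp add: poly_const_sum poly_const_simps sum_distrib_left mult_ac)
  also have "\<dots> = linear_form (\<phi> \<circ> g)"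
    by (simp add: linear_form_def flip: linear_functional_expand[OF assms])
  finally show ?thesis .
qed

context hiller
begin

abbreviation "pact \<equiv> poly_act W \<rho>"
abbreviation "dd \<equiv> divided_diff W \<rho> \<iota> \<Phi> C"
abbreviation lin :: "('k ^ 'n \<Rightarrow> 'k) \<Rightarrow> bool" where "lin \<equiv> Vector_Spaces.linear (*s) (*)"

lemma lin_coord: "lin (\<lambda>x. x $ i)"
  by (rule linear_functionalI) auto

lemma lin_act: "lin \<phi> \<Longrightarrow> w \<in> carrier W \<Longrightarrow> lin (act w \<phi>)"
  unfolding act_def by (rule linear_functional_comp) (auto intro: rep_linear)

lemma act_act: "u \<in> carrier W \<Longrightarrow> w \<in> carrier W \<Longrightarrow> act u (act w \<phi>) = act (u \<otimes> w) \<phi>"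
  by (simp add: act_def inv_mult_group rep_mult comp_assoc)

lemma pact_simps [simp]:
  "pact w 0 = 0" "pact w (poly_const c) = poly_const c" "pact w (f + g) = pact w f + pact w g"
  "pact w (f - g) = pact w f - pact w g" "pact w (- f) = - pact w f"
  "pact w (f * g) = pact w f * pact w g"
  by (simp_all add: poly_act_def poly_subst_add poly_subst_diff poly_subst_uminus poly_subst_mult)

lemma pact_linear_form: "lin \<phi> \<Longrightarrow> pact w (linear_form \<phi>) = linear_form (act w \<phi>)"
  unfolding poly_act_def act_def by (rule poly_subst_linear_form)

lemma pact_var: "pact w (poly_var i) = linear_form (act w (\<lambda>x. x $ i))"
  by (simp add: pact_linear_form lin_coord flip: linear_form_coord)

lemma pact_one [simp]: "pact \<one> f = f"
  by (induction f rule: mpoly_induct) (simp_all add: pact_var act_def comp_def linear_form_coord)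

lemma pact_mult: "u \<in> carrier W \<Longrightarrow> w \<in> carrier W \<Longrightarrow> pact (u \<otimes> w) f = pact u (pact w f)"
  by (induction f rule: mpoly_induct)
     (simp_all add: pact_var pact_linear_form lin_act lin_coord act_act)

lemma pact_simple_simple [simp]: "s \<in> S \<Longrightarrow> pact s (pact s f) = f"
  by (simp add: S_involution flip: pact_mult)

lemma pact_lookup_0: "lookup (pact w f) 0 = lookup f 0"
proof (induction f rule: mpoly_induct)
  case (var i f)
  have "lookup (linear_form (act w (\<lambda>x. x $ i))) 0 = 0" "lookup (poly_var i :: ('n, 'k) mpoly) 0 = 0"
    using homogeneous_lookup_0[OF homogeneous_linear_form] homogeneous_lookup_0[OF homogeneous_var] by auto
  thus ?case by (simp add: lookup_0_mult pact_var)
qed (simp_all add: lookup_add)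

text \<open>Since \<open>\<beta> (coroot \<beta>) = 2\<close>, a root is nonzero and its linear form
  is not a zero divisor.\<close>

lemma cancel_root: "\<beta> \<in> \<Phi> \<Longrightarrow> linear_form \<beta> * f = linear_form \<beta> * g \<Longrightarrow> f = g"
  using linear_form_mult_eq_0[OF root_linear, of \<beta> "coroot \<beta>" "f - g"]
  by (simp add: root_coroot two_neq_0 algebra_simps)

lemma pact_refl_linear_form:
  assumes "\<beta> \<in> \<Phi>" "lin \<phi>"
  shows "linear_form \<phi> - pact (refl \<beta>) (linear_form \<phi>) = linear_form \<beta> * poly_const (\<phi> (coroot \<beta>))"
proof -
  have "act (refl \<beta>) \<phi> = (\<lambda>x. 1 * \<phi> x + (- \<phi> (coroot \<beta>)) * \<beta> x)"
    using assms by (auto simp: act_def inv_refl rep_refl linear_functional_simps)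
  hence "linear_form (act (refl \<beta>) \<phi>)
      = poly_const 1 * linear_form \<phi> + poly_const (- \<phi> (coroot \<beta>)) * linear_form \<beta>"
    by (simp only: linear_form_lincomb)
  thus ?thesis using assms by (simp add: pact_linear_form poly_const_simps)
qed

lemma sr_root [simp]: "s \<in> S \<Longrightarrow> sr s \<in> \<Phi>"
  by (simp add: sr_Pos)

text \<open>For a variable \<open>x\<close>, the difference \<open>x f - s (x f)\<close> is
  \<open>(x - s x) f + (s x) (f - s f)\<close>, and the root divides \<open>x - s x\<close> as well
  as, by induction, \<open>f - s f\<close>.\<close>

lemma dd_exists: "s \<in> S \<Longrightarrow> \<exists>g. linear_form (sr s) * g = f - pact s f"
proof (induction f rule: mpoly_induct)
  case (const c)
  thus ?case by (intro exI[of _ 0]) simp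
next
  case (add f g)
  then obtain f' g' where "linear_form (sr s) * f' = f - pact s f" "linear_form (sr s) * g' = g - pact s g"
    by blast
  thus ?case by (intro exI[of _ "f' + g'"]) (simp add: distrib_left)
next
  case (var i f)
  then obtain g where g: "linear_form (sr s) * g = f - pact s f" by blast
  let ?x = "poly_var i :: ('n, 'k) mpoly"
  obtain c where c: "?x - pact s ?x = linear_form (sr s) * c"
    using pact_refl_linear_form[of "sr s" "\<lambda>x. x $ i"] var.prems
    by (auto simp: refl_sr lin_coord linear_form_coord)
  have "?x * f - pact s (?x * f) = (?x - pact s ?x) * f + pact s ?x * (f - pact s f)"
    by (simp add: algebra_simps)
  also have "\<dots> = linear_form (sr s) * (c * f + pact s ?x * g)"
    by (simp add: c g[symmetric] algebra_simps)
  finally show ?case by (intro exI[of _ "c * f + pact s ?x * g"]) (rule sym)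
qed

lemma dd_eq: "s \<in> S \<Longrightarrow> linear_form (sr s) * dd s f = f - pact s f"
proof -
  assume s: "s \<in> S"
  obtain g where g: "linear_form (sr s) * g = f - pact s f" using dd_exists[OF s] by blast
  have "dd s f = g"
    unfolding divided_diff_def
  proof (rule the_equality)
    show "linear_form (sr s) * g = f - pact s f" by (fact g)
    fix h assume "linear_form (sr s) * h = f - pact s f"
    with g show "h = g" using cancel_root[of "sr s" h g] s by simp
  qed
  with g show ?thesis by simp
qed

lemma dd_unique: "s \<in> S \<Longrightarrow> linear_form (sr s) * g = f - pact s f \<Longrightarrow> dd s f = g"
  using cancel_root[of "sr s" "dd s f" g] by (simp add: dd_eq)

lemma dd_add: "s \<in> S \<Longrightarrow> dd s (f + g) = dd s f + dd s g"
  by (rule dd_unique) (auto simp: distrib_left dd_eq)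

lemma dd_mult: "s \<in> S \<Longrightarrow> dd s (f * g) = dd s f * g + pact s f * dd s g"
proof (rule dd_unique)
  assume s: "s \<in> S"
  have "linear_form (sr s) * (dd s f * g + pact s f * dd s g)
      = (linear_form (sr s) * dd s f) * g + pact s f * (linear_form (sr s) * dd s g)"
    by (simp add: algebra_simps)
  thus "linear_form (sr s) * (dd s f * g + pact s f * dd s g) = f * g - pact s (f * g)"
    using s by (simp add: dd_eq algebra_simps)
qed

lemma dd_mult': "s \<in> S \<Longrightarrow> dd s (f * g) = f * dd s g + dd s f * pact s g"
  using dd_mult[of s g f] by (simp add: algebra_simps)

lemma dd_const [simp]: "s \<in> S \<Longrightarrow> dd s (poly_const c) = 0"
  by (rule dd_unique) auto

lemma dd_0 [simp]: "s \<in> S \<Longrightarrow> dd s 0 = 0"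
  by (rule dd_unique) auto

lemma dd_eq_0_iff: "s \<in> S \<Longrightarrow> dd s f = 0 \<longleftrightarrow> pact s f = f"
  using dd_eq[of s f] dd_unique[of s 0 f] by auto

lemma dd_invariant_mult: "s \<in> S \<Longrightarrow> pact s f = f \<Longrightarrow> dd s (f * g) = f * dd s g"
  by (simp add: dd_mult' flip: dd_eq_0_iff)

text \<open>\<open>s\<close> negates both \<open>f - s f\<close> and the root, so it fixes their
  quotient.\<close>

lemma pact_dd: "s \<in> S \<Longrightarrow> pact s (dd s f) = dd s f"
proof -
  assume s: "s \<in> S"
  have "linear_form (act s (sr s)) * pact s (dd s f) = pact s (linear_form (sr s) * dd s f)"
    using s by (simp add: pact_linear_form root_linear)
  also have "\<dots> = - (linear_form (sr s) * dd s f)" using s by (simp add: dd_eq)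
  finally have "linear_form (sr s) * pact s (dd s f) = linear_form (sr s) * dd s f"
    using s by (simp add: act_sr neg_def linear_form_uminus)
  thus ?thesis by (rule cancel_root[rotated]) (use s in auto)
qed

lemma dd_dd: "s \<in> S \<Longrightarrow> dd s (dd s f) = 0"
  by (simp add: dd_eq_0_iff pact_dd)

lemma dd_sum: "s \<in> S \<Longrightarrow> dd s (\<Sum>x\<in>A. f x) = (\<Sum>x\<in>A. dd s (f x))"
  by (induction A rule: infinite_finite_induct) (simp_all add: dd_add)

lemma dd_linear_form:
  assumes "s \<in> S" "lin \<phi>" shows "dd s (linear_form \<phi>) = poly_const (\<phi> (coroot (sr s)))"
  using pact_refl_linear_form[of "sr s" \<phi>] assms by (intro dd_unique) (simp_all add: refl_sr)

text \<open>Natural subtraction makes \<open>d - 1\<close> equal to \<open>0\<close> at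
  \<open>d = 0\<close>, so vanishing in that case is recorded separately.\<close>

lemma dd_homogeneous:
  assumes "s \<in> S" "homogeneous d f"
  shows "homogeneous (d - 1) (dd s f) \<and> (d = 0 \<longrightarrow> dd s f = 0)"
proof -
  \<comment> \<open>Homogeneity of \<open>f\<close> stays in the induction because the Leibniz rule
    for a variable times \<open>f\<close> also yields a multiple of \<open>f\<close> itself.\<close>
  from assms(2) have "homogeneous d f \<and> homogeneous (d - 1) (dd s f) \<and> (d = 0 \<longrightarrow> dd s f = 0)"
  proof (induction rule: homogeneous_induct)
    case (var d i f)
    obtain c where c: "dd s (poly_var i) = poly_const c"
      using dd_linear_form[OF assms(1) lin_coord, of i] by (auto simp: linear_form_coord)
    let ?l = "linear_form (act s (\<lambda>x. x $ i))"
    have 1: "dd s (poly_var i * f) = poly_const c * f + ?l * dd s f"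
      using assms(1) by (simp add: dd_mult c pact_var)
    have "homogeneous d (poly_const c * f)"
      using homogeneous_mult[OF homogeneous_const, of d f c] var by simp
    moreover have "homogeneous d (?l * dd s f)"
    proof (cases d)
      case (Suc e)
      thus ?thesis using homogeneous_mult[OF homogeneous_linear_form, of e "dd s f"] var by auto
    qed (use var in simp)
    ultimately show ?case
      using homogeneous_mult[OF homogeneous_var, of d f i] var by (simp add: 1 homogeneous_add)
  qed (use assms(1) in \<open>simp_all add: dd_add homogeneous_add homogeneous_const\<close>)
  thus ?thesis by blast
qed

subsection \<open>Independence of the reduced word\<close>

definition D :: "'g list \<Rightarrow> ('n, 'k) mpoly \<Rightarrow> ('n, 'k) mpoly" where
  "D xs = foldr dd xs"

lemma D_simps [simp]: "D [] f = f" "D (x # xs) f = dd x (D xs f)" "D (xs @ ys) f = D xs (D ys f)"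
  by (simp_all add: D_def)

lemma D_add: "xs \<in> lists S \<Longrightarrow> D xs (f + g) = D xs f + D xs g"
  by (induction xs) (auto simp: dd_add)

lemma D_0 [simp]: "xs \<in> lists S \<Longrightarrow> D xs 0 = 0"
  by (induction xs) auto

lemma D_const: "xs \<in> lists S \<Longrightarrow> xs \<noteq> [] \<Longrightarrow> D xs (poly_const c) = 0"
  by (induction xs rule: rev_induct) auto

text \<open>Applied with \<open>J = S\<close> to invariants of the whole group, and with the given
  \<open>J\<close> to pull out \<open>Sch x\<close> for a minimal representative
  \<open>x\<close>.\<close>

lemma D_invariant_mult: "xs \<in> lists J \<Longrightarrow> J \<subseteq> S \<Longrightarrow> (\<And>s. s \<in> J \<Longrightarrow> pact s f = f) \<Longrightarrow> D xs (f * g) = f * D xs g"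
  by (induction xs) (auto simp: dd_invariant_mult)

lemma D_homogeneous:
  "xs \<in> lists S \<Longrightarrow> homogeneous d f \<Longrightarrow>
    homogeneous (d - length xs) (D xs f) \<and> (d < length xs \<longrightarrow> D xs f = 0)"
proof (induction xs)
  case (Cons s xs)
  hence "homogeneous (d - length xs) (D xs f)" "d < length xs \<longrightarrow> D xs f = 0" "s \<in> S" by auto
  thus ?case using dd_homogeneous[of s "d - length xs" "D xs f"] by (auto simp: less_Suc_eq)
qed simp

text \<open>Each letter either acts on the form or turns it into a scalar and disappears. Carrying
  that scalar back through the letters to its right replaces the simple coroot by the coroot of
  \<open>word_root\<close>.\<close>

lemma D_linear_form_mult:
  assumes "xs \<in> lists S" "lin \<phi>"
  shows "D xs (linear_form \<phi> * f) = linear_form (act (wprod xs) \<phi>) * D xs f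
    + (\<Sum>i<length xs. poly_const (\<phi> (coroot (word_root xs i))) * D (del i xs) f)"
  using assms(1)
proof (induction xs)
  case Nil
  thus ?case by (simp add: act_def)
next
  case (Cons s xs)
  hence s: "s \<in> S" "xs \<in> lists S" by auto
  define \<mu> where "\<mu> = act (wprod xs) \<phi>"
  have mu: "lin \<mu>" using s assms by (simp add: \<mu>_def lin_act)
  have "word_root (s # xs) 0 = act (inv (wprod xs)) (sr s)" by (simp add: word_root_def)
  hence c0: "\<phi> (coroot (word_root (s # xs) 0)) = \<mu> (coroot (sr s))"
    using s by (simp add: refl_act_coroot) (simp add: \<mu>_def act_def)
  have d: "del 0 (s # xs) = xs" "del (Suc i) (s # xs) = s # del i xs"
    "word_root (s # xs) (Suc i) = word_root xs i" for i
    by (simp_all add: del_def word_root_def)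
  have "D (s # xs) (linear_form \<phi> * f) = dd s (linear_form \<mu> * D xs f)
      + (\<Sum>i<length xs. poly_const (\<phi> (coroot (word_root xs i))) * dd s (D (del i xs) f))"
    using s by (simp add: Cons.IH \<mu>_def dd_add dd_sum dd_invariant_mult)
  also have "dd s (linear_form \<mu> * D xs f)
      = linear_form (act s \<mu>) * dd s (D xs f) + poly_const (\<mu> (coroot (sr s))) * D xs f"
    using s mu by (simp add: dd_mult dd_linear_form pact_linear_form)
  also have "act s \<mu> = act (wprod (s # xs)) \<phi>" using s by (simp add: \<mu>_def act_act)
  finally show ?case
    by (simp add: sum.lessThan_Suc_shift d c0 del: sum.lessThan_Suc)
qed

abbreviation "E \<equiv> divided_diff_elem W S \<rho> \<iota> \<Phi> C"

lemma E_def': "E w = D (SOME xs. reduced_word W S w xs)"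
  by (simp add: divided_diff_elem_def D_def)

lemma some_reduced: "w \<in> carrier W \<Longrightarrow> reduced_word W S w (SOME xs. reduced_word W S w xs)"
  by (rule someI_ex[OF exists_reduced])

lemma reduced_carrier: "reduced_word W S w xs \<Longrightarrow> w \<in> carrier W"
  by (auto simp: reduced_word_def)

text \<open>\<open>wd\<close> and \<open>nil\<close> are the two induction claims for length
  \<open>n\<close>: a deletion that stays reduced depends only on its product, all others vanish.
  Reindexing by inversions then eliminates the word.\<close>

lemma D_deletions:
  assumes wd: "\<And>w xs. reduced_word W S w xs \<Longrightarrow> length xs = n \<Longrightarrow> D xs = E w"
    and nil: "\<And>xs. xs \<in> lists S \<Longrightarrow> length xs = n \<Longrightarrow> len (wprod xs) < n \<Longrightarrow> D xs f = 0"
    and xs: "reduced_word W S w xs" "length xs = Suc n"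
  shows "(\<Sum>i<length xs. poly_const (\<phi> (coroot (word_root xs i))) * D (del i xs) f)
    = (\<Sum>\<beta>\<in>Inv w. poly_const (\<phi> (coroot \<beta>)) *
         (if Suc (len (w \<otimes> refl \<beta>)) = len w then E (w \<otimes> refl \<beta>) f else 0))"
proof -
  note x = reducedD[OF xs(1)]
  let ?g = "\<lambda>\<beta>. poly_const (\<phi> (coroot \<beta>)) *
         (if Suc (len (w \<otimes> refl \<beta>)) = len w then E (w \<otimes> refl \<beta>) f else 0)"
  have "(\<Sum>i<length xs. poly_const (\<phi> (coroot (word_root xs i))) * D (del i xs) f)
      = (\<Sum>i<length xs. ?g (word_root xs i))"
  proof (rule sum.cong)
    fix i assume "i \<in> {..<length xs}"
    hence i: "i < length xs" by simp
    have p: "wprod (del i xs) = w \<otimes> refl (word_root xs i)" using wprod_del[OF x(1) i] x by simp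
    have l: "del i xs \<in> lists S" "length (del i xs) = n"
      using del_in_lists[OF x(1)] length_del[OF i] xs(2) by auto
    show "poly_const (\<phi> (coroot (word_root xs i))) * D (del i xs) f = ?g (word_root xs i)"
    proof (cases "len (wprod (del i xs)) = n")
      case True
      hence "reduced_word W S (wprod (del i xs)) (del i xs)" using l by (simp add: reduced_word_def)
      hence "D (del i xs) = E (wprod (del i xs))" using wd l by blast
      thus ?thesis using True x xs(2) by (simp add: p)
    next
      case False
      hence "len (wprod (del i xs)) < n" using len_le[OF l(1)] l by simp
      thus ?thesis using nil[OF l] x xs(2) by (simp add: p)
    qed
  qed simp
  also have "\<dots> = (\<Sum>\<beta>\<in>Inv w. ?g \<beta>)"
    by (rule sum.reindex_bij_betw[OF word_root_reduced[OF xs(1)]])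
  finally show ?thesis .
qed

text \<open>The two claims need a joint induction, because deleting a letter from a reduced word may
  leave a non-reduced one.\<close>

lemma D_well_defined_aux:
  "(\<forall>w xs. reduced_word W S w xs \<longrightarrow> length xs = n \<longrightarrow> D xs = E w) \<and>
   (\<forall>xs f. xs \<in> lists S \<longrightarrow> length xs = n \<longrightarrow> len (wprod xs) < n \<longrightarrow> D xs f = 0)"
proof (induction n)
  case 0
  have "D xs = E w" if r: "reduced_word W S w xs" "length xs = 0" for w xs
  proof -
    have "length (SOME xs. reduced_word W S w xs) = length xs"
      using reducedD(3)[OF some_reduced[OF reduced_carrier[OF r(1)]]] reducedD(3)[OF r(1)] by simp
    thus ?thesis using r(2) by (simp add: E_def')
  qed
  thus ?case by blast
next
  case (Suc n)
  hence wd: "\<And>w xs. reduced_word W S w xs \<Longrightarrow> length xs = n \<Longrightarrow> D xs = E w"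
    and nil: "\<And>xs f. xs \<in> lists S \<Longrightarrow> length xs = n \<Longrightarrow> len (wprod xs) < n \<Longrightarrow> D xs f = 0"
    by blast+
  have same: "D xs f = D ys f"
    if xs: "reduced_word W S w xs" "length xs = Suc n" and ys: "reduced_word W S w ys" "length ys = Suc n"
    for xs ys w f
  proof (induction f rule: mpoly_induct)
    case (const c)
    show ?case using reducedD[OF xs(1)] reducedD[OF ys(1)] xs(2) ys(2) D_const
      by (metis length_0_conv nat.distinct(1))
  next
    case (add f g)
    thus ?case using reducedD[OF xs(1)] reducedD[OF ys(1)] by (simp add: D_add)
  next
    case (var i f)
    \<comment> \<open>Besides \<open>D zs f\<close> the right-hand side sees only \<open>w\<close>,
      so agreement on \<open>f\<close> extends to \<open>poly_var i * f\<close>.\<close>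
    have "D zs (poly_var i * f) = linear_form (act w (\<lambda>x. x $ i)) * D zs f
        + (\<Sum>\<beta>\<in>Inv w. poly_const (coroot \<beta> $ i) *
            (if Suc (len (w \<otimes> refl \<beta>)) = len w then E (w \<otimes> refl \<beta>) f else 0))"
      if zs: "reduced_word W S w zs" "length zs = Suc n" for zs
      using D_deletions[OF wd nil zs, of "\<lambda>x. x $ i" f] D_linear_form_mult[OF reducedD(1)[OF zs(1)] lin_coord, of i f] reducedD(2)[OF zs(1)]
      by (simp only: linear_form_coord)
    from this[OF xs] this[OF ys] show ?case by (simp only: var)
  qed
  have "D xs = E w" if "reduced_word W S w xs" "length xs = Suc n" for w xs
  proof -
    note sr = some_reduced[OF reduced_carrier[OF that(1)]]
    have "length (SOME xs. reduced_word W S w xs) = Suc n"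
      using reducedD(3)[OF sr] reducedD(3)[OF that(1)] that(2) by simp
    thus ?thesis using same[OF that sr] by (auto simp: E_def')
  qed
  moreover have "D xs f = 0" if xs: "xs \<in> lists S" "length xs = Suc n" "len (wprod xs) < Suc n" for xs f
  proof -
    obtain s a where a: "xs = s # a" using xs by (cases xs) auto
    hence s: "s \<in> S" "a \<in> lists S" "length a = n" using xs by auto
    show ?thesis
    proof (cases "len (wprod a) < n")
      case True
      thus ?thesis using nil[of a f] s a by simp
    next
      case False
      hence la: "len (wprod a) = n" using len_le[of a] s by simp
      hence ra: "reduced_word W S (wprod a) a" using s by (simp add: reduced_word_def)
      \<comment> \<open>The tail \<open>a\<close> is reduced while \<open>s # a\<close> is not, so
        \<open>s\<close> is a left descent of its product. Hence \<open>a\<close> can be traded for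
        a reduced word beginning with \<open>s\<close>, and \<open>dd s\<close> squares to
        zero.\<close>
      have lsa: "len (wprod a) = Suc (len (s \<otimes> wprod a))"
        using len_simple_left_cases[of "wprod a" s] s la xs a by auto
      obtain b where b: "reduced_word W S (s \<otimes> wprod a) b"
        using exists_reduced[of "s \<otimes> wprod a"] s by auto
      hence "reduced_word W S (wprod a) (s # b)"
        using lsa s reducedD[OF b] by (simp add: reduced_word_def)
      hence "D a = D (s # b)" using wd[OF ra] wd[of "wprod a" "s # b"] la s reducedD(3) by metis
      thus ?thesis using a s by (simp add: dd_dd)
    qed
  qed
  ultimately show ?case by blast
qed

lemma D_reduced: "reduced_word W S w xs \<Longrightarrow> D xs = E w"
  using D_well_defined_aux[of "length xs"] by blast

lemma D_nonreduced: "xs \<in> lists S \<Longrightarrow> len (wprod xs) < length xs \<Longrightarrow> D xs f = 0"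
  using D_well_defined_aux[of "length xs"] by blast

text \<open>The nil-Coxeter relations: the concatenation of two reduced words is either reduced or
  gives a vanishing composite.\<close>

lemma E_mult:
  assumes "u \<in> carrier W" "w \<in> carrier W"
  shows "E u (E w f) = (if len (u \<otimes> w) = len u + len w then E (u \<otimes> w) f else 0)"
proof -
  obtain xs ys where r: "reduced_word W S u xs" "reduced_word W S w ys" using assms exists_reduced by blast
  note x = reducedD[OF r(1)] and y = reducedD[OF r(2)]
  have "E u (E w f) = D (xs @ ys) f" using D_reduced[OF r(1)] D_reduced[OF r(2)] by simp
  also have "\<dots> = (if len (u \<otimes> w) = len u + len w then E (u \<otimes> w) f else 0)"
  proof (cases "len (u \<otimes> w) = len u + len w")
    case True
    hence "reduced_word W S (u \<otimes> w) (xs @ ys)" using x y by (simp add: reduced_word_def)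
    thus ?thesis using True D_reduced by auto
  next
    case False
    hence "len (u \<otimes> w) < len u + len w" using len_mult_le[OF assms] by simp
    thus ?thesis using x y False D_nonreduced[of "xs @ ys" f] by simp
  qed
  finally show ?thesis .
qed

text \<open>The commutation rule behind Chevalley's formula, now free of words: besides
  \<open>E w\<close> itself, only elements covered by \<open>w\<close> contribute.\<close>

lemma E_linear_form_mult:
  assumes w: "w \<in> carrier W" and lam: "lin \<phi>"
  shows "E w (linear_form \<phi> * f) = linear_form (act w \<phi>) * E w f
    + (\<Sum>\<beta>\<in>Inv w. poly_const (\<phi> (coroot \<beta>)) *
         (if Suc (len (w \<otimes> refl \<beta>)) = len w then E (w \<otimes> refl \<beta>) f else 0))"
proof -
  obtain xs where r: "reduced_word W S w xs" using assms exists_reduced by blast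
  note x = reducedD[OF r]
  show ?thesis
  proof (cases "length xs")
    case 0
    hence "xs = []" "w = \<one>" using x by auto
    moreover have "Inv w = {}" using card_Inv[OF w] x 0 by simp
    moreover have "E w g = g" for g using D_reduced[OF r] \<open>xs = []\<close> by (metis D_simps(1))
    ultimately show ?thesis by (simp add: act_def)
  next
    case (Suc n)
    have "\<And>xs. xs \<in> lists S \<Longrightarrow> length xs = n \<Longrightarrow> len (wprod xs) < n \<Longrightarrow> D xs f = 0"
      using D_nonreduced by simp
    note D_deletions[OF D_reduced this r Suc, of \<phi>]
    thus ?thesis
      using D_linear_form_mult[OF x(1) lam, of f] by (simp only: D_reduced[OF r] x(2))
  qed
qed

end

context hiller
begin

section \<open>Divided differences indexed by group elements\<close>

lemma E_eq_D: "w \<in> carrier W \<Longrightarrow> \<exists>xs. reduced_word W S w xs \<and> E w = D xs"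
  using some_reduced E_def' by blast

lemma E_add: "w \<in> carrier W \<Longrightarrow> E w (f + g) = E w f + E w g"
  using E_eq_D[of w] by (auto simp: reduced_word_def D_add)

lemma E_0 [simp]: "w \<in> carrier W \<Longrightarrow> E w 0 = 0"
  using E_eq_D[of w] by (auto simp: reduced_word_def)

lemma E_diff: "w \<in> carrier W \<Longrightarrow> E w (f - g) = E w f - E w g"
  using E_add[of w "f - g" g] by simp

lemma E_sum: "w \<in> carrier W \<Longrightarrow> E w (\<Sum>x\<in>A. f x) = (\<Sum>x\<in>A. E w (f x))"
  by (induction A rule: infinite_finite_induct) (simp_all add: E_add)

lemma E_invariant_mult:
  assumes "w \<in> carrier W" "\<And>s. s \<in> S \<Longrightarrow> pact s f = f" shows "E w (f * g) = f * E w g"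
  using E_eq_D[OF assms(1)] D_invariant_mult[OF _ subset_refl assms(2)] by (auto simp: reduced_word_def)

lemma E_const_mult: "w \<in> carrier W \<Longrightarrow> E w (poly_const c * g) = poly_const c * E w g"
  by (rule E_invariant_mult) auto

lemma E_homogeneous:
  assumes "w \<in> carrier W" "homogeneous d f"
  shows "homogeneous (d - len w) (E w f)" "d < len w \<Longrightarrow> E w f = 0"
proof -
  obtain xs where xs: "reduced_word W S w xs" using exists_reduced[OF assms(1)] by blast
  show "homogeneous (d - len w) (E w f)" "d < len w \<Longrightarrow> E w f = 0"
    using D_homogeneous[OF reducedD(1)[OF xs] assms(2)] unfolding D_reduced[OF xs] reducedD(3)[OF xs] by blast+
qed

lemma len_simple [simp]: "s \<in> S \<Longrightarrow> len s = 1"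
  using len_simple_cases[of \<one> s] by simp

lemma dd_eq_E: "s \<in> S \<Longrightarrow> dd s f = E s f"
  using D_reduced[of s "[s]"] by (auto simp: reduced_word_def fun_eq_iff)

lemma E_one [simp]: "E \<one> f = f"
  using D_reduced[of \<one> "[]"] by (auto simp: reduced_word_def fun_eq_iff)

lemma invariant_group:
  assumes "\<And>s. s \<in> S \<Longrightarrow> pact s f = f" "w \<in> carrier W" shows "pact w f = f"
proof -
  obtain xs where xs: "xs \<in> lists S" "wprod xs = w" using exists_word[OF assms(2)] by blast
  have "pact (wprod xs) f = f" using xs(1) by (induction xs) (auto simp: pact_mult assms(1))
  thus ?thesis using xs by simp
qed

subsection \<open>Nonvanishing of the top divided difference\<close>

text \<open>The standard form summed over the group: invariant, and positive definite after applying
  \<iota>.\<close>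

definition inner :: "'k ^ 'n \<Rightarrow> 'k ^ 'n \<Rightarrow> 'k" where
  "inner x y = (\<Sum>w\<in>carrier W. \<Sum>i\<in>UNIV. \<rho> w x $ i * \<rho> w y $ i)"

lemma inner_commute: "inner x y = inner y x"
  by (simp add: inner_def mult.commute)

lemma inner_diff: "inner x (y - z) = inner x y - inner x z"
  by (simp add: inner_def rep_simps sum_subtractf algebra_simps)

lemma inner_scale: "inner x (c *s y) = c * inner x y"
  by (simp add: inner_def rep_simps sum_distrib_left algebra_simps)

lemma lin_inner: "lin (inner x)"
  by (rule linear_functionalI) (simp_all add: inner_scale, simp add: inner_def rep_simps sum.distrib algebra_simps)

lemma inner_invariant: "u \<in> carrier W \<Longrightarrow> inner (\<rho> u x) (\<rho> u y) = inner x y"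
  unfolding inner_def
  by (rule sum.reindex_bij_witness[where i = "\<lambda>w. w \<otimes> inv u" and j = "\<lambda>w. w \<otimes> u"])
     (auto simp: m_assoc rep_mult)

lemma inner_pos: assumes "x \<noteq> 0" shows "\<iota> (inner x x) > 0"
proof -
  obtain i where i: "x $ i \<noteq> 0" using assms by (auto simp: vec_eq_iff)
  have "0 < (\<Sum>w\<in>carrier W. \<Sum>i\<in>UNIV. \<iota> (\<rho> w x $ i) * \<iota> (\<rho> w x $ i))"
  proof (rule sum_pos2[OF finite_W one_closed])
    have "\<iota> (x $ i) * \<iota> (x $ i) > 0" using i iota_eq_0[of "x $ i"] by (metis not_real_square_gt_zero)
    thus "0 < (\<Sum>i\<in>UNIV. \<iota> (\<rho> \<one> x $ i) * \<iota> (\<rho> \<one> x $ i))"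
      by (intro sum_pos2[of _ i]) auto
  qed (auto intro: sum_nonneg)
  thus ?thesis by (simp add: inner_def iota_sum)
qed

text \<open>For \<open>d = x0 - \<rho> (refl \<beta>) x0\<close>, the multiple of the coroot by
  \<open>\<beta> x0\<close>, invariance gives \<open>inner d d = 2 * inner x0 d\<close>, whose left
  side is positive.\<close>

lemma dominant_functional: assumes "\<beta> \<in> Pos" shows "\<iota> (inner x0 (coroot \<beta>)) > 0"
proof -
  have b: "\<beta> \<in> \<Phi>" using assms by simp
  let ?t = "refl \<beta>"
  define d where "d = x0 - \<rho> ?t x0"
  have d: "d = \<beta> x0 *s coroot \<beta>" using b by (simp add: d_def rep_refl)
  have "coroot \<beta> \<noteq> 0" using root_coroot[OF b] two_neq_0 b by (auto simp: root_simps)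
  hence "d \<noteq> 0" using d x0(1)[OF b] by simp
  have "inner d d = 2 * inner x0 d"
    using inner_invariant[OF refl_carrier[OF b], of x0 x0] inner_commute[of "\<rho> ?t x0" x0]
    by (simp add: d_def inner_diff inner_commute[of "x0 - \<rho> ?t x0"])
  moreover have "inner x0 d = \<beta> x0 * inner x0 (coroot \<beta>)" by (simp add: d inner_scale)
  ultimately have "0 < \<iota> (2 * (\<beta> x0 * inner x0 (coroot \<beta>)))" using inner_pos[OF \<open>d \<noteq> 0\<close>] by simp
  hence "0 < 2 * (\<iota> (\<beta> x0) * \<iota> (inner x0 (coroot \<beta>)))" using iota_of_nat[of 2] by simp
  thus ?thesis using assms by (simp add: Pos_iff zero_less_mult_iff)
qed

text \<open>After one factor is split off, the remaining power has degree below \<open>len w\<close>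
  and is killed by \<open>E w\<close>, so only covered elements contribute. Their coefficients are
  positive, and a descent of \<open>w\<close> provides at least one of them.\<close>

lemma E_power_pos:
  assumes "w \<in> carrier W" "len w = k"
  shows "\<exists>c. E w (linear_form (inner x0) ^ k) = poly_const c \<and> \<iota> c > 0"
  using assms
proof (induction k arbitrary: w)
  case 0
  hence "w = \<one>" using len_eq_0 by simp
  thus ?case by (intro exI[of _ 1]) (simp add: poly_const_simps)
next
  case (Suc k)
  let ?l = "linear_form (inner x0)" and ?cov = "\<lambda>\<beta>. Suc (len (w \<otimes> refl \<beta>)) = len w"
  have "\<exists>c. \<beta> \<in> Inv w \<longrightarrow> ?cov \<beta> \<longrightarrow> E (w \<otimes> refl \<beta>) (?l ^ k) = poly_const c \<and> \<iota> c > 0" for \<beta>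
    using Suc.IH[of "w \<otimes> refl \<beta>"] Suc.prems by (auto simp: Inv_def refl_carrier)
  then obtain c where c: "\<And>\<beta>. \<beta> \<in> Inv w \<Longrightarrow> ?cov \<beta> \<Longrightarrow> E (w \<otimes> refl \<beta>) (?l ^ k) = poly_const (c \<beta>) \<and> \<iota> (c \<beta>) > 0"
    by metis
  define C where "C = (\<Sum>\<beta>\<in>Inv w. inner x0 (coroot \<beta>) * (if ?cov \<beta> then c \<beta> else 0))"
  have "E w (?l ^ k) = 0"
    by (rule E_homogeneous(2)[OF Suc.prems(1) homogeneous_power_linear_form]) (use Suc.prems in simp)
  hence "E w (?l ^ Suc k) = (\<Sum>\<beta>\<in>Inv w. poly_const (inner x0 (coroot \<beta>)) *
         (if ?cov \<beta> then E (w \<otimes> refl \<beta>) (?l ^ k) else 0))"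
    using E_linear_form_mult[OF Suc.prems(1) lin_inner, of x0 "?l ^ k"] by simp
  also have "\<dots> = poly_const C"
    unfolding C_def poly_const_sum by (rule sum.cong) (auto simp: c poly_const_simps)
  finally have 1: "E w (?l ^ Suc k) = poly_const C" .
  obtain s where s: "s \<in> S" "len w = Suc (len (w \<otimes> s))" using exists_descent[OF Suc.prems(1)] Suc.prems by auto
  have sI: "sr s \<in> Inv w"
    using s Suc.prems len_simple_less_iff(1)[of w s] by (simp add: Inv_def sr_Pos)
  have pos: "\<iota> (inner x0 (coroot \<beta>)) > 0" if "\<beta> \<in> Inv w" for \<beta>
    using that by (intro dominant_functional) (simp add: Inv_def)
  have "0 < (\<Sum>\<beta>\<in>Inv w. \<iota> (inner x0 (coroot \<beta>)) * \<iota> (if ?cov \<beta> then c \<beta> else 0))"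
  proof (rule sum_pos2[OF finite_Inv sI])
    have "?cov (sr s)" using s by (simp add: refl_sr)
    thus "0 < \<iota> (inner x0 (coroot (sr s))) * \<iota> (if ?cov (sr s) then c (sr s) else 0)"
      using pos[OF sI] c[OF sI] by simp
    show "0 \<le> \<iota> (inner x0 (coroot \<beta>)) * \<iota> (if ?cov \<beta> then c \<beta> else 0)" if "\<beta> \<in> Inv w" for \<beta>
      using pos[OF that] c[OF that] by (auto intro!: mult_nonneg_nonneg less_imp_le)
  qed
  thus ?case using 1 by (intro exI[of _ C]) (simp add: C_def iota_sum)
qed

text \<open>Each \<open>\<partial>\<^sub>s\<close> is self-adjoint for the pairing \<open>alt (f * g)\<close>.  So if \<open>\<partial>\<close> for the longest element killed
  the product of the positive roots, it would vanish identically, against the positivity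
  just shown.\<close>

definition alt :: "('n, 'k) mpoly \<Rightarrow> ('n, 'k) mpoly" where
  "alt f = (\<Sum>w\<in>carrier W. (- 1) ^ len w * pact w f)"

lemma sign_simple: "w \<in> carrier W \<Longrightarrow> s \<in> S \<Longrightarrow> (- 1 :: ('n, 'k) mpoly) ^ len (w \<otimes> s) = - ((- 1) ^ len w)"
  using len_simple_cases[of w s] by auto

lemma alt_diff: "alt (f - g) = alt f - alt g"
  by (simp add: alt_def sum_subtractf right_diff_distrib)

lemma alt_0 [simp]: "alt 0 = 0"
  by (simp add: alt_def)

lemma alt_simple: assumes s: "s \<in> S" shows "alt (pact s f) = - alt f"
proof -
  have "alt (pact s f) = (\<Sum>w\<in>carrier W. - ((- 1) ^ len w * pact w f))"
    unfolding alt_def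
    by (rule sum.reindex_bij_witness[where i = "\<lambda>w. w \<otimes> s" and j = "\<lambda>w. w \<otimes> s"])
       (use s in \<open>auto simp: pact_mult sign_simple\<close>)
  thus ?thesis by (simp add: alt_def sum_negf)
qed

lemma double_cancel: fixes f g :: "('n, 'k) mpoly" assumes "f + f = g + g" shows "f = g"
proof (rule poly_mapping_eqI)
  fix m
  have "2 * lookup f m = 2 * lookup g m"
    using arg_cong[OF assms, of "\<lambda>p. lookup p m"] by (simp only: lookup_add mult_2)
  thus "lookup f m = lookup g m" using two_neq_0 by simp
qed

text \<open>Subtracting from \<open>g * dd s f\<close> its image under \<open>s\<close> gives the
  root times \<open>dd s g * dd s f\<close>, which is symmetric in \<open>f\<close> and
  \<open>g\<close>; on such a difference \<open>alt\<close> takes twice its value on the first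
  term.\<close>

lemma alt_adjoint: assumes s: "s \<in> S" shows "alt (g * dd s f) = alt (dd s g * f)"
proof -
  let ?X = "g * dd s f"
  have "alt ?X + alt ?X = alt (?X - pact s ?X)" using s by (simp only: alt_diff alt_simple) simp
  also have "?X - pact s ?X = (g - pact s g) * dd s f" using s by (simp add: pact_dd algebra_simps)
  also have "\<dots> = dd s g * (linear_form (sr s) * dd s f)" using s by (simp add: dd_eq[symmetric] algebra_simps)
  also have "\<dots> = dd s g * f - pact s (dd s g * f)" using s by (simp add: dd_eq pact_dd algebra_simps)
  also have "alt \<dots> = alt (dd s g * f) + alt (dd s g * f)" using s by (simp only: alt_diff alt_simple) simp
  finally show ?thesis by (rule double_cancel)
qed

lemma alt_adjoint_word: "xs \<in> lists S \<Longrightarrow> alt (g * D xs f) = alt (D (rev xs) g * f)"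
  by (induction xs arbitrary: g) (auto simp: alt_adjoint)

definition root_product :: "('n, 'k) mpoly" where
  "root_product = (\<Prod>\<alpha>\<in>Pos. linear_form \<alpha>)"

lemma pact_prod: "finite A \<Longrightarrow> pact w (\<Prod>x\<in>A. f x) = (\<Prod>x\<in>A. pact w (f x))"
proof (induction A rule: finite_induct)
  case empty
  show ?case using pact_simps(2)[of w 1] by (simp add: poly_const_simps)
qed simp

text \<open>\<open>s\<close> negates \<open>sr s\<close> and permutes the other positive
  roots.\<close>

lemma root_product_simple: assumes s: "s \<in> S" shows "pact s root_product = - root_product"
proof -
  have fin: "finite (Pos - {sr s})" using finite_Pos by simp
  have P: "root_product = linear_form (sr s) * (\<Prod>\<alpha>\<in>Pos - {sr s}. linear_form \<alpha>)"
    unfolding root_product_def using sr_Pos[OF s] finite_Pos by (rule prod.remove[rotated])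
  have cl: "act s \<alpha> \<in> Pos - {sr s}" if "\<alpha> \<in> Pos - {sr s}" for \<alpha>
  proof -
    have "act s \<alpha> \<noteq> sr s"
    proof
      assume "act s \<alpha> = sr s"
      hence "\<alpha> = neg (sr s)" using act_simple_simple[OF s, of \<alpha>] that act_sr[OF s] by simp
      thus False using that neg_not_Pos sr_Pos[OF s] by auto
    qed
    thus ?thesis using that act_simple_Pos[OF s] by auto
  qed
  have "pact s (\<Prod>\<alpha>\<in>Pos - {sr s}. linear_form \<alpha>) = (\<Prod>\<alpha>\<in>Pos - {sr s}. linear_form (act s \<alpha>))"
    using fin by (simp add: pact_prod pact_linear_form root_linear)
  also have "\<dots> = (\<Prod>\<alpha>\<in>Pos - {sr s}. linear_form \<alpha>)"
    by (rule prod.reindex_bij_witness[where i = "act s" and j = "act s"])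
       (use cl act_simple_simple[OF s] in auto)
  finally show ?thesis
    using s by (simp add: P pact_linear_form root_linear act_sr neg_def linear_form_uminus)
qed

lemma root_product_sign: "w \<in> carrier W \<Longrightarrow> pact w root_product = (- 1) ^ len w * root_product"
proof -
  assume "w \<in> carrier W"
  then obtain xs where "reduced_word W S w xs" using exists_reduced by blast
  thus ?thesis
  proof (induction xs arbitrary: w rule: rev_induct)
    case Nil
    thus ?case by (auto simp: reduced_word_def)
  next
    case (snoc s xs)
    note r = reduced_snoc[OF snoc.prems]
    have "pact w root_product = pact (w \<otimes> s \<otimes> s) root_product" using r by simp
    also have "\<dots> = pact (w \<otimes> s) (pact s root_product)" using r by (subst pact_mult) auto
    also have "\<dots> = - ((- 1) ^ len (w \<otimes> s) * root_product)"
      using r snoc.IH[OF r(3)] by (simp add: root_product_simple)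
    finally show ?case using r(4) by simp
  qed
qed

lemma cancel_root_product: assumes "root_product * f = 0" shows "f = 0"
proof -
  have "f = 0" if "finite A" "A \<subseteq> \<Phi>" "(\<Prod>\<alpha>\<in>A. linear_form \<alpha>) * f = 0" for A
    using that
  proof (induction A rule: finite_induct)
    case (insert \<alpha> A)
    hence "linear_form \<alpha> * ((\<Prod>\<alpha>\<in>A. linear_form \<alpha>) * f) = linear_form \<alpha> * 0"
      by (simp add: mult.assoc)
    hence "(\<Prod>\<alpha>\<in>A. linear_form \<alpha>) * f = 0" by (rule cancel_root[rotated]) (use insert.prems in simp)
    thus ?case using insert by simp
  qed simp
  thus ?thesis using assms finite_Pos Pos_subset by (auto simp: root_product_def)
qed

text \<open>\<open>w0\<close> cannot be lengthened, so every \<open>dd s\<close> kills the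
  value.\<close>

lemma E_w0_invariant: assumes "s \<in> S" shows "pact s (E w0 f) = E w0 f"
proof -
  have "len (s \<otimes> w0) \<noteq> len s + len w0" using len_mult_w0[of s] assms len_w0 by simp
  hence "dd s (E w0 f) = 0" using assms by (simp add: dd_eq_E E_mult)
  thus ?thesis using assms by (simp add: dd_eq_0_iff)
qed

lemma E_w0_root_product: "E w0 root_product \<noteq> 0"
proof
  assume z: "E w0 root_product = 0"
  obtain c where c: "E w0 (linear_form (inner x0) ^ len w0) = poly_const c" "\<iota> c > 0"
    using E_power_pos[OF w0_closed] by blast
  obtain xs where xs: "reduced_word W S w0 xs" using exists_reduced[OF w0_closed] by blast
  \<comment> \<open>The adjoint of the operator along \<open>xs\<close> runs along
    \<open>rev xs\<close>, again a reduced word of \<open>w0\<close> because \<open>w0\<close> is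
    its own inverse.\<close>
  have "reduced_word W S w0 (rev xs)"
    using xs by (simp add: reduced_word_def wprod_rev inv_w0 in_lists_conv_set)
  hence "D (rev xs) root_product = 0" using z D_reduced by simp
  hence "alt (root_product * D xs f) = 0" for f using reducedD[OF xs] by (simp add: alt_adjoint_word)
  hence "alt (root_product * E w0 f) = 0" for f using D_reduced[OF xs] by simp
  \<comment> \<open>Antisymmetry of the root product cancels the signs in \<open>alt\<close>, so all
    summands coincide.\<close>
  moreover have "alt (root_product * E w0 f) = root_product * (of_nat (card (carrier W)) * E w0 f)" for f
  proof -
    have "alt (root_product * E w0 f) = (\<Sum>w\<in>carrier W. root_product * E w0 f)"
      unfolding alt_def
    proof (rule sum.cong)
      fix w assume w: "w \<in> carrier W"
      have "pact w (E w0 f) = E w0 f" using E_w0_invariant w by (rule invariant_group)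
      thus "(- 1) ^ len w * pact w (root_product * E w0 f) = root_product * E w0 f"
        using w by (simp add: root_product_sign flip: mult.assoc power_add)
    qed simp
    thus ?thesis by (simp add: algebra_simps)
  qed
  ultimately have "of_nat (card (carrier W)) * E w0 f = 0" for f
    using cancel_root_product[of "of_nat (card (carrier W)) * E w0 f"] by simp
  from this[of "linear_form (inner x0) ^ len w0"] have "of_nat (card (carrier W)) * (poly_const c :: ('n, 'k) mpoly) = 0"
    by (simp only: c(1))
  hence "lookup (of_nat (card (carrier W)) * (poly_const c :: ('n, 'k) mpoly)) 0 = 0" by simp
  hence "of_nat (card (carrier W)) * c = 0" by (simp add: lookup_0_mult lookup_of_nat)
  moreover have "card (carrier W) > 0" using finite_W by (auto simp: card_gt_0_iff)
  ultimately show False using of_nat_neq_0 c by simp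
qed

subsection \<open>Schubert polynomials\<close>

abbreviation "Sch \<equiv> schubert W S \<rho> \<iota> \<Phi> C"

text \<open>In fact \<open>\<kappa> = 1\<close>, but only \<open>\<kappa> \<noteq> 0\<close> is needed.\<close>

definition \<kappa> :: 'k where
  "\<kappa> = lookup (Sch \<one>) 0"

lemma Sch_def: "Sch w = E (inv w \<otimes> w0) (schubert_top W \<iota> \<Phi> C)"
  by (simp add: schubert_def)

text \<open>Multiplication by \<open>w0\<close> reverses lengths, so the additivity condition of
  \<open>E_mult\<close> becomes a drop in length from \<open>w\<close> to
  \<open>w \<otimes> inv u\<close>.\<close>

lemma E_Sch:
  assumes "u \<in> carrier W" "w \<in> carrier W"
  shows "E u (Sch w) = (if len (w \<otimes> inv u) + len u = len w then Sch (w \<otimes> inv u) else 0)"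
proof -
  have e: "u \<otimes> (inv w \<otimes> w0) = inv (w \<otimes> inv u) \<otimes> w0" using assms by (simp add: inv_mult_group m_assoc)
  have "len (inv (w \<otimes> inv u) \<otimes> w0) + len (w \<otimes> inv u) = card Pos"
    using len_mult_w0[of "inv (w \<otimes> inv u)"] assms len_inv[of "w \<otimes> inv u"] by simp
  moreover have "len (inv w \<otimes> w0) + len w = card Pos"
    using len_mult_w0[of "inv w"] assms by (simp add: len_inv)
  ultimately have "len (u \<otimes> (inv w \<otimes> w0)) = len u + len (inv w \<otimes> w0) \<longleftrightarrow> len (w \<otimes> inv u) + len u = len w"
    unfolding e by linarith
  moreover have "inv w \<otimes> w0 \<in> carrier W" using assms by simp
  ultimately show ?thesis
    unfolding Sch_def using E_mult[OF assms(1)] e by simp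
qed

lemma homogeneous_Sch: assumes "w \<in> carrier W" shows "homogeneous (len w) (Sch w)"
proof -
  have "homogeneous (card Pos) (schubert_top W \<iota> \<Phi> C)"
    unfolding schubert_top_def
    using homogeneous_mult[OF homogeneous_const homogeneous_prod_linear_forms] by simp
  moreover have "inv w \<otimes> w0 \<in> carrier W" using assms by simp
  ultimately have "homogeneous (card Pos - len (inv w \<otimes> w0)) (Sch w)"
    unfolding Sch_def by (intro E_homogeneous)
  moreover have "len (inv w \<otimes> w0) + len w = card Pos"
    using len_mult_w0[of "inv w"] assms by (simp add: len_inv)
  ultimately show ?thesis by (metis add_diff_cancel_left')
qed

lemma Sch_one: "Sch \<one> = poly_const \<kappa>"
  unfolding \<kappa>_def using homogeneous_Sch[of \<one>] by (intro homogeneous_degree_0) simp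

text \<open>Up to a nonzero scalar, \<open>Sch \<one>\<close> is the longest operator applied to the
  product of the positive roots.\<close>

lemma kappa_neq_0: "\<kappa> \<noteq> 0"
proof
  assume "\<kappa> = 0"
  hence "Sch \<one> = 0" by (simp add: Sch_one poly_const_simps)
  hence "poly_const (inverse (of_nat (card (carrier W)))) * E w0 root_product = 0"
    unfolding Sch_def schubert_top_def root_product_def[symmetric] by (simp add: E_const_mult)
  hence "poly_const (of_nat (card (carrier W))) * (poly_const (inverse (of_nat (card (carrier W)))) * E w0 root_product) = 0"
    by simp
  moreover have "card (carrier W) > 0" using finite_W by (auto simp: card_gt_0_iff)
  ultimately have "E w0 root_product = 0"
    by (simp add: of_nat_neq_0 poly_const_simps flip: mult.assoc poly_const_simps(6))
  thus False using E_w0_root_product by simp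
qed

lemma lookup_Sch_0: "w \<in> carrier W \<Longrightarrow> lookup (Sch w) 0 = (if w = \<one> then \<kappa> else 0)"
  using homogeneous_lookup_0[OF homogeneous_Sch, of w] len_eq_0[of w] by (cases "w = \<one>") (simp_all add: \<kappa>_def)

lemma dd_Sch:
  assumes "s \<in> S" "w \<in> carrier W"
  shows "dd s (Sch w) = (if len (w \<otimes> s) < len w then Sch (w \<otimes> s) else 0)"
  using len_simple_cases[of w s] assms by (auto simp: dd_eq_E E_Sch)

lemma pact_Sch: "s \<in> S \<Longrightarrow> w \<in> carrier W \<Longrightarrow> len w < len (w \<otimes> s) \<Longrightarrow> pact s (Sch w) = Sch w"
  by (simp add: dd_Sch flip: dd_eq_0_iff)

lemma E_Sch_lookup_0:
  assumes "u \<in> carrier W" "w \<in> carrier W"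
  shows "lookup (E u (Sch w)) 0 = (if u = w then \<kappa> else 0)"
proof -
  have "w \<otimes> inv u = \<one> \<longleftrightarrow> u = w" using assms by (metis inv_closed inv_equality inv_inv r_inv)
  thus ?thesis using assms by (auto simp: E_Sch lookup_Sch_0)
qed

lemma E_Sch_same_length:
  assumes "u \<in> carrier W" "w \<in> carrier W" "len w \<le> len u"
  shows "E u (Sch w) = (if u = w then poly_const \<kappa> else 0)"
proof -
  have "w \<otimes> inv u = \<one> \<longleftrightarrow> u = w" using assms by (metis inv_closed inv_equality inv_inv r_inv)
  moreover have "len (w \<otimes> inv u) + len u \<noteq> len w" if "w \<otimes> inv u \<noteq> \<one>"
    using assms len_eq_0[of "w \<otimes> inv u"] that by simp
  ultimately show ?thesis using assms by (cases "u = w") (simp_all add: E_Sch Sch_one)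
qed

text \<open>Peeling off the operators of maximal length acting nontrivially on \<open>f\<close>: their values are
  invariant because every further divided difference kills them.\<close>

lemma invariant_expansion:
  "\<exists>g. (\<forall>u\<in>carrier W. \<forall>s\<in>S. pact s (g u) = g u) \<and> f = (\<Sum>u\<in>carrier W. g u * Sch u)"
proof -
  have "\<exists>g. (\<forall>u\<in>carrier W. \<forall>s\<in>S. pact s (g u) = g u) \<and> f = (\<Sum>u\<in>carrier W. g u * Sch u)"
    if "\<forall>u\<in>carrier W. j \<le> len u \<longrightarrow> E u f = 0" for j f
    using that
  proof (induction j arbitrary: f)
    case 0
    hence "E \<one> f = 0" by blast
    thus ?case by (intro exI[of _ "\<lambda>_. 0"]) simp
  next
    case (Suc j)
    \<comment> \<open>The operator of \<open>u\<close> sends \<open>Sch u\<close> to the constant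
      \<kappa>, which the coefficient must compensate.\<close>
    define h where "h u = (if len u = j then poly_const (inverse \<kappa>) * E u f else 0)" for u
    have inv: "pact s (h u) = h u" if "u \<in> carrier W" "s \<in> S" for u s
    proof (cases "len u = j")
      case True
      have "len (s \<otimes> u) = len s + len u \<Longrightarrow> E (s \<otimes> u) f = 0" using Suc.prems that True by auto
      hence "dd s (E u f) = 0" using that by (simp add: dd_eq_E E_mult)
      thus ?thesis using that by (simp add: h_def dd_eq_0_iff)
    qed (simp add: h_def)
    define f' where "f' = f - (\<Sum>u\<in>carrier W. h u * Sch u)"
    have "E u f' = 0" if u: "u \<in> carrier W" "j \<le> len u" for u
    proof -
      have "E u (h w * Sch w) = (if w = u then poly_const \<kappa> * h u else 0)" if w: "w \<in> carrier W" for w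
      proof (cases "len w = j")
        case True
        thus ?thesis using u w inv[OF w] by (simp add: E_invariant_mult E_Sch_same_length mult.commute)
      next
        case False
        thus ?thesis using u by (auto simp: h_def)
      qed
      hence "E u f' = E u f - poly_const \<kappa> * h u"
        using u finite_W by (simp add: f'_def E_diff E_sum)
      also have "\<dots> = 0"
        using u Suc.prems kappa_neq_0
        by (auto simp: h_def poly_const_simps simp flip: mult.assoc poly_const_simps(6))
      finally show ?thesis .
    qed
    then obtain g where g: "\<forall>u\<in>carrier W. \<forall>s\<in>S. pact s (g u) = g u" "f' = (\<Sum>u\<in>carrier W. g u * Sch u)"
      using Suc.IH[of f'] by blast
    thus ?case using inv
      by (intro exI[of _ "\<lambda>u. g u + h u"]) (auto simp: f'_def sum.distrib distrib_right algebra_simps)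
  qed
  \<comment> \<open>No length exceeds the number of positive roots, so the peeling can start just
    above it.\<close>
  moreover have "\<forall>u\<in>carrier W. Suc (card Pos) \<le> len u \<longrightarrow> E u f = 0"
    using len_mult_w0 by fastforce
  ultimately show ?thesis by blast
qed

section \<open>Expansions modulo the ideal of positive-degree invariants\<close>

abbreviation "Iinv \<equiv> invariant_ideal W \<rho>"

lemma poly_ring_simps [simp]:
  "carrier (poly_ring :: ('n, 'k) mpoly ring) = UNIV" "x \<otimes>\<^bsub>poly_ring\<^esub> y = x * y"
  "x \<oplus>\<^bsub>poly_ring\<^esub> y = x + y" "\<zero>\<^bsub>poly_ring\<^esub> = (0 :: ('n, 'k) mpoly)" "\<one>\<^bsub>poly_ring\<^esub> = (1 :: ('n, 'k) mpoly)"
  by (simp_all add: poly_ring_def ring_of_type_algebra_def)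

lemma cring_poly_ring: "cring (poly_ring :: ('n, 'k) mpoly ring)"
  unfolding poly_ring_def by (rule cring_from_type_algebra)

lemma ideal_Iinv: "ideal Iinv poly_ring"
  unfolding invariant_ideal_def
  by (rule ring.genideal_ideal) (auto simp: cring.axioms(1) cring_poly_ring)

lemma Iinv_closed:
  "f \<in> Iinv \<Longrightarrow> g \<in> Iinv \<Longrightarrow> f + g \<in> Iinv" "f \<in> Iinv \<Longrightarrow> g * f \<in> Iinv" "0 \<in> Iinv"
  "f \<in> positive_invariants W \<rho> \<Longrightarrow> f \<in> Iinv"
proof -
  interpret ideal Iinv poly_ring by (rule ideal_Iinv)
  show "f \<in> Iinv \<Longrightarrow> g \<in> Iinv \<Longrightarrow> f + g \<in> Iinv" using additive_subgroup.a_closed[OF additive_subgroup_axioms, of f g] by simp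
  show "f \<in> Iinv \<Longrightarrow> g * f \<in> Iinv" using I_l_closed[of f g] by simp
  show "0 \<in> Iinv" using additive_subgroup.zero_closed[OF additive_subgroup_axioms] by simp
  show "f \<in> positive_invariants W \<rho> \<Longrightarrow> f \<in> Iinv"
    unfolding invariant_ideal_def using genideal_self[of "positive_invariants W \<rho>"] by auto
qed

lemma Iinv_sum: "(\<And>x. x \<in> A \<Longrightarrow> f x \<in> Iinv) \<Longrightarrow> (\<Sum>x\<in>A. f x) \<in> Iinv"
  by (induction A rule: infinite_finite_induct) (auto intro: Iinv_closed)

text \<open>Modulo the ideal an invariant coefficient equals its constant term, which is recovered,
  up to the factor \<kappa>, by applying \<open>E u\<close> to \<open>f\<close> and evaluating at
  the origin.\<close>

lemma schubert_expansion:
  "f - (\<Sum>u\<in>carrier W. poly_const (inverse \<kappa> * lookup (E u f) 0) * Sch u) \<in> Iinv"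
proof -
  obtain g where g: "\<And>u s. u \<in> carrier W \<Longrightarrow> s \<in> S \<Longrightarrow> pact s (g u) = g u" "f = (\<Sum>u\<in>carrier W. g u * Sch u)"
    using invariant_expansion[of f] by blast
  have "lookup (E w f) 0 = \<kappa> * lookup (g w) 0" if w: "w \<in> carrier W" for w
  proof -
    have "E w f = (\<Sum>u\<in>carrier W. g u * E w (Sch u))"
      unfolding g(2) using w g(1) by (simp add: E_sum E_invariant_mult)
    hence "lookup (E w f) 0 = (\<Sum>u\<in>carrier W. if u = w then \<kappa> * lookup (g w) 0 else 0)"
      using w by (auto simp: lookup_sum lookup_0_mult E_Sch_lookup_0 intro!: sum.cong)
    thus ?thesis using w finite_W by simp
  qed
  hence "inverse \<kappa> * lookup (E w f) 0 = lookup (g w) 0" if "w \<in> carrier W" for w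
    using that kappa_neq_0 by simp
  hence "f - (\<Sum>u\<in>carrier W. poly_const (inverse \<kappa> * lookup (E u f) 0) * Sch u)
      = (\<Sum>u\<in>carrier W. (g u - poly_const (lookup (g u) 0)) * Sch u)"
    by (subst (1) g(2)) (simp add: left_diff_distrib sum_subtractf)
  also have "\<dots> \<in> Iinv"
  proof (rule Iinv_sum)
    fix u assume u: "u \<in> carrier W"
    have "g u - poly_const (lookup (g u) 0) \<in> positive_invariants W \<rho>"
      using invariant_group[of "g u"] g(1)[OF u] by (auto simp: positive_invariants_def lookup_minus)
    thus "(g u - poly_const (lookup (g u) 0)) * Sch u \<in> Iinv"
      by (subst mult.commute) (intro Iinv_closed(2) Iinv_closed(4))
  qed
  finally show ?thesis .
qed

subsection \<open>Products with Schubert polynomials\<close>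

text \<open>The last letter \<open>s\<close> either differentiates \<open>f\<close>, leaving
  \<open>x\<close> below the shorter \<open>u \<otimes> s\<close>, or differentiates
  \<open>Sch x\<close>, shortening \<open>x\<close> and \<open>u\<close> alike; the lifting property
  undoes the latter.\<close>

lemma coeff_support:
  assumes "reduced_word W S u xs" "x \<in> carrier W" "lookup (D xs (Sch x * f)) 0 \<noteq> 0"
  shows "x \<preceq> u"
  using assms
proof (induction xs arbitrary: u x f rule: rev_induct)
  case Nil
  thus ?case by (auto simp: reduced_word_def lookup_0_mult lookup_Sch_0 split: if_splits)
next
  case (snoc s xs)
  note r = reduced_snoc[OF snoc.prems(1)]
  have us: "u \<otimes> s \<in> carrier W" using r by simp
  have le: "u \<otimes> s \<preceq> u" using r by (intro bruhat_gt_simple) auto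
  have xl: "xs \<in> lists S" using reducedD[OF r(3)] by simp
  have "D (xs @ [s]) (Sch x * f) = D xs (Sch x * dd s f) + D xs (dd s (Sch x) * pact s f)"
    using r xl by (simp add: dd_mult' D_add)
  hence "lookup (D xs (Sch x * dd s f)) 0 \<noteq> 0 \<or> lookup (D xs (dd s (Sch x) * pact s f)) 0 \<noteq> 0"
    using snoc.prems(3) by (auto simp: lookup_add)
  thus ?case
  proof
    assume "lookup (D xs (Sch x * dd s f)) 0 \<noteq> 0"
    hence "x \<preceq> u \<otimes> s" using snoc.IH[OF r(3) snoc.prems(2)] by blast
    thus ?thesis using le bruhat_trans by blast
  next
    assume nz: "lookup (D xs (dd s (Sch x) * pact s f)) 0 \<noteq> 0"
    hence l: "len (x \<otimes> s) < len x" using xl by (auto simp: dd_Sch r snoc.prems split: if_splits)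
    hence "x \<otimes> s \<preceq> u \<otimes> s"
      using nz snoc.IH[OF r(3), of "x \<otimes> s" "pact s f"] r snoc.prems by (simp add: dd_Sch)
    hence "x \<otimes> s \<otimes> s \<preceq> u \<otimes> s \<otimes> s" using bruhat_mult_simple[OF _ us r(1)] r us by simp
    thus ?thesis using r snoc.prems by simp
  qed
qed

text \<open>A letter that spared \<open>Sch x\<close> would put \<open>x\<close> below a shorter
  element, so every letter differentiates \<open>Sch x\<close>. Meanwhile \<open>f\<close> is only
  acted on, which preserves its constant term.\<close>

lemma coeff_diagonal:
  assumes "reduced_word W S x xs"
  shows "lookup (D xs (Sch x * f)) 0 = \<kappa> * lookup f 0"
  using assms
proof (induction xs arbitrary: x f rule: rev_induct)
  case Nil
  thus ?case by (auto simp: reduced_word_def lookup_0_mult lookup_Sch_0)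
next
  case (snoc s xs)
  note r = reduced_snoc[OF snoc.prems(1)]
  have xl: "xs \<in> lists S" using reducedD[OF r(3)] by simp
  have "lookup (D xs (Sch x * dd s f)) 0 = 0"
  proof (rule ccontr)
    assume "\<not> ?thesis"
    hence "x \<preceq> x \<otimes> s" using coeff_support[OF r(3) r(2)] by blast
    thus False using bruhat_len r(4) by fastforce
  qed
  moreover have "dd s (Sch x) = Sch (x \<otimes> s)" using r by (simp add: dd_Sch)
  ultimately show ?case
    using r xl snoc.IH[OF r(3), of "pact s f"] by (simp add: dd_mult' D_add lookup_add pact_lookup_0)
qed

text \<open>\<open>Sch x\<close> is fixed by the reflections in \<open>J\<close>, so the letters of
  \<open>zs\<close> differentiate \<open>Sch z\<close> alone, and those of \<open>x\<close> then
  extract the constant term. This is the triangularity within one coset.\<close>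

lemma coset_product_coeff:
  assumes J: "J \<subseteq> S" and x: "x \<in> min_coset_reps W S J"
    and zs: "zs \<in> lists J" "reduced_word W S (wprod zs) zs"
    and len: "len (x \<otimes> wprod zs) = len x + length zs"
    and z: "z \<in> carrier W"
  shows "lookup (E (x \<otimes> wprod zs) (Sch x * Sch z)) 0 = (if wprod zs = z then \<kappa> * \<kappa> else 0)"
proof -
  have xc: "x \<in> carrier W" using x by (simp add: min_coset_reps_def)
  have zS: "zs \<in> lists S" using zs J by (auto simp: in_lists_conv_set)
  obtain xs where xs: "reduced_word W S x xs" using exists_reduced[OF xc] by blast
  have "reduced_word W S (x \<otimes> wprod zs) (xs @ zs)"
    using reducedD[OF xs] zS len by (simp add: reduced_word_def)
  hence "E (x \<otimes> wprod zs) (Sch x * Sch z) = D xs (D zs (Sch x * Sch z))" using D_reduced by (metis D_simps(3))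
  also have "D zs (Sch x * Sch z) = Sch x * D zs (Sch z)"
    by (rule D_invariant_mult[OF zs(1) J]) (use pact_Sch coset_rep_ascent[OF x _ J] xc J in blast)
  also have "D zs (Sch z) = E (wprod zs) (Sch z)" using D_reduced[OF zs(2)] by simp
  finally show ?thesis using coeff_diagonal[OF xs] z zS by (simp add: E_Sch_lookup_0)
qed

lemma schubert_product:
  assumes "x \<in> carrier W"
  shows "f * Sch x - (\<Sum>u\<in>{u \<in> carrier W. x \<preceq> u}. poly_const (inverse \<kappa> * lookup (E u (f * Sch x)) 0) * Sch u) \<in> Iinv"
proof -
  have "(\<Sum>u\<in>carrier W. poly_const (inverse \<kappa> * lookup (E u (f * Sch x)) 0) * Sch u)
      = (\<Sum>u\<in>{u \<in> carrier W. x \<preceq> u}. poly_const (inverse \<kappa> * lookup (E u (f * Sch x)) 0) * Sch u)"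
  proof (rule sum.mono_neutral_right)
    show "\<forall>u\<in>carrier W - {u \<in> carrier W. x \<preceq> u}. poly_const (inverse \<kappa> * lookup (E u (f * Sch x)) 0) * Sch u = 0"
    proof
      fix u assume u: "u \<in> carrier W - {u \<in> carrier W. x \<preceq> u}"
      then obtain xs where "reduced_word W S u xs" "E u = D xs" using E_eq_D[of u] by blast
      hence "lookup (E u (f * Sch x)) 0 = 0"
        using coeff_support[of u xs x f] u assms by (auto simp: mult.commute)
      thus "poly_const (inverse \<kappa> * lookup (E u (f * Sch x)) 0) * Sch u = 0" by (simp add: poly_const_simps)
    qed
  qed (use finite_W in auto)
  thus ?thesis using schubert_expansion[of "f * Sch x"] by simp
qed

text \<open>Modulo the ideal, \<open>S\<^sub>x S\<^sub>z\<close> equals \<open>\<kappa> S\<^sub>x\<^sub>z\<close> plus terms whose minimal coset representative is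
  longer than \<open>x\<close>.\<close>

lemma schubert_in_generated:
  assumes J: "J \<subseteq> S" and v: "v \<in> min_coset_reps W S J"
    and Q0: "Iinv \<subseteq> Q" and Qadd: "\<And>f g. f \<in> Q \<Longrightarrow> g \<in> Q \<Longrightarrow> f + g \<in> Q"
    and Qmult: "\<And>f g. f \<in> Q \<Longrightarrow> g * f \<in> Q"
    and gens: "\<And>x. x \<in> min_coset_reps W S J \<Longrightarrow> v \<preceq> x \<Longrightarrow> Sch x \<in> Q"
    and u: "u \<in> carrier W" "v \<preceq> u"
  shows "Sch u \<in> Q"
proof -
  have Qsum: "(\<Sum>x\<in>A. f x) \<in> Q" if "\<And>x. x \<in> A \<Longrightarrow> f x \<in> Q" for A and f :: "'g \<Rightarrow> ('n, 'k) mpoly"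
    using that by (induction A rule: infinite_finite_induct) (use Q0 Iinv_closed(3) Qadd in auto)
  have Qdiff: "f - g \<in> Q" if "f \<in> Q" "g \<in> Q" for f g
    using Qadd[OF that(1) Qmult[OF that(2), of "- 1"]] by simp
  have lenb: "len w \<le> card Pos" if "w \<in> carrier W" for w using len_mult_w0[OF that] by simp
  have "Sch (x \<otimes> wprod zs) \<in> Q"
    if "x \<in> min_coset_reps W S J" "v \<preceq> x" "zs \<in> lists J" "reduced_word W S (wprod zs) zs"
      "len (x \<otimes> wprod zs) = len x + length zs" for x zs
    using that
  proof (induction "card Pos - len x" arbitrary: x zs rule: less_induct)
    case less
    have xc: "x \<in> carrier W" using less.prems by (simp add: min_coset_reps_def)
    have zS: "zs \<in> lists S" using less.prems J by (auto simp: in_lists_conv_set)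
    define z where "z = wprod zs"
    have zc: "z \<in> carrier W" using zS by (simp add: z_def)
    define c where "c u = inverse \<kappa> * lookup (E u (Sch z * Sch x)) 0" for u
    define U where "U = {u \<in> carrier W. x \<preceq> u}"
    \<comment> \<open>The comparison is read off from the nonzero coefficient at
      \<open>x \<otimes> z\<close> by \<open>coeff_support\<close>.\<close>
    have xle: "x \<preceq> x \<otimes> z"
    proof -
      have "lookup (E (x \<otimes> z) (Sch x * Sch z)) 0 = \<kappa> * \<kappa>"
        using coset_product_coeff[OF J less.prems(1,3,4,5) zc] by (simp add: z_def)
      moreover obtain ys where "reduced_word W S (x \<otimes> z) ys" "E (x \<otimes> z) = D ys"
        using E_eq_D[of "x \<otimes> z"] xc zc by auto
      ultimately show ?thesis using coeff_support[of "x \<otimes> z" ys x "Sch z"] xc kappa_neq_0 by simp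
    qed
    have xzU: "x \<otimes> z \<in> U" using xle xc zc by (simp add: U_def)
    have finU: "finite U" using finite_W by (simp add: U_def)
    have cxz: "c (x \<otimes> z) = \<kappa>"
      using coset_product_coeff[OF J less.prems(1,3,4,5) zc] kappa_neq_0 by (simp add: c_def z_def mult.commute)
    \<comment> \<open>Within the coset of \<open>x\<close> the coefficient is zero; in any other
      coset the representative \<open>y\<close> is strictly above \<open>x\<close>, hence longer,
      and the induction hypothesis applies.\<close>
    have other: "poly_const (c w) * Sch w \<in> Q" if w: "w \<in> U - {x \<otimes> z}" for w
    proof -
      have wc: "w \<in> carrier W" "x \<preceq> w" using w by (auto simp: U_def)
      obtain y ys where y: "y \<in> min_coset_reps W S J" "ys \<in> lists J" "reduced_word W S (wprod ys) ys"
        "w = y \<otimes> wprod ys" "len w = len y + length ys" "x \<preceq> y"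
        using coset_decomposition[OF J wc(1)] less.prems(1) wc(2) by blast
      have yc: "y \<in> carrier W" using y by (simp add: min_coset_reps_def)
      show ?thesis
      proof (cases "y = x")
        case True
        have "wprod ys \<noteq> z" using w y True by auto
        hence "lookup (E w (Sch x * Sch z)) 0 = 0"
          using coset_product_coeff[OF J less.prems(1) y(2,3) _ zc] y True by simp
        hence "c w = 0" by (simp add: c_def mult.commute)
        thus ?thesis using Q0 Iinv_closed(3) by (auto simp: poly_const_simps)
      next
        case False
        hence "len x < len y" using bruhat_len_eq[OF y(6)] by fastforce
        hence "card Pos - len y < card Pos - len x" using lenb[OF yc] by linarith
        hence "Sch (y \<otimes> wprod ys) \<in> Q"
          using less.hyps[of y ys] y less.prems(2) bruhat_trans by metis
        thus ?thesis using y Qmult by simp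
      qed
    qed
    have "Sch z * Sch x \<in> Q" using gens[OF less.prems(1,2)] Qmult by blast
    moreover have "Sch z * Sch x - (\<Sum>w\<in>U. poly_const (c w) * Sch w) \<in> Q"
      using schubert_product[OF xc, of "Sch z"] Q0 by (auto simp: U_def c_def)
    ultimately have "Sch z * Sch x - (Sch z * Sch x - (\<Sum>w\<in>U. poly_const (c w) * Sch w)) \<in> Q" by (rule Qdiff)
    hence "(\<Sum>w\<in>U. poly_const (c w) * Sch w) \<in> Q" by simp
    hence "poly_const \<kappa> * Sch (x \<otimes> z) + (\<Sum>w\<in>U - {x \<otimes> z}. poly_const (c w) * Sch w) \<in> Q"
      using xzU finU by (simp add: sum.remove cxz)
    moreover have "(\<Sum>w\<in>U - {x \<otimes> z}. poly_const (c w) * Sch w) \<in> Q" by (rule Qsum) (rule other)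
    ultimately have "poly_const \<kappa> * Sch (x \<otimes> z) \<in> Q" using Qdiff by fastforce
    from Qmult[OF this, of "poly_const (inverse \<kappa>)"] show ?case
      using kappa_neq_0 by (simp add: z_def poly_const_simps flip: mult.assoc poly_const_simps(6))
  qed
  moreover obtain x zs where "x \<in> min_coset_reps W S J" "zs \<in> lists J" "reduced_word W S (wprod zs) zs"
    "u = x \<otimes> wprod zs" "len u = len x + length zs" "v \<preceq> x"
    using coset_decomposition[OF J u(1)] v u(2) by blast
  ultimately show ?thesis by simp
qed

end

section \<open>The coinvariant algebra\<close>

context hiller
begin

abbreviation "coinv \<equiv> coinvariant_algebra W \<rho>"
abbreviation "cl \<equiv> coinv_class W \<rho>"

lemma cl_hom: "ring_hom_ring poly_ring coinv cl"
proof -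
  interpret ideal Iinv poly_ring by (rule ideal_Iinv)
  have "cl = (\<lambda>f. Iinv +>\<^bsub>poly_ring\<^esub> f)" by (simp add: coinv_class_def fun_eq_iff)
  thus ?thesis unfolding coinvariant_algebra_def using rcos_ring_hom_ring by simp
qed

lemma cring_coinv: "cring coinv"
  unfolding coinvariant_algebra_def
  by (rule ideal.quotient_is_cring[OF ideal_Iinv cring_poly_ring])

lemma cl_closed [simp]: "cl f \<in> carrier coinv"
  and cl_add: "cl (f + g) = cl f \<oplus>\<^bsub>coinv\<^esub> cl g"
  and cl_mult: "cl (f * g) = cl f \<otimes>\<^bsub>coinv\<^esub> cl g"
  and cl_0: "cl 0 = \<zero>\<^bsub>coinv\<^esub>"
proof -
  interpret ring_hom_ring poly_ring coinv cl by (rule cl_hom)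
  show "cl f \<in> carrier coinv" "cl (f + g) = cl f \<oplus>\<^bsub>coinv\<^esub> cl g" "cl (f * g) = cl f \<otimes>\<^bsub>coinv\<^esub> cl g"
    "cl 0 = \<zero>\<^bsub>coinv\<^esub>"
    using hom_closed[of f] hom_add[of f g] hom_mult[of f g] hom_zero by simp_all
qed

lemma cl_surj: "x \<in> carrier coinv \<Longrightarrow> \<exists>f. x = cl f"
  by (auto simp: coinvariant_algebra_def FactRing_def A_RCOSETS_def' coinv_class_def)

lemma cl_eq_0: "f \<in> Iinv \<Longrightarrow> cl f = cl 0"
proof -
  interpret ideal Iinv poly_ring by (rule ideal_Iinv)
  assume "f \<in> Iinv"
  thus ?thesis unfolding coinv_class_def using a_rcos_const Iinv_closed(3) by simp
qed

lemma cl_eqI: "f - g \<in> Iinv \<Longrightarrow> cl f = cl g"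
  using cl_add[of "f - g" g] cl_eq_0[of "f - g"] cl_add[of 0 g] by simp

section \<open>Linear spans and ideals in the quotient\<close>

abbreviation "scaled c a \<equiv> cl (poly_const (c a)) \<otimes>\<^bsub>coinv\<^esub> a"

lemma coinv_spanE:
  assumes x: "x \<in> coinv_span W \<rho> A" and A: "A \<subseteq> carrier coinv" "A \<subseteq> M"
    and M: "cl 0 \<in> M" "\<And>x y. x \<in> M \<Longrightarrow> y \<in> M \<Longrightarrow> x \<oplus>\<^bsub>coinv\<^esub> y \<in> M"
      "\<And>k x. x \<in> M \<Longrightarrow> cl (poly_const k) \<otimes>\<^bsub>coinv\<^esub> x \<in> M"
  shows "x \<in> M"
proof -
  interpret Q: cring coinv by (rule cring_coinv)
  obtain F c where F: "x = finsum coinv (scaled c) F" "finite F" "F \<subseteq> A"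
    using x by (auto simp: coinv_span_def)
  from F(2,3) have "finsum coinv (scaled c) F \<in> M"
  proof (induction F rule: finite_induct)
    case empty
    show ?case using M(1) by (simp add: cl_0)
  next
    case (insert a F)
    have "finsum coinv (scaled c) (insert a F) = scaled c a \<oplus>\<^bsub>coinv\<^esub> finsum coinv (scaled c) F"
      using insert A by (intro Q.finsum_insert) auto
    thus ?case using insert A M by auto
  qed
  thus ?thesis using F by simp
qed

lemma coinv_span_0: "cl 0 \<in> coinv_span W \<rho> A"
proof -
  interpret Q: cring coinv by (rule cring_coinv)
  show ?thesis unfolding coinv_span_def cl_0 by (rule CollectI, rule exI[of _ "{}"]) simp
qed

lemma coinv_span_add_term:
  assumes x: "x \<in> coinv_span W \<rho> A" and A: "A \<subseteq> carrier coinv" "a \<in> A"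
  shows "cl (poly_const k) \<otimes>\<^bsub>coinv\<^esub> a \<oplus>\<^bsub>coinv\<^esub> x \<in> coinv_span W \<rho> A"
proof -
  interpret Q: cring coinv by (rule cring_coinv)
  obtain F c where F: "x = finsum coinv (scaled c) F" "finite F" "F \<subseteq> A"
    using x by (auto simp: coinv_span_def)
  \<comment> \<open>\<open>a\<close> may already be a summand, and the coefficient function lives on
    classes, so \<open>k\<close> is added to the present coefficient.\<close>
  define k' where "k' = (if a \<in> F then c a else 0)"
  define c' where "c' = c(a := k + k')"
  have a: "a \<in> carrier coinv" using A by blast
  have G: "finsum coinv (scaled c) (F - {a}) \<in> carrier coinv" (is "?y \<in> _")
    using F A by (intro Q.finsum_closed) auto
  have x': "x = cl (poly_const k') \<otimes>\<^bsub>coinv\<^esub> a \<oplus>\<^bsub>coinv\<^esub> ?y"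
  proof (cases "a \<in> F")
    case True
    hence "x = finsum coinv (scaled c) (insert a (F - {a}))" using F by (simp add: insert_absorb)
    also have "\<dots> = scaled c a \<oplus>\<^bsub>coinv\<^esub> ?y" using F A a by (intro Q.finsum_insert) auto
    finally show ?thesis using True by (simp add: k'_def)
  next
    case False
    hence "?y = x" using F by simp
    thus ?thesis using False a G by (simp add: k'_def poly_const_simps cl_0)
  qed
  have "finsum coinv (scaled c') (insert a (F - {a})) = scaled c' a \<oplus>\<^bsub>coinv\<^esub> finsum coinv (scaled c') (F - {a})"
    using F A a by (intro Q.finsum_insert) auto
  also have "finsum coinv (scaled c') (F - {a}) = ?y"
    using F A by (intro Q.finsum_cong') (auto simp: c'_def)
  also have "scaled c' a \<oplus>\<^bsub>coinv\<^esub> ?y = cl (poly_const k) \<otimes>\<^bsub>coinv\<^esub> a \<oplus>\<^bsub>coinv\<^esub> x"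
    unfolding x' using a G by (simp add: c'_def poly_const_simps cl_add Q.l_distr Q.a_assoc)
  finally have "cl (poly_const k) \<otimes>\<^bsub>coinv\<^esub> a \<oplus>\<^bsub>coinv\<^esub> x = finsum coinv (scaled c') (insert a (F - {a}))" ..
  moreover have "finite (insert a (F - {a}))" "insert a (F - {a}) \<subseteq> A" using F A by auto
  ultimately show ?thesis unfolding coinv_span_def by blast
qed

text \<open>The span above \<open>v\<close> pulled back to polynomials, so that closure properties
  can be proved with ordinary sums rather than \<open>finsum\<close> in the quotient.\<close>

definition upper_span :: "'g \<Rightarrow> ('n, 'k) mpoly set" where
  "upper_span v = {f. \<exists>c. f - (\<Sum>u\<in>{u \<in> carrier W. v \<preceq> u}. poly_const (c u) * Sch u) \<in> Iinv}"

lemma upper_span_Iinv: "f \<in> Iinv \<Longrightarrow> f \<in> upper_span v"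
  unfolding upper_span_def by (rule CollectI, rule exI[of _ "\<lambda>_. 0"]) (simp add: poly_const_simps)

lemma upper_span_add:
  assumes "f \<in> upper_span v" "g \<in> upper_span v" shows "f + g \<in> upper_span v"
proof -
  let ?U = "{u \<in> carrier W. v \<preceq> u}"
  obtain c d where "f - (\<Sum>u\<in>?U. poly_const (c u) * Sch u) \<in> Iinv" "g - (\<Sum>u\<in>?U. poly_const (d u) * Sch u) \<in> Iinv"
    using assms by (auto simp: upper_span_def)
  from Iinv_closed(1)[OF this] show ?thesis
    unfolding upper_span_def
    by (intro CollectI exI[of _ "\<lambda>u. c u + d u"]) (simp add: poly_const_simps sum.distrib algebra_simps)
qed

lemma upper_span_const_mult:
  assumes "f \<in> upper_span v" shows "poly_const k * f \<in> upper_span v"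
proof -
  let ?U = "{u \<in> carrier W. v \<preceq> u}"
  obtain c where "f - (\<Sum>u\<in>?U. poly_const (c u) * Sch u) \<in> Iinv"
    using assms by (auto simp: upper_span_def)
  from Iinv_closed(2)[OF this, of "poly_const k"] show ?thesis
    unfolding upper_span_def
    by (intro CollectI exI[of _ "\<lambda>u. k * c u"])
       (simp add: poly_const_simps sum_distrib_left right_diff_distrib mult.assoc)
qed

lemma upper_span_sum: "(\<And>x. x \<in> A \<Longrightarrow> f x \<in> upper_span v) \<Longrightarrow> (\<Sum>x\<in>A. f x) \<in> upper_span v"
  by (induction A rule: infinite_finite_induct)
     (auto intro: upper_span_add upper_span_Iinv Iinv_closed)

lemma upper_span_Sch:
  assumes "u \<in> carrier W" "v \<preceq> u" shows "Sch u \<in> upper_span v"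
proof -
  have "(\<Sum>w\<in>{w \<in> carrier W. v \<preceq> w}. poly_const (if w = u then 1 else 0) * Sch w)
      = (\<Sum>w\<in>{w \<in> carrier W. v \<preceq> w}. if w = u then Sch u else 0)"
    by (rule sum.cong) (auto simp: poly_const_simps)
  also have "\<dots> = Sch u" using assms finite_W by (simp add: sum.delta)
  finally show ?thesis
    unfolding upper_span_def by (intro CollectI exI[of _ "\<lambda>w. if w = u then 1 else 0"]) (simp add: Iinv_closed)
qed

text \<open>Multiples of \<open>Sch u\<close> expand into terms above \<open>u\<close>, and Bruhat
  order is transitive.\<close>

lemma upper_span_mult:
  assumes "f \<in> upper_span v" shows "g * f \<in> upper_span v"
proof -
  have S: "g * Sch u \<in> upper_span v" if "u \<in> carrier W" "v \<preceq> u" for u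
  proof -
    let ?s = "\<Sum>w\<in>{w \<in> carrier W. u \<preceq> w}. poly_const (inverse \<kappa> * lookup (E w (g * Sch u)) 0) * Sch w"
    have "?s \<in> upper_span v"
      using that bruhat_trans by (intro upper_span_sum upper_span_const_mult upper_span_Sch) auto
    from upper_span_add[OF upper_span_Iinv[OF schubert_product[OF that(1), of g]] this] show ?thesis by simp
  qed
  let ?U = "{u \<in> carrier W. v \<preceq> u}"
  obtain c where c: "f - (\<Sum>u\<in>?U. poly_const (c u) * Sch u) \<in> Iinv"
    using assms by (auto simp: upper_span_def)
  have "g * f = g * (f - (\<Sum>u\<in>?U. poly_const (c u) * Sch u)) + (\<Sum>u\<in>?U. poly_const (c u) * (g * Sch u))"
    by (simp add: right_diff_distrib sum_distrib_left mult.left_commute)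
  also have "\<dots> \<in> upper_span v"
    by (rule upper_span_add[OF upper_span_Iinv[OF Iinv_closed(2)[OF c]]])
       (intro upper_span_sum upper_span_const_mult, use S in auto)
  finally show ?thesis .
qed

lemma schubert_ideal_eq: "schubert_ideal W S \<rho> \<iota> \<Phi> C v = cl ` upper_span v"
proof
  let ?A = "{schubert_class W S \<rho> \<iota> \<Phi> C u |u. u \<in> carrier W \<and> v \<preceq> u}"
  have A: "?A \<subseteq> carrier coinv" by (auto simp: schubert_class_def)
  show "schubert_ideal W S \<rho> \<iota> \<Phi> C v \<subseteq> cl ` upper_span v"
  proof
    fix x assume "x \<in> schubert_ideal W S \<rho> \<iota> \<Phi> C v"
    hence "x \<in> coinv_span W \<rho> ?A" by (simp add: schubert_ideal_def)
    thus "x \<in> cl ` upper_span v"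
    proof (rule coinv_spanE[OF _ A])
      show "?A \<subseteq> cl ` upper_span v" by (auto simp: schubert_class_def intro: upper_span_Sch)
      show "cl 0 \<in> cl ` upper_span v" by (intro imageI upper_span_Iinv Iinv_closed)
      fix x assume "x \<in> cl ` upper_span v"
      then obtain f where f: "f \<in> upper_span v" "x = cl f" by blast
      show "cl (poly_const k) \<otimes>\<^bsub>coinv\<^esub> x \<in> cl ` upper_span v" for k
        unfolding f(2) cl_mult[symmetric] by (intro imageI upper_span_const_mult f(1))
      fix y assume "y \<in> cl ` upper_span v"
      then obtain g where g: "g \<in> upper_span v" "y = cl g" by blast
      show "x \<oplus>\<^bsub>coinv\<^esub> y \<in> cl ` upper_span v"
        unfolding f(2) g(2) cl_add[symmetric] by (intro imageI upper_span_add f(1) g(1))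
    qed
  qed
  show "cl ` upper_span v \<subseteq> schubert_ideal W S \<rho> \<iota> \<Phi> C v"
  proof
    fix x assume "x \<in> cl ` upper_span v"
    then obtain f c where f: "x = cl f" "f - (\<Sum>u\<in>{u \<in> carrier W. v \<preceq> u}. poly_const (c u) * Sch u) \<in> Iinv"
      by (auto simp: upper_span_def)
    have "cl (\<Sum>u\<in>B. poly_const (c u) * Sch u) \<in> coinv_span W \<rho> ?A"
      if "finite B" "B \<subseteq> {u \<in> carrier W. v \<preceq> u}" for B
      using that
    proof (induction B rule: finite_induct)
      case empty
      show ?case by (simp add: coinv_span_0)
    next
      case (insert u B)
      have "schubert_class W S \<rho> \<iota> \<Phi> C u \<in> ?A" using insert.prems by auto
      from coinv_span_add_term[OF insert.IH A this, of "c u"] show ?case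
        using insert by (simp add: cl_add cl_mult schubert_class_def)
    qed
    from this[OF _ subset_refl] have "cl f \<in> coinv_span W \<rho> ?A" using finite_W cl_eqI[OF f(2)] by simp
    thus "x \<in> schubert_ideal W S \<rho> \<iota> \<Phi> C v" by (simp add: f(1) schubert_ideal_def)
  qed
qed

lemma ideal_schubert_ideal: "ideal (cl ` upper_span v) coinv"
proof -
  interpret Q: cring coinv by (rule cring_coinv)
  have mult: "x \<otimes>\<^bsub>coinv\<^esub> a \<in> cl ` upper_span v" if ax: "a \<in> cl ` upper_span v" "x \<in> carrier coinv" for a x
  proof -
    obtain f where f: "f \<in> upper_span v" "a = cl f" using ax(1) by blast
    obtain g where g: "x = cl g" using cl_surj[OF ax(2)] by blast
    show ?thesis unfolding f(2) g cl_mult[symmetric] by (intro imageI upper_span_mult f(1))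
  qed
  show ?thesis
  proof (rule idealI[OF Q.ring_axioms])
    show "subgroup (cl ` upper_span v) (add_monoid coinv)"
    proof (rule Q.add.subgroupI)
      show "cl ` upper_span v \<subseteq> carrier coinv" by auto
      show "cl ` upper_span v \<noteq> {}" using upper_span_Iinv[OF Iinv_closed(3)] by blast
      fix a assume a: "a \<in> cl ` upper_span v"
      hence ac: "a \<in> carrier coinv" by auto
      \<comment> \<open>Negation is multiplication by minus one, so it is covered by closure under
        ring multiplication.\<close>
      have "\<ominus>\<^bsub>coinv\<^esub> a = (\<ominus>\<^bsub>coinv\<^esub> \<one>\<^bsub>coinv\<^esub>) \<otimes>\<^bsub>coinv\<^esub> a" using ac by (simp add: Q.l_minus)
      thus "\<ominus>\<^bsub>coinv\<^esub> a \<in> cl ` upper_span v" using mult[OF a, of "\<ominus>\<^bsub>coinv\<^esub> \<one>\<^bsub>coinv\<^esub>"] by simp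
      fix b assume "b \<in> cl ` upper_span v"
      with a obtain f g where f: "f \<in> upper_span v" "g \<in> upper_span v" "a = cl f" "b = cl g" by blast
      show "a \<oplus>\<^bsub>coinv\<^esub> b \<in> cl ` upper_span v"
        unfolding f(3,4) cl_add[symmetric] by (intro imageI upper_span_add f(1,2))
    qed
    show "x \<otimes>\<^bsub>coinv\<^esub> a \<in> cl ` upper_span v" "a \<otimes>\<^bsub>coinv\<^esub> x \<in> cl ` upper_span v"
      if "a \<in> cl ` upper_span v" "x \<in> carrier coinv" for a x
      using mult[OF that] Q.m_comm[of a x] that by auto
  qed
qed

lemma schubert_ideal_generated:
  assumes J: "J \<subseteq> S" and v: "v \<in> min_coset_reps W S J"
  shows "schubert_ideal W S \<rho> \<iota> \<Phi> C v =
    Idl\<^bsub>coinv\<^esub> {schubert_class W S \<rho> \<iota> \<Phi> C u |u. u \<in> min_coset_reps W S J \<and> v \<preceq> u}"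
proof
  interpret Q: cring coinv by (rule cring_coinv)
  let ?G = "{schubert_class W S \<rho> \<iota> \<Phi> C u |u. u \<in> min_coset_reps W S J \<and> v \<preceq> u}"
  have G: "?G \<subseteq> carrier coinv" by (auto simp: schubert_class_def)
  interpret K: ideal "Idl\<^bsub>coinv\<^esub> ?G" coinv by (rule Q.genideal_ideal[OF G])
  show "Idl\<^bsub>coinv\<^esub> ?G \<subseteq> schubert_ideal W S \<rho> \<iota> \<Phi> C v"
    unfolding schubert_ideal_eq
    by (rule Q.genideal_minimal[OF ideal_schubert_ideal])
       (auto simp: schubert_class_def min_coset_reps_def intro: upper_span_Sch)
  \<comment> \<open>The generated ideal pulled back to polynomials; it contains \<open>Iinv\<close>,
    as \<open>schubert_in_generated\<close> requires.\<close>
  let ?Q = "{f. cl f \<in> Idl\<^bsub>coinv\<^esub> ?G}"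
  have zero: "cl 0 \<in> Idl\<^bsub>coinv\<^esub> ?G"
    using additive_subgroup.zero_closed[OF K.additive_subgroup_axioms] by (simp add: cl_0)
  have add: "f + g \<in> ?Q" if "f \<in> ?Q" "g \<in> ?Q" for f g
    using that additive_subgroup.a_closed[OF K.additive_subgroup_axioms] by (simp add: cl_add)
  have mult: "g * f \<in> ?Q" if "f \<in> ?Q" for f g
    using that K.I_l_closed by (simp add: cl_mult)
  have Iq: "Iinv \<subseteq> ?Q" using cl_eq_0 zero by auto
  have gens: "Sch x \<in> ?Q" if "x \<in> min_coset_reps W S J" "v \<preceq> x" for x
    using Q.genideal_self[OF G] that by (auto simp: schubert_class_def)
  have Sq: "Sch u \<in> ?Q" if "u \<in> carrier W" "v \<preceq> u" for u
    by (rule schubert_in_generated[OF J v Iq add mult gens that])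
  show "schubert_ideal W S \<rho> \<iota> \<Phi> C v \<subseteq> Idl\<^bsub>coinv\<^esub> ?G"
  proof
    fix x assume "x \<in> schubert_ideal W S \<rho> \<iota> \<Phi> C v"
    then obtain f c where f: "x = cl f" "f - (\<Sum>u\<in>{u \<in> carrier W. v \<preceq> u}. poly_const (c u) * Sch u) \<in> Iinv"
      unfolding schubert_ideal_eq by (auto simp: upper_span_def)
    have "(\<Sum>u\<in>B. poly_const (c u) * Sch u) \<in> ?Q" if "finite B" "B \<subseteq> {u \<in> carrier W. v \<preceq> u}" for B
      using that
    proof (induction B rule: finite_induct)
      case (insert u B)
      have "poly_const (c u) * Sch u \<in> ?Q" using mult[OF Sq] insert.prems by auto
      from add[OF this insert.IH] show ?case using insert by simp
    qed (use zero in simp)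
    from this[OF _ subset_refl] show "x \<in> Idl\<^bsub>coinv\<^esub> ?G"
      using finite_W cl_eqI[OF f(2)] f(1) by simp
  qed
qed

end

theorem theorem2p3:
  fixes W :: "('g, 'm) monoid_scheme"
    and S J :: "'g set"
    and \<iota> :: "'k::field \<Rightarrow> real"
    and \<rho> :: "'g \<Rightarrow> 'k ^ 'n::finite \<Rightarrow> 'k ^ 'n"
    and \<Phi> :: "('k ^ 'n \<Rightarrow> 'k) set"
    and C :: "('k ^ 'n) set"
    and v :: 'g
  assumes "coxeter_system W S"
    and "finite (carrier W)"
    and "irreducible_coxeter W S"
    and "real_embedding \<iota>"
    and "reflection_representation W S \<rho>"
    and "root_system W \<rho> \<Phi>"
    and "chamber \<iota> \<Phi> C"
    and "S = wall_reflections W \<rho> \<iota> \<Phi> C"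
    and "J \<subseteq> S"
    and "v \<in> min_coset_reps W S J"
  shows "schubert_ideal W S \<rho> \<iota> \<Phi> C v =
    Idl\<^bsub>coinvariant_algebra W \<rho>\<^esub>
      {schubert_class W S \<rho> \<iota> \<Phi> C u |u. u \<in> min_coset_reps W S J \<and> bruhat_le W S v u}"
proof -
  interpret hiller W S \<iota> \<rho> \<Phi> C by unfold_locales (use assms in auto)
  show ?thesis by (rule schubert_ideal_generated) (use assms in auto)
qed

end
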